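(* Let $\mathfrak{a},\mathfrak{b}>0$ be real, $\omega_1=\mathfrak{a}-i\mathfrak{b}$, $\omega_2=\mathfrak{a}+i\mathfrak{b}$, $\Lambda=\{2m\omega_1+2n\omega_2: m,n\in\mathbb{Z}\}$, $T=\mathbb{C}/\Lambda$, and let $|T|$ be the area of $T$. Let $\mathfrak{c}$ and $\zeta$ be the constant and the symmetric zeta-function attached to $\Lambda$ as in the context, and let $$\mathfrak{Z}(w)=-\frac{1}{2\pi}\,\mathrm{Re}\int_0^{w}\mathfrak{c}\,\zeta(z)\,dz .$$ Let $A,B,C$ be the unique real constants such that $\hat{\mathfrak{Z}}(z)=\mathfrak{Z}(z)+Ax^2+By^2+Cxy$ (with $x=\mathrm{Re}\,z$, $y=\mathrm{Im}\,z$) is doubly periodic with periods $2\omega_1$ and $2\omega_2$. Put $$G=2\mathfrak{Z}+Ax^2+By^2 .$$ Then $G$ is the Green's function of $T$ with $G(0)=0$, and $$\Delta G=-\sum_{m,n\in\mathbb{Z}}\delta_{2\mathfrak{a}+2m\omega_1+2n\omega_2}+\frac{1}{|T|}\quad\text{in }\mathbb{C},$$ where $\delta_p$ is the Dirac delta distribution at $p$.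
   Context: Let $\boldsymbol{\wp}$ denote the classical Weierstrass P-function of $\Lambda$, $$\boldsymbol{\wp}(z)=\frac1{z^2}+\sum_{\lambda\in\Lambda\setminus\{0\}}\Bigl(\frac1{(z-\lambda)^2}-\frac1{\lambda^2}\Bigr).$$ Put $e_1=\boldsymbol{\wp}(\omega_1)$, $e_2=\boldsymbol{\wp}(\omega_2)$, $e_3=\boldsymbol{\wp}(\omega_1+\omega_2)$. Let $\mathfrak{c}$ be the square root of $(e_1-e_3)(e_3-e_2)$ with $\mathfrak{c}=-i|\mathfrak{c}|$. Karcher's symmetric Weierstrass P-function is $$\wp(z)=\frac{\boldsymbol{\wp}(z-\omega_1-\omega_2)-e_3}{\mathfrak{c}},\qquad z\in\mathbb{C},$$ which has a double zero at $0$ and double poles exactly at the points of $\omega_1+\omega_2+\Lambda=2\mathfrak{a}+\Lambda$. The symmetric zeta-function is its primitive $\zeta(z)=-\int_0^z\wp(u)\,du$, a meromorphic function on $\mathbb{C}$ with simple poles at the points of $2\mathfrak{a}+\Lambda$. In the definition of $\mathfrak{Z}$, integration is along any path from $0$ to $w$ avoiding the poles of $\zeta$ (the real part does not depend on the path), and $\mathfrak{Z}$ takes the value $\infty$ at the points of $2\mathfrak{a}+\Lambda$. A Green's function of $T$ with pole at $p\in T$ is a solution on $T$ of $\Delta G=-\delta_p+1/|T|$, unique up to an additive constant, regarded as a doubly periodic function on $\mathbb{C}$ (with periods $2\omega_1,2\omega_2$); here the pole is the class of $2\mathfrak{a}$ and the additive constant is fixed by $G(0)=0$ instead of $\int_T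 G\,dA=0$.
   Formalization: The formal theorem takes G = 𝔷 + Ax² + By² (𝔷 the fraktur Z) instead of the printed G = 2𝔷 + Ax² + By², which is false for all 𝔞, 𝔟 > 0: since 𝔠ζ has residue 1, its Laplacian would have point masses −2. *)

theory Defs
  imports "HOL-Complex_Analysis.Complex_Analysis"
begin

section \<open>Lattices and tori\<close>

definition lattice :: "complex \<Rightarrow> complex \<Rightarrow> complex set" where
  "lattice p q = {of_int m * p + of_int n * q | m n. True}"

definition doubly_periodic :: "complex \<Rightarrow> complex \<Rightarrow> (complex \<Rightarrow> 'a) \<Rightarrow> bool" where
  "doubly_periodic p q f \<longleftrightarrow> (\<forall>z. f (z + p) = f z \<and> f (z + q) = f z)"

definition fundamental_domain :: "complex \<Rightarrow> complex \<Rightarrow> complex set" where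
  "fundamental_domain p q =
     {of_real s * p + of_real t * q | s t. 0 \<le> s \<and> s < 1 \<and> 0 \<le> t \<and> t < 1}"

definition torus_area :: "complex \<Rightarrow> complex \<Rightarrow> real" where
  "torus_area p q = measure lborel (fundamental_domain p q)"


section \<open>Smooth functions and distributions\<close>

fun Ck :: "nat \<Rightarrow> (complex \<Rightarrow> real) \<Rightarrow> bool" where
  "Ck 0 f \<longleftrightarrow> continuous_on UNIV f"
| "Ck (Suc k) f \<longleftrightarrow>
     (\<forall>z. f differentiable (at z)) \<and> (\<forall>v. Ck k (\<lambda>z. frechet_derivative f (at z) v))"

definition smooth :: "(complex \<Rightarrow> real) \<Rightarrow> bool" where
  "smooth f \<longleftrightarrow> (\<forall>k. Ck k f)"

definition test_function :: "(complex \<Rightarrow> real) \<Rightarrow> bool" where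
  "test_function \<phi> \<longleftrightarrow> smooth \<phi> \<and> compact (closure {z. \<phi> z \<noteq> 0})"

definition laplacian :: "(complex \<Rightarrow> real) \<Rightarrow> complex \<Rightarrow> real" where
  "laplacian \<phi> z =
     (\<Sum>e\<in>{1, \<i>}. frechet_derivative (\<lambda>w. frechet_derivative \<phi> (at w) e) (at z) e)"

definition dirac :: "complex \<Rightarrow> (complex \<Rightarrow> real) \<Rightarrow> real" where
  "dirac p \<phi> = \<phi> p"

definition locally_integrable :: "(complex \<Rightarrow> real) \<Rightarrow> bool" where
  "locally_integrable f \<longleftrightarrow> (\<forall>K. compact K \<longrightarrow> set_integrable lborel K f)"

definition has_distr_laplacian ::
    "(complex \<Rightarrow> ereal) \<Rightarrow> ((complex \<Rightarrow> real) \<Rightarrow> real) \<Rightarrow> bool" where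
  "has_distr_laplacian G T \<longleftrightarrow>
     locally_integrable (\<lambda>z. real_of_ereal (G z)) \<and>
     (\<forall>\<phi>. test_function \<phi> \<longrightarrow> (LINT z|lborel. real_of_ereal (G z) * laplacian \<phi> z) = T \<phi>)"

text \<open>
  Functions on the torus are doubly periodic functions on the plane. Since the torus is
  compact, every smooth function on it is a test function. A solution of the equation is only
  determined almost everywhere; continuity (with values in the extended reals) selects the
  representative whose value at a point is meant when the additive constant is fixed.
\<close>

definition is_green_function :: "complex \<Rightarrow> complex \<Rightarrow> complex \<Rightarrow> (complex \<Rightarrow> ereal) \<Rightarrow> bool" where
  "is_green_function p q x0 G \<longleftrightarrow>
     doubly_periodic p q G \<and> continuous_on UNIV G \<and>
     set_integrable lborel (fundamental_domain p q) (\<lambda>z. real_of_ereal (G z)) \<and>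
     (\<forall>\<phi>. smooth \<phi> \<and> doubly_periodic p q \<phi> \<longrightarrow>
        (LINT z:fundamental_domain p q|lborel. real_of_ereal (G z) * laplacian \<phi> z) =
          - dirac x0 \<phi> + 1 / torus_area p q * (LINT z:fundamental_domain p q|lborel. \<phi> z))"


section \<open>The symmetric Weierstrass functions of a rhombic lattice\<close>

definition weierstrass_P :: "complex set \<Rightarrow> complex \<Rightarrow> complex" where
  "weierstrass_P L z = 1 / z^2 + (\<Sum>\<^sub>\<infinity>l\<in>L - {0}. 1 / (z - l)^2 - 1 / l^2)"

definition \<omega>\<^sub>1 :: "real \<Rightarrow> real \<Rightarrow> complex" where
  "\<omega>\<^sub>1 a b = of_real a - \<i> * of_real b"

definition \<omega>\<^sub>2 :: "real \<Rightarrow> real \<Rightarrow> complex" where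
  "\<omega>\<^sub>2 a b = of_real a + \<i> * of_real b"

definition \<Lambda> :: "real \<Rightarrow> real \<Rightarrow> complex set" where
  "\<Lambda> a b = lattice (2 * \<omega>\<^sub>1 a b) (2 * \<omega>\<^sub>2 a b)"

definition e\<^sub>1 :: "real \<Rightarrow> real \<Rightarrow> complex" where
  "e\<^sub>1 a b = weierstrass_P (\<Lambda> a b) (\<omega>\<^sub>1 a b)"

definition e\<^sub>2 :: "real \<Rightarrow> real \<Rightarrow> complex" where
  "e\<^sub>2 a b = weierstrass_P (\<Lambda> a b) (\<omega>\<^sub>2 a b)"

definition e\<^sub>3 :: "real \<Rightarrow> real \<Rightarrow> complex" where
  "e\<^sub>3 a b = weierstrass_P (\<Lambda> a b) (\<omega>\<^sub>1 a b + \<omega>\<^sub>2 a b)"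

definition sym_c :: "real \<Rightarrow> real \<Rightarrow> complex" where
  "sym_c a b =
     (THE c. c^2 = (e\<^sub>1 a b - e\<^sub>3 a b) * (e\<^sub>3 a b - e\<^sub>2 a b) \<and> c = - \<i> * of_real (cmod c))"

definition sym_P :: "real \<Rightarrow> real \<Rightarrow> complex \<Rightarrow> complex" where
  "sym_P a b z =
     (weierstrass_P (\<Lambda> a b) (z - \<omega>\<^sub>1 a b - \<omega>\<^sub>2 a b) - e\<^sub>3 a b) / sym_c a b"

definition sym_poles :: "real \<Rightarrow> real \<Rightarrow> complex set" where
  "sym_poles a b = {of_real (2 * a) + l | l. l \<in> \<Lambda> a b}"

text \<open>
  All values of the integral of \<^term>\<open>f\<close> from \<open>0\<close> to \<open>w\<close> along paths in
  \<^term>\<open>S\<close>. In the two definitions below, \<^const>\<open>the_elem\<close> expresses that (the real part of)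
  this integral does not depend on the path.
\<close>

definition path_integral_values ::
    "complex set \<Rightarrow> (complex \<Rightarrow> complex) \<Rightarrow> complex \<Rightarrow> complex set" where
  "path_integral_values S f w =
     {contour_integral \<gamma> f | \<gamma>.
        valid_path \<gamma> \<and> path_image \<gamma> \<subseteq> S \<and> pathstart \<gamma> = 0 \<and> pathfinish \<gamma> = w}"

definition sym_zeta :: "real \<Rightarrow> real \<Rightarrow> complex \<Rightarrow> complex" where
  "sym_zeta a b z = - the_elem (path_integral_values (- sym_poles a b) (sym_P a b) z)"

definition sym_Z :: "real \<Rightarrow> real \<Rightarrow> complex \<Rightarrow> ereal" where
  "sym_Z a b w =
     (if w \<in> sym_poles a b then \<infinity>
      else ereal (- 1 / (2 * pi) *
        the_elem (Re ` path_integral_values (- sym_poles a b) (\<lambda>z. sym_c a b * sym_zeta a b z) w)))"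

definition sym_Z_hat :: "real \<Rightarrow> real \<Rightarrow> real \<Rightarrow> real \<Rightarrow> real \<Rightarrow> complex \<Rightarrow> ereal" where
  "sym_Z_hat a b A B C z =
     sym_Z a b z + ereal (A * (Re z)^2 + B * (Im z)^2 + C * Re z * Im z)"

text \<open>
  The source prints the factor \<open>2\<close> in front of \<^const>\<open>sym_Z\<close> here. With that factor the
  function is not doubly periodic and its Laplacian has point masses \<open>-2\<close>. The normalisation
  \<open>-1/(2\<pi>)\<close> of \<^const>\<open>sym_Z\<close> already gives point masses \<open>-1\<close>, so the factor must be \<open>1\<close>.
\<close>

definition sym_G :: "real \<Rightarrow> real \<Rightarrow> real \<Rightarrow> real \<Rightarrow> complex \<Rightarrow> ereal" where
  "sym_G a b A B z = sym_Z a b z + ereal (A * (Re z)^2 + B * (Im z)^2)"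

end

theory Submission
  imports Defs "HOL-Real_Asymp.Real_Asymp"
begin

text \<open>
  Twice integrating the Weierstrass function gives a function \<open>\<ZZ> + A x\<^sup>2 + B y\<^sup>2\<close> that near every
  compact set is \<open>- 1 / (2 \<pi>)\<close> times a finite sum of logarithms \<open>ln \<bar>z - p\<bar>\<close> over poles, plus the
  real part of a holomorphic function, plus the quadratic form. Hence its distributional Laplacian is
  \<open>2 A + 2 B\<close> minus the point masses at the poles, where \<open>\<Delta> ln \<bar>z\<bar> = 2 \<pi> \<delta>\<close> is obtained by mollifying the
  logarithm. The quasi-periods of the zeta-function at the two complex conjugate periods are complex
  conjugate, so a quadratic form without mixed term restores periodicity, without recourse to
  Legendre's relation. The identity on the torus follows from the one in the plane by means of a
  partition of unity made of cubic B-splines; testing it with the constant \<open>1\<close> yields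
  \<open>2 A + 2 B = 1 / \<bar>T\<bar>\<close>.
\<close>


subsection \<open>Lattice sums and the Weierstrass function\<close>

text \<open>\<open>sym_zeta\<close> and \<open>sym_Z\<close> are defined by \<open>the_elem\<close>,
  so path independence has to be established before anything else can be computed. The integrand of
  zeta has double poles without residues and hence a single-valued primitive. Zeta itself has
  residue 1 at each pole after multiplication by \<open>sym_c\<close>, so its integral is determined
  only up to multiples of 2 pi i; only the real part is a function, and
  \<open>ln (cmod (z - p))\<close> serves directly as the real primitive of
  \<open>1 / (z - p)\<close>. The factor \<open>sym_c\<close> cancels in \<open>sym_Z\<close>, but
  only if it is nonzero, since otherwise division makes \<open>sym_P\<close> vanish identically.
  This is why the values of the Weierstrass function at two half-periods must be told apart. The
  Laplacian identity is proved for compactly supported functions of class C^2, not only for test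
  functions: this admits splines, which are explicit piecewise polynomials, as cutoffs. On the torus
  they turn a periodic function into a compactly supported one.\<close>

text \<open>The exponent 3/2 is half of 3 and still exceeds 1: the product of two such factors, one
  for each lattice coordinate, will dominate the inverse cube of the norm.\<close>

lemma summable_on_int_powr: "(\<lambda>m::int. (1 + \<bar>real_of_int m\<bar>) powr (- (3/2))) summable_on UNIV"
proof -
  let ?f = "\<lambda>m::int. (1 + \<bar>real_of_int m\<bar>) powr (- (3/2))"
  have "summable (\<lambda>n. real n powr (- (3/2)))"
    by (simp add: summable_real_powr_iff)
  then have "summable (\<lambda>n. real (Suc n) powr (- (3/2)))"
    by (subst summable_Suc_iff)
  then have "(\<lambda>n. real (Suc n) powr (- (3/2))) summable_on UNIV"
    by (intro norm_summable_imp_summable_on) simp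
  then have nat: "(\<lambda>n. (1 + real n) powr (- (3/2))) summable_on UNIV"
    by simp
  have pos: "?f summable_on range int"
    by (subst summable_on_reindex) (use nat in \<open>auto simp: o_def\<close>)
  have neg: "?f summable_on range (\<lambda>n. - int n)"
    by (subst summable_on_reindex) (use nat in \<open>auto simp: o_def inj_on_def\<close>)
  have "?f summable_on (range int \<union> range (\<lambda>n. - int n))"
    using pos neg by (rule summable_on_union)
  moreover have "range int \<union> range (\<lambda>n. - int n) = UNIV"
  proof (rule UNIV_eq_I[symmetric])
    fix m :: int
    show "m \<in> range int \<union> range (\<lambda>n. - int n)"
      by (cases m rule: int_cases2) auto
  qed
  ultimately show ?thesis
    by (simp only:)
qed

lemma summable_on_int_pair_powr:
  "(\<lambda>(m::int, n::int). (1 + \<bar>real_of_int m\<bar>) powr (- (3/2)) * (1 + \<bar>real_of_int n\<bar>) powr (- (3/2)))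
     summable_on UNIV"
proof -
  let ?f = "\<lambda>m::int. (1 + \<bar>real_of_int m\<bar>) powr (- (3/2))"
  have "(\<lambda>(m, n). ?f m * ?f n) summable_on (Sigma UNIV (\<lambda>_. UNIV))"
  proof (rule summable_on_SigmaI)
    show "((\<lambda>n. case (m, n) of (m, n) \<Rightarrow> ?f m * ?f n) has_sum ?f m * infsum ?f UNIV) UNIV" for m
      using has_sum_cmult_right[OF has_sum_infsum[OF summable_on_int_powr]] by simp
    show "(\<lambda>m. ?f m * infsum ?f UNIV) summable_on UNIV"
      by (intro summable_on_cmult_left summable_on_int_powr)
  qed auto
  then show ?thesis by simp
qed

definition lat_pt :: "real \<Rightarrow> real \<Rightarrow> int \<times> int \<Rightarrow> complex" where
  "lat_pt a b = (\<lambda>(m, n). of_int m * (2 * \<omega>\<^sub>1 a b) + of_int n * (2 * \<omega>\<^sub>2 a b))"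

lemma Re_lat_pt: "Re (lat_pt a b (m, n)) = 2 * a * (m + n)"
  and Im_lat_pt: "Im (lat_pt a b (m, n)) = 2 * b * (n - m)"
  by (simp_all add: lat_pt_def \<omega>\<^sub>1_def \<omega>\<^sub>2_def algebra_simps)

lemma Lambda_eq: "\<Lambda> a b = range (lat_pt a b)"
  by (auto simp: \<Lambda>_def lattice_def lat_pt_def)

lemma inj_lat_pt:
  assumes "a > 0" "b > 0"
  shows "inj (lat_pt a b)"
proof (rule injI, clarify)
  fix m n m' n' assume eq: "lat_pt a b (m, n) = lat_pt a b (m', n')"
  have "2 * a * real_of_int (m + n) = 2 * a * real_of_int (m' + n')"
    using arg_cong[OF eq, of Re] by (simp add: Re_lat_pt)
  moreover have "2 * b * real_of_int (n - m) = 2 * b * real_of_int (n' - m')"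
    using arg_cong[OF eq, of Im] by (simp add: Im_lat_pt)
  ultimately have "m + n = m' + n'" "n - m = n' - m'"
    using assms by (simp_all only: mult_cancel_left of_int_eq_iff) auto
  then show "m = m' \<and> n = n'" by linarith
qed

text \<open>The real and imaginary parts are \<open>m + n\<close> and \<open>n - m\<close> up to the
  factors \<open>2 * a\<close> and \<open>2 * b\<close>, and these two integers control both
  \<open>m\<close> and \<open>n\<close>.\<close>

lemma norm_lat_pt_ge:
  fixes a b :: real and m n :: int
  assumes "a > 0" "b > 0"
  shows "min a b * \<bar>m\<bar> \<le> norm (lat_pt a b (m, n))" "min a b * \<bar>n\<bar> \<le> norm (lat_pt a b (m, n))"
proof -
  define c where "c = min a b"
  have c: "c > 0" "c \<le> a" "c \<le> b" using assms by (auto simp: c_def)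
  have R: "c * (2 * \<bar>m + n\<bar>) \<le> norm (lat_pt a b (m, n))"
  proof -
    have "c * (2 * \<bar>m + n\<bar>) \<le> a * (2 * \<bar>m + n\<bar>)"
      using c by (intro mult_right_mono) auto
    also have "\<dots> = \<bar>Re (lat_pt a b (m, n))\<bar>"
      using assms by (simp add: Re_lat_pt abs_mult)
    also have "\<dots> \<le> norm (lat_pt a b (m, n))" by (rule abs_Re_le_cmod)
    finally show ?thesis .
  qed
  have I: "c * (2 * \<bar>n - m\<bar>) \<le> norm (lat_pt a b (m, n))"
  proof -
    have "c * (2 * \<bar>n - m\<bar>) \<le> b * (2 * \<bar>n - m\<bar>)"
      using c by (intro mult_right_mono) auto
    also have "\<dots> = \<bar>Im (lat_pt a b (m, n))\<bar>"
      using assms by (simp add: Im_lat_pt abs_mult)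
    also have "\<dots> \<le> norm (lat_pt a b (m, n))" by (rule abs_Im_le_cmod)
    finally show ?thesis .
  qed
  have *: "c * \<bar>k\<bar> \<le> norm (lat_pt a b (m, n))" if "\<bar>k\<bar> \<le> \<bar>m + n\<bar> + \<bar>n - m\<bar>" for k
  proof -
    have "c * real_of_int \<bar>k\<bar> \<le> c * real_of_int (\<bar>m + n\<bar> + \<bar>n - m\<bar>)"
      using c that by (intro mult_left_mono) (simp_all only: of_int_le_iff less_imp_le)
    also have "\<dots> = c * (2 * \<bar>m + n\<bar>) / 2 + c * (2 * \<bar>n - m\<bar>) / 2"
      by (simp add: distrib_left)
    also have "\<dots> \<le> norm (lat_pt a b (m, n))"
      using R I by linarith
    finally show ?thesis .
  qed
  have "\<bar>m\<bar> \<le> \<bar>m + n\<bar> + \<bar>n - m\<bar>" "\<bar>n\<bar> \<le> \<bar>m + n\<bar> + \<bar>n - m\<bar>"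
    by (smt (verit))+
  from *[OF this(1)] *[OF this(2)]
  show "min a b * \<bar>m\<bar> \<le> norm (lat_pt a b (m, n))" "min a b * \<bar>n\<bar> \<le> norm (lat_pt a b (m, n))"
    unfolding c_def .
qed

lemma finite_Lambda_cball:
  assumes "a > 0" "b > 0"
  shows "finite {l \<in> \<Lambda> a b. norm l \<le> R}"
proof (rule finite_subset)
  define N where "N = \<lfloor>R / min a b\<rfloor>"
  show "{l \<in> \<Lambda> a b. norm l \<le> R} \<subseteq> lat_pt a b ` ({-N..N} \<times> {-N..N})"
  proof clarsimp
    fix l assume l: "l \<in> \<Lambda> a b" "norm l \<le> R"
    then obtain m n where mn: "l = lat_pt a b (m, n)"
      by (auto simp: Lambda_eq)
    have c: "min a b > 0" using assms by simp
    have "\<bar>real_of_int m\<bar> \<le> R / min a b" "\<bar>real_of_int n\<bar> \<le> R / min a b"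
      unfolding pos_le_divide_eq[OF c]
      using norm_lat_pt_ge[OF assms, where m = m and n = n] l(2)
      unfolding mn of_int_abs mult.commute[of _ "min a b"] by linarith+
    then have "\<bar>m\<bar> \<le> N" "\<bar>n\<bar> \<le> N"
      unfolding N_def by (auto simp: le_floor_iff)
    then show "l \<in> lat_pt a b ` ({- N..N} \<times> {- N..N})"
      unfolding mn by (intro imageI) auto
  qed
qed auto

lemma summable_on_Lambda:
  assumes "a > 0" "b > 0"
  shows "(\<lambda>l. 1 / norm l ^ 3) summable_on (\<Lambda> a b - {0})"
proof -
  define c where "c = min a b"
  have c: "c > 0" using assms by (simp add: c_def)
  let ?f = "\<lambda>m::int. (1 + \<bar>real_of_int m\<bar>) powr (- (3/2))"
  have "(\<lambda>x. 8 / c ^ 3 * (case x of (m::int, n::int) \<Rightarrow> ?f m * ?f n)) summable_on (UNIV - {(0,0)})"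
    by (intro summable_on_cmult_right summable_on_subset_banach[OF summable_on_int_pair_powr]) auto
  then have "(\<lambda>x. 1 / norm (lat_pt a b x) ^ 3) summable_on (UNIV - {(0,0)})"
  proof (rule summable_on_comparison_test)
    fix x :: "int \<times> int" assume x: "x \<in> UNIV - {(0, 0)}"
    obtain m n where mn: "x = (m, n)" by force
    define N where "N = norm (lat_pt a b x)"
    have mN: "c * \<bar>m\<bar> \<le> N" and nN: "c * \<bar>n\<bar> \<le> N"
      using norm_lat_pt_ge[OF assms, where m = m and n = n] unfolding N_def mn c_def .
    have "\<bar>m\<bar> \<ge> 1 \<or> \<bar>n\<bar> \<ge> 1" using x unfolding mn by auto
    then have "1 \<le> real_of_int \<bar>m\<bar> \<or> 1 \<le> real_of_int \<bar>n\<bar>" by linarith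
    then have "c * 1 \<le> c * real_of_int \<bar>m\<bar> \<or> c * 1 \<le> c * real_of_int \<bar>n\<bar>"
      using c by (auto intro: mult_left_mono)
    with mN nN have cN: "c * 1 \<le> N" by linarith
    then have N: "N > 0" using c by linarith
    \<comment> \<open>The summand 1 is absorbed by \<open>c \<le> N\<close>. This costs a factor 2
      in each bound, which becomes the 8 in the final constant.\<close>
    have le: "1 + \<bar>real_of_int m\<bar> \<le> 2 * N / c" "1 + \<bar>real_of_int n\<bar> \<le> 2 * N / c"
      unfolding pos_le_divide_eq[OF c] using mN nN cN by (simp_all add: algebra_simps)
    have "(2 * N / c) powr (-(3/2)) * (2 * N / c) powr (-(3/2)) \<le> ?f m * ?f n"
      using le by (intro mult_mono powr_mono2') auto
    also have "(2 * N / c) powr (-(3/2)) * (2 * N / c) powr (-(3/2)) = (2 * N / c) powr (-3)"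
      by (simp flip: powr_add)
    also have "\<dots> = 1 / (2 * N / c) ^ 3"
      using N c by (simp add: powr_minus powr_numeral divide_simps)
    also have "\<dots> = c ^ 3 / 8 * (1 / N ^ 3)"
      by (simp add: power_divide power_mult_distrib)
    finally show "1 / norm (lat_pt a b x) ^ 3 \<le> 8 / c ^ 3 * (case x of (m, n) \<Rightarrow> ?f m * ?f n)"
      using c by (simp add: mn N_def field_simps)
  qed auto
  then have "(\<lambda>l. 1 / norm l ^ 3) summable_on lat_pt a b ` (UNIV - {(0,0)})"
    by (subst summable_on_reindex) (auto simp: o_def intro: inj_on_subset[OF inj_lat_pt[OF assms]])
  moreover have "lat_pt a b ` (UNIV - {(0,0)}) = \<Lambda> a b - {0}"
  proof -
    have "lat_pt a b (0,0) = 0" by (simp add: lat_pt_def)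
    then show ?thesis
      using image_set_diff[OF inj_lat_pt[OF assms], of UNIV "{(0,0)}"] unfolding Lambda_eq by simp
  qed
  ultimately show ?thesis by simp
qed

text \<open>A locally finite subgroup with summable inverse cubes is enough for the series and its
  periodicity, so no generators are fixed here. Cocompactness is a separate hypothesis of the one
  lemma that applies Liouville's theorem.\<close>

locale cubic_lattice =
  fixes L :: "complex set"
  assumes zero_mem: "0 \<in> L"
    and add_mem: "x \<in> L \<Longrightarrow> y \<in> L \<Longrightarrow> x + y \<in> L"
    and uminus_mem: "x \<in> L \<Longrightarrow> - x \<in> L"
    and finite_cball: "finite {l \<in> L. norm l \<le> R}"
    and summable_cube: "(\<lambda>l. 1 / norm l ^ 3) summable_on (L - {0})"

lemma cubic_lattice_Lambda:
  assumes "a > 0" "b > 0"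
  shows "cubic_lattice (\<Lambda> a b)"
proof
  show "0 \<in> \<Lambda> a b" by (auto simp: \<Lambda>_def lattice_def intro!: exI[of _ 0])
  show "x + y \<in> \<Lambda> a b" if xy: "x \<in> \<Lambda> a b" "y \<in> \<Lambda> a b" for x y
  proof -
    from xy obtain m n m' n' where "x = lat_pt a b (m, n)" "y = lat_pt a b (m', n')"
      by (auto simp: Lambda_eq)
    then have "x + y = lat_pt a b (m + m', n + n')"
      by (simp add: lat_pt_def algebra_simps)
    then show ?thesis by (simp add: Lambda_eq)
  qed
  show "- x \<in> \<Lambda> a b" if x: "x \<in> \<Lambda> a b" for x
  proof -
    from x obtain m n where "x = lat_pt a b (m, n)"
      by (auto simp: Lambda_eq)
    then have "- x = lat_pt a b (- m, - n)"
      by (simp add: lat_pt_def algebra_simps)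
    then show ?thesis by (simp add: Lambda_eq)
  qed
qed (use finite_Lambda_cball summable_on_Lambda assms in auto)

section \<open>Terms of the Weierstrass series and the local form of their sum\<close>

definition wp_term :: "complex \<Rightarrow> complex \<Rightarrow> complex" where
  "wp_term z l = 1 / (z - l)\<^sup>2 - 1 / l\<^sup>2"

text \<open>The leading parts of the two fractions cancel, leaving \<open>z * (2 * l - z)\<close>
  over \<open>l\<^sup>2 * (z - l)\<^sup>2\<close>, which decays like the inverse cube of
  \<open>l\<close>. The bounds \<open>5/2 * norm l\<close> for \<open>2 * l - z\<close> and
  \<open>norm l / 2\<close> for \<open>z - l\<close> produce the constant 10.\<close>

lemma norm_wp_term_le:
  assumes "norm z \<le> R" "2 * R \<le> norm l" "l \<noteq> 0"
  shows "norm (wp_term z l) \<le> 10 * R * (1 / norm l ^ 3)"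
proof (cases "R = 0")
  case True
  then show ?thesis using assms by (simp add: wp_term_def)
next
  case False
  have R: "R > 0" using False assms norm_ge_zero[of z] by linarith
  have zl: "norm l / 2 \<le> norm (z - l)"
    using norm_triangle_ineq2[of l z] assms by (simp add: norm_minus_commute)
  have nz: "z \<noteq> l" using zl assms by auto
  have "wp_term z l = z * (2 * l - z) / (l\<^sup>2 * (z - l)\<^sup>2)"
    using nz assms by (simp add: wp_term_def divide_simps) (simp add: power2_eq_square algebra_simps)
  then have "norm (wp_term z l) = norm z * norm (2 * l - z) / (norm l ^ 2 * norm (z - l) ^ 2)"
    by (simp add: norm_mult norm_divide norm_power)
  also have "\<dots> \<le> R * (5/2 * norm l) / (norm l ^ 2 * (norm l / 2) ^ 2)"
  proof (intro frac_le mult_mono power_mono)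
    show "norm (2 * l - z) \<le> 5/2 * norm l"
      using norm_triangle_ineq4[of "2*l" z] assms by (simp add: norm_mult)
  qed (use assms zl R in auto)
  also have "\<dots> = 10 * R * (1 / norm l ^ 3)"
    using assms by (simp add: field_simps power2_eq_square power3_eq_cube)
  finally show ?thesis .
qed

context cubic_lattice
begin

lemma finite_ball_diff: "finite {l \<in> L - {0}. norm l < R}"
  by (rule finite_subset[OF _ finite_cball[of R]]) auto

lemma summable_wp_term: "(\<lambda>l. norm (wp_term z l)) summable_on (L - {0})"
proof -
  define R where "R = norm z"
  have "(\<lambda>l. norm (wp_term z l)) summable_on {l \<in> L - {0}. norm l < 2 * R}"
    by (intro summable_on_finite finite_ball_diff)
  moreover have "(\<lambda>l. norm (wp_term z l)) summable_on {l \<in> L - {0}. \<not> norm l < 2 * R}"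
  proof (rule summable_on_comparison_test)
    show "(\<lambda>l. 10 * R * (1 / norm l ^ 3)) summable_on {l \<in> L - {0}. \<not> norm l < 2 * R}"
      by (intro summable_on_cmult_right summable_on_subset_banach[OF summable_cube]) auto
    show "norm (wp_term z l) \<le> 10 * R * (1 / norm l ^ 3)" if "l \<in> {l \<in> L - {0}. \<not> norm l < 2 * R}" for l
      using that by (intro norm_wp_term_le) (auto simp: R_def)
  qed auto
  ultimately have "(\<lambda>l. norm (wp_term z l)) summable_on
      ({l \<in> L - {0}. norm l < 2 * R} \<union> {l \<in> L - {0}. \<not> norm l < 2 * R})"
    by (rule summable_on_union)
  moreover have "{l \<in> L - {0}. norm l < 2 * R} \<union> {l \<in> L - {0}. \<not> norm l < 2 * R} = L - {0}" by auto
  ultimately show ?thesis by simp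
qed

lemma weierstrass_P_eq: "weierstrass_P L z = 1 / z\<^sup>2 + infsum (wp_term z) (L - {0})"
  by (simp add: weierstrass_P_def wp_term_def[abs_def])

text \<open>The terms with \<open>2 * R \<le> norm l\<close> converge uniformly on the closed disc,
  so their sum is holomorphic inside; the finitely many remaining ones contribute double poles and
  constants. The equation holds even at lattice points, because the singular term is
  \<open>1 / 0 = 0\<close> on both sides.\<close>

lemma weierstrass_P_local:
  assumes "R > 0"
  obtains S U where "finite S" "L \<inter> ball 0 R \<subseteq> S" "S \<subseteq> L" "U holomorphic_on ball 0 R"
    "\<And>z. z \<in> ball 0 R \<Longrightarrow> weierstrass_P L z = (\<Sum>l\<in>S. 1 / (z - l)\<^sup>2) + U z"
proof -
  define S where "S = {l \<in> L. norm l < 2 * R}"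
  define T where "T = L - S"
  define V where "V z = infsum (wp_term z) T" for z
  have finS: "finite S"
    unfolding S_def by (rule finite_subset[OF _ finite_cball[of "2 * R"]]) auto
  have S0: "0 \<in> S" using assms zero_mem by (auto simp: S_def)
  have T: "l \<noteq> 0" "2 * R \<le> norm l" if "l \<in> T" for l
    using that S0 by (auto simp: T_def S_def)
  have "V holomorphic_on ball 0 R"
  proof (rule holomorphic_uniform_limit)
    show "uniform_limit (cball 0 R) (\<lambda>X z. \<Sum>l\<in>X. wp_term z l) V (finite_subsets_at_top T)"
      unfolding V_def
    proof (rule Weierstrass_m_test_general)
      show "(\<lambda>l. 10 * R * (1 / norm l ^ 3)) summable_on T"
        by (intro summable_on_cmult_right summable_on_subset_banach[OF summable_cube])
           (use T in \<open>auto simp: T_def\<close>)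
      show "norm (wp_term z l) \<le> 10 * R * (1 / norm l ^ 3)" if "l \<in> T" "z \<in> cball 0 R" for l z
        using that T[of l] by (intro norm_wp_term_le) auto
    qed
    have hol: "wp_term' holomorphic_on cball 0 R" if "l \<in> T" "wp_term' = (\<lambda>z. wp_term z l)" for l wp_term'
    proof -
      have "z - l \<noteq> 0" if "z \<in> cball 0 R" for z
        using that T[OF \<open>l \<in> T\<close>] assms by auto
      then show ?thesis unfolding that(2) wp_term_def
        by (intro holomorphic_intros) auto
    qed
    have "(\<lambda>z. \<Sum>l\<in>X. wp_term z l) holomorphic_on cball 0 R" if "X \<subseteq> T" for X
      by (intro holomorphic_on_sum hol) (use that in auto)
    then show "\<forall>\<^sub>F X in finite_subsets_at_top T. continuous_on (cball 0 R) (\<lambda>z. \<Sum>l\<in>X. wp_term z l) \<and>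
        (\<lambda>z. \<Sum>l\<in>X. wp_term z l) holomorphic_on ball 0 R"
      by (intro eventually_finite_subsets_at_top_weakI conjI)
         (auto intro: holomorphic_on_imp_continuous_on holomorphic_on_subset[OF _ ball_subset_cball])
  qed auto
  then have hol: "(\<lambda>z. V z - (\<Sum>l\<in>S - {0}. 1 / l\<^sup>2)) holomorphic_on ball 0 R"
    by (intro holomorphic_intros)
  have eq: "weierstrass_P L z = (\<Sum>l\<in>S. 1 / (z - l)\<^sup>2) + (V z - (\<Sum>l\<in>S - {0}. 1 / l\<^sup>2))" for z
  proof -
    have un: "L - {0} = (S - {0}) \<union> T" "(S - {0}) \<inter> T = {}"
      using S0 zero_mem by (auto simp: T_def S_def)
    have "infsum (wp_term z) (L - {0}) = infsum (wp_term z) (S - {0}) + infsum (wp_term z) T"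
      unfolding un(1)
      by (rule infsum_Un_disjoint)
         (use finS un summable_wp_term[THEN abs_summable_summable] T in
           \<open>auto intro: summable_on_subset_banach simp: T_def\<close>)
    also have "infsum (wp_term z) (S - {0}) = (\<Sum>l\<in>S - {0}. wp_term z l)"
      using finS by simp
    also have "\<dots> = (\<Sum>l\<in>S - {0}. 1 / (z - l)\<^sup>2) - (\<Sum>l\<in>S - {0}. 1 / l\<^sup>2)"
      by (simp add: wp_term_def sum_subtractf)
    finally show ?thesis
      using sum.remove[OF finS S0, of "\<lambda>l. 1 / (z - l)\<^sup>2"]
      by (simp add: weierstrass_P_eq V_def)
  qed
  show ?thesis
  proof (rule that[OF finS _ _ hol eq])
    show "L \<inter> ball 0 R \<subseteq> S" using assms by (auto simp: S_def)
  qed (auto simp: S_def)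
qed

lemma weierstrass_P_uminus: "weierstrass_P L (- z) = weierstrass_P L z"
proof -
  have "infsum (wp_term (- z)) (L - {0}) = infsum (wp_term z) (L - {0})"
    by (rule infsum_reindex_bij_witness[of _ uminus uminus])
       (auto simp: uminus_mem wp_term_def power2_eq_square algebra_simps)
  then show ?thesis by (simp add: weierstrass_P_eq)
qed

lemma weierstrass_P_cnj:
  assumes "\<And>l. l \<in> L \<Longrightarrow> cnj l \<in> L"
  shows "weierstrass_P L (cnj z) = cnj (weierstrass_P L z)"
proof -
  have "infsum (wp_term (cnj z)) (L - {0}) = infsum (\<lambda>l. cnj (wp_term z l)) (L - {0})"
    by (rule infsum_reindex_bij_witness[of _ cnj cnj]) (auto simp: assms wp_term_def)
  then show ?thesis by (simp add: weierstrass_P_eq)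
qed

text \<open>The constants \<open>1 / l\<^sup>2\<close> cancel, and the separate term
  \<open>1 / z\<^sup>2\<close> becomes the summand of the lattice point 0.\<close>

lemma weierstrass_P_diff:
  "((\<lambda>l. 1 / (z - l)\<^sup>2 - 1 / (w - l)\<^sup>2) has_sum (weierstrass_P L z - weierstrass_P L w)) L"
proof -
  have hs: "(wp_term z has_sum infsum (wp_term z) (L - {0})) (L - {0})" for z
    using summable_wp_term[THEN abs_summable_summable] by (rule has_sum_infsum)
  have "((\<lambda>l. wp_term z l - wp_term w l) has_sum
     (infsum (wp_term z) (L - {0}) - infsum (wp_term w) (L - {0}))) (L - {0})"
    using has_sum_add[OF hs[of z] has_sum_uminusI[OF hs[of w]]] by simp
  then have "((\<lambda>l. 1 / (z - l)\<^sup>2 - 1 / (w - l)\<^sup>2) has_sum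
     (infsum (wp_term z) (L - {0}) - infsum (wp_term w) (L - {0}))) (L - {0})"
    by (simp add: wp_term_def)
  from has_sum_insert[OF _ this, of 0] show ?thesis
    using zero_mem by (simp add: weierstrass_P_eq insert_absorb algebra_simps)
qed

text \<open>Differences of values are sums over the whole lattice, hence invariant under a common
  translation; the constant \<open>\<wp>(z + p) - \<wp>(z)\<close> is then read off at \<open>- p / 2\<close>.\<close>

lemma weierstrass_P_add:
  assumes "p \<in> L"
  shows "weierstrass_P L (z + p) = weierstrass_P L z"
proof -
  define w where "w = - p / 2"
  have "weierstrass_P L (z + p) - weierstrass_P L (w + p) = weierstrass_P L z - weierstrass_P L w"
  proof -
    have "infsum (\<lambda>l. 1 / (z + p - l)\<^sup>2 - 1 / (w + p - l)\<^sup>2) L = infsum (\<lambda>l. 1 / (z - l)\<^sup>2 - 1 / (w - l)\<^sup>2) L"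
      by (rule infsum_reindex_bij_witness[of _ "\<lambda>l. l + p" "\<lambda>l. l - p"])
         (use add_mem uminus_mem assms in \<open>auto simp: algebra_simps, metis add_mem uminus_mem uminus_add_conv_diff\<close>)
    then show ?thesis using weierstrass_P_diff by (metis infsumI)
  qed
  moreover have "weierstrass_P L (w + p) = weierstrass_P L w"
    using weierstrass_P_uminus[of w] by (simp add: w_def)
  ultimately show ?thesis by simp
qed

end


subsection \<open>Values at half-periods\<close>

lemma closed_if_locally_finite:
  fixes X :: "'a :: real_normed_vector set"
  assumes "\<And>R. finite {x \<in> X. norm x \<le> R}"
  shows "closed X"
  unfolding closed_limpt
proof (intro allI impI)
  fix x assume "x islimpt X"
  then have "infinite (X \<inter> ball x 1)"
    unfolding islimpt_eq_infinite_ball by simp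
  moreover have "X \<inter> ball x 1 \<subseteq> {y \<in> X. norm y \<le> norm x + 1}"
  proof
    fix y assume "y \<in> X \<inter> ball x 1"
    moreover have "norm y \<le> norm x + norm (y - x)"
      by (metis add.commute diff_add_cancel norm_triangle_ineq)
    ultimately show "y \<in> {y \<in> X. norm y \<le> norm x + 1}"
      by (auto simp: dist_norm norm_minus_commute)
  qed
  ultimately show "x \<in> X"
    using assms[of "norm x + 1"] finite_subset by blast
qed

lemma countable_if_locally_finite:
  fixes X :: "'a :: real_normed_vector set"
  assumes "\<And>R. finite {x \<in> X. norm x \<le> R}"
  shows "countable X"
proof -
  have "X = (\<Union>n. {x \<in> X. norm x \<le> real n})"
    using real_arch_simple by auto
  moreover have "countable (\<Union>n. {x \<in> X. norm x \<le> real n})"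
    by (intro countable_UN) (auto intro: countable_finite assms)
  ultimately show ?thesis by simp
qed

lemma finite_cball_translate:
  fixes X :: "'a :: real_normed_vector set"
  assumes "\<And>R. finite {x \<in> X. norm x \<le> R}"
  shows "finite {x \<in> (+) c ` X. norm x \<le> R}"
proof (rule finite_subset)
  show "{x \<in> (+) c ` X. norm x \<le> R} \<subseteq> (+) c ` {x \<in> X. norm x \<le> R + norm c}"
  proof clarsimp
    fix x assume "x \<in> X" "norm (c + x) \<le> R"
    moreover have "norm x \<le> norm (c + x) + norm c"
      using norm_triangle_ineq4[of "c + x" c] by simp
    ultimately show "c + x \<in> (+) c ` {x \<in> X. norm x \<le> R + norm c}" by auto
  qed
qed (use assms in auto)

text \<open>By evenness the derivative at 0 equals its own negative, so the zero has order at least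
  two. Two divisions by \<open>z\<close>, each with a removable singularity, then give a holomorphic
  quotient.\<close>

lemma even_zero_order_two:
  assumes hol: "F holomorphic_on S" and "0 \<in> interior S" and "F 0 = 0"
    and even: "\<And>z. F (- z) = F z"
  obtains k where "(\<lambda>z. F z / z\<^sup>2) \<midarrow>0\<rightarrow> k"
proof -
  have op: "open (interior S)" and hol': "F holomorphic_on interior S"
    using holomorphic_on_subset[OF hol interior_subset] by auto
  define F1 where "F1 = (\<lambda>z. if z = 0 then deriv F 0 else (F z - F 0) / (z - 0))"
  have F1: "F1 holomorphic_on interior S"
    unfolding F1_def by (rule pole_lemma[OF hol']) (use assms in auto)
  have dF: "(F has_field_derivative deriv F 0) (at 0)"
    using hol' op assms(2) holomorphic_derivI by blast
  then have "((\<lambda>z. F (- z)) has_field_derivative - deriv F 0) (at 0)"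
    using DERIV_chain2[of F "deriv F 0" uminus 0 "- 1" UNIV] DERIV_minus[OF DERIV_ident, of "0::complex" UNIV]
    by simp
  then have "deriv F 0 = - deriv F 0"
    using dF DERIV_unique unfolding even by blast
  then have "deriv F 0 = 0" by simp
  then have F10: "F1 0 = 0" by (simp add: F1_def)
  define F2 where "F2 = (\<lambda>z. if z = 0 then deriv F1 0 else (F1 z - F1 0) / (z - 0))"
  have F2: "F2 holomorphic_on interior S"
    unfolding F2_def by (rule pole_lemma[OF F1]) (use assms in auto)
  then have "F2 \<midarrow>0\<rightarrow> F2 0"
    using holomorphic_on_imp_continuous_on op assms(2)
    by (metis continuous_on_eq_continuous_at isContD)
  moreover have "\<forall>\<^sub>F z in at 0. F2 z = F z / z\<^sup>2"
    unfolding eventually_at_filter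
    by (rule always_eventually)
       (use F10 in \<open>auto simp: F2_def F1_def \<open>F 0 = 0\<close> \<open>deriv F 0 = 0\<close> power2_eq_square\<close>)
  ultimately have "(\<lambda>z. F z / z\<^sup>2) \<midarrow>0\<rightarrow> F2 0"
    by (rule Lim_transform_eventually)
  then show ?thesis by (rule that)
qed

context cubic_lattice
begin

lemma diff_mem: "x \<in> L \<Longrightarrow> y \<in> L \<Longrightarrow> x - y \<in> L"
  using add_mem[of x "- y"] uminus_mem by simp

lemma closed: "closed L"
  by (rule closed_if_locally_finite[OF finite_cball])

lemma countable: "countable L"
  by (rule countable_if_locally_finite[OF finite_cball])

lemma weierstrass_P_holomorphic: "weierstrass_P L holomorphic_on - L"
proof -
  have "weierstrass_P L field_differentiable (at z)" if z: "z \<notin> L" for z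
  proof -
    define R where "R = norm z + 1"
    have "R > 0" by (simp add: R_def add_nonneg_pos)
    then obtain S U where SU: "finite S" "L \<inter> ball 0 R \<subseteq> S" "S \<subseteq> L" "U holomorphic_on ball 0 R"
      "\<And>z. z \<in> ball 0 R \<Longrightarrow> weierstrass_P L z = (\<Sum>l\<in>S. 1 / (z - l)\<^sup>2) + U z"
      by (rule weierstrass_P_local) blast
    have "(\<lambda>z. (\<Sum>l\<in>S. 1 / (z - l)\<^sup>2) + U z) holomorphic_on ball 0 R - S"
      by (intro holomorphic_intros holomorphic_on_subset[OF SU(4)]) auto
    then have "weierstrass_P L holomorphic_on ball 0 R - S"
      by (rule holomorphic_transform) (use SU(5) in auto)
    moreover have "open (ball 0 R - S)" "z \<in> ball 0 R - S"
      using SU z by (auto simp: R_def finite_imp_closed)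
    ultimately show ?thesis
      using holomorphic_on_imp_differentiable_at by blast
  qed
  then show ?thesis
    using closed by (simp add: holomorphic_on_open field_differentiable_def open_Compl)
qed

lemma weierstrass_P_pole: "(\<lambda>z. z\<^sup>2 * weierstrass_P L z) \<midarrow>0\<rightarrow> 1"
proof -
  obtain S U where SU: "finite S" "L \<inter> ball 0 1 \<subseteq> S" "S \<subseteq> L" "U holomorphic_on ball 0 1"
    "\<And>z. z \<in> ball 0 1 \<Longrightarrow> weierstrass_P L z = (\<Sum>l\<in>S. 1 / (z - l)\<^sup>2) + U z"
    by (rule weierstrass_P_local[of 1]) auto
  have S0: "0 \<in> S" using SU zero_mem by auto
  have "isCont U 0"
    using SU(4) holomorphic_on_imp_continuous_on continuous_on_eq_continuous_at
    by (metis centre_in_ball open_ball zero_less_one)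
  then have "(\<lambda>z. 1 + z\<^sup>2 * ((\<Sum>l\<in>S - {0}. 1 / (z - l)\<^sup>2) + U z)) \<midarrow>0\<rightarrow> 1 + 0\<^sup>2 * ((\<Sum>l\<in>S - {0}. 1 / (0 - l)\<^sup>2) + U 0)"
    by (intro tendsto_intros isContD) auto
  moreover have "\<forall>\<^sub>F z in at 0. z \<in> ball 0 1 - {0::complex}"
    by (rule eventually_at_in_open) auto
  then have "\<forall>\<^sub>F z in at 0. 1 + z\<^sup>2 * ((\<Sum>l\<in>S - {0}. 1 / (z - l)\<^sup>2) + U z) = z\<^sup>2 * weierstrass_P L z"
  proof eventually_elim
    case (elim z)
    then show ?case
      using sum.remove[OF SU(1) S0, of "\<lambda>l. 1 / (z - l)\<^sup>2"]
      by (simp add: SU(5) algebra_simps)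
  qed
  ultimately show ?thesis
    by (auto intro: Lim_transform_eventually)
qed

text \<open>If \<open>\<wp>\<close> took the same value at the two half-periods \<open>u\<close> and \<open>v\<close>, then
  \<open>f z = \<wp> z - \<wp> v\<close> would have double zeros at both. In \<open>f z * f (z - v)\<close> the double zeros
  at the class of \<open>v\<close> cancel all double poles, so by Liouville's theorem the product is constant,
  and it vanishes at \<open>u\<close>.\<close>

lemma weierstrass_P_half_periods_distinct:
  assumes u: "u \<notin> L" and v: "v \<notin> L" "2 * v \<in> L" and uv: "u - v \<notin> L"
    and cocompact: "\<And>z. \<exists>l\<in>L. norm (z - l) \<le> B"
  shows "weierstrass_P L u \<noteq> weierstrass_P L v"
proof
  assume eq: "weierstrass_P L u = weierstrass_P L v"
  define f where "f z = weierstrass_P L z - weierstrass_P L v" for z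
  define g where "g z = f z * f (z - v)" for z
  define X where "X = L \<union> (+) v ` L"
  have f_add: "f (z + p) = f z" if "p \<in> L" for z p
    using weierstrass_P_add[OF that] by (simp add: f_def)
  have f_hol: "f holomorphic_on - L"
    unfolding f_def by (intro holomorphic_intros weierstrass_P_holomorphic)
  have f_minus: "f (- z) = f z" for z by (simp add: f_def weierstrass_P_uminus)
  have v_minus: "f (z - v) = f (z + v)" for z
    using f_add[OF v(2), of "z - v"] by (simp add: algebra_simps)
  have opL: "open (- L)" using closed by auto

  have pole: "(\<lambda>z. z\<^sup>2 * f z) \<midarrow>0\<rightarrow> 1"
  proof -
    have "(\<lambda>z. z\<^sup>2 * weierstrass_P L z - z\<^sup>2 * weierstrass_P L v) \<midarrow>0\<rightarrow> 1 - 0\<^sup>2 * weierstrass_P L v"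
      by (intro tendsto_intros weierstrass_P_pole)
    then show ?thesis by (simp add: f_def algebra_simps)
  qed
  \<comment> \<open>Since \<open>2 * v\<close> is a period, \<open>f (z + v)\<close> is even in
    \<open>z\<close>; it vanishes at 0, hence to order two, which just compensates the double pole
    of the other factor.\<close>
  obtain k where zero: "(\<lambda>z. f (z + v) / z\<^sup>2) \<midarrow>0\<rightarrow> k"
  proof (rule even_zero_order_two)
    have "f \<circ> (\<lambda>z. z + v) holomorphic_on (\<lambda>z. z - v) ` (- L)"
      by (rule holomorphic_on_compose_gen[OF _ f_hol]) (auto intro!: holomorphic_intros)
    then show "(\<lambda>z. f (z + v)) holomorphic_on (\<lambda>z. z - v) ` (- L)"
      by (simp add: o_def)
    have "open ((\<lambda>z. z - v) ` (- L))"
      using open_translation[OF opL, of "- v"] by simp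
    moreover have "0 \<in> (\<lambda>z. z - v) ` (- L)"
      using v by (intro image_eqI[of _ _ v]) auto
    ultimately show "0 \<in> interior ((\<lambda>z. z - v) ` (- L))"
      by (simp add: interior_open)
    show "f (- z + v) = f (z + v)" for z
      using f_minus[of "z - v"] v_minus[of z] by simp
  qed (auto simp: f_def)
  have g0: "g \<midarrow>0\<rightarrow> k"
  proof -
    have "(\<lambda>z. z\<^sup>2 * f z * (f (z + v) / z\<^sup>2)) \<midarrow>0\<rightarrow> 1 * k"
      by (intro tendsto_intros pole zero)
    moreover have "\<forall>\<^sub>F z in at 0. z\<^sup>2 * f z * (f (z + v) / z\<^sup>2) = g z"
      unfolding eventually_at_filter by (auto simp: g_def v_minus)
    ultimately show ?thesis using Lim_transform_eventually by fastforce
  qed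
  have g_add: "g (z + p) = g z" if "p \<in> L" for z p
    using f_add[OF that, of z] f_add[OF that, of "z - v"] by (simp add: g_def algebra_simps)
  \<comment> \<open>Translation by \<open>v\<close> swaps the two factors of \<open>g\<close>. Thus
    every point of \<open>X\<close> is a translate of 0 under a period of \<open>g\<close>, and the
    limit \<open>k\<close> at 0 is the limit there too.\<close>
  have g_v: "g (z + v) = g z" for z
    by (simp add: g_def v_minus[of z])

  have g_hol: "g holomorphic_on - X"
  proof -
    have "f \<circ> (\<lambda>z. z - v) holomorphic_on - (+) v ` L"
    proof (rule holomorphic_on_compose_gen[OF _ f_hol])
      show "(\<lambda>z. z - v) ` (- (+) v ` L) \<subseteq> - L"
        by (auto simp: image_iff) (metis add.commute diff_add_cancel)
    qed (auto intro!: holomorphic_intros)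
    then have "(\<lambda>z. f (z - v)) holomorphic_on - (+) v ` L"
      by (simp add: o_def)
    then show ?thesis
      unfolding g_def[abs_def] X_def
      by (intro holomorphic_intros) (auto intro: holomorphic_on_subset f_hol)
  qed
  have clX: "closed Y" if "Y \<subseteq> X" for Y
  proof (rule closed_if_locally_finite)
    show "finite {x \<in> Y. norm x \<le> R}" for R
    proof (rule finite_subset)
      show "{x \<in> Y. norm x \<le> R} \<subseteq> {x \<in> L. norm x \<le> R} \<union> {x \<in> (+) v ` L. norm x \<le> R}"
        using that by (auto simp: X_def)
    qed (use finite_cball finite_cball_translate[OF finite_cball] in auto)
  qed
  have g_an: "remove_sings g analytic_on {z}" for z
  proof (cases "z \<in> X")
    case False
    have "g analytic_on - X"
      using g_hol clX[of X] by (simp add: analytic_on_open open_Compl)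
    then have "g analytic_on {z}" by (rule analytic_on_subset) (use False in auto)
    then show ?thesis by (rule remove_sings_analytic_on)
  next
    case True
    have "open (- (X - {z}))" "z \<in> - (X - {z})"
      using clX[of "X - {z}"] by (simp_all only: open_Compl Diff_subset) auto
    then obtain r where r: "r > 0" "ball z r \<subseteq> - (X - {z})"
      using openE by blast
    have "g analytic_on - X"
      using g_hol clX[of X] by (simp add: analytic_on_open open_Compl)
    then have "g analytic_on ball z r - {z}"
      by (rule analytic_on_subset) (use r in auto)
    then have iso: "isolated_singularity_at g z"
      using r unfolding isolated_singularity_at_def by blast
    have "\<exists>p. (\<forall>w. g (w + p) = g w) \<and> z = p"
      using True g_add g_v unfolding X_def by (auto simp: add.assoc) (metis add.assoc)
    then have "(\<lambda>w. g (w + z)) = g" by auto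
    then have "g \<midarrow>z\<rightarrow> k"
      using g0 LIM_offset_zero_cancel[of g z k] by (simp add: add.commute)
    then show ?thesis using iso remove_sings_analytic_at by blast
  qed
  define h where "h = remove_sings g"
  have h_hol: "h holomorphic_on UNIV"
    using g_an unfolding h_def by (metis analytic_imp_holomorphic analytic_on_analytic_at)
  have h_add: "h (z + p) = h z" if "p \<in> L" for z p
  proof -
    have "(\<lambda>w. g (z + p + w)) = (\<lambda>w. g (z + w))"
      using g_add[OF that] by (metis add.assoc add.commute)
    then show ?thesis
      unfolding h_def using remove_sings_shift_0[of g "z + p"] remove_sings_shift_0[of g z] by simp
  qed
  have "bounded (range h)"
  proof (rule bounded_subset)
    have "continuous_on (cball 0 B) h"
      using h_hol holomorphic_on_imp_continuous_on continuous_on_subset by blast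
    then show "bounded (h ` cball 0 B)"
      by (intro compact_imp_bounded compact_continuous_image) auto
    show "range h \<subseteq> h ` cball 0 B"
    proof clarify
      fix z
      obtain l where l: "l \<in> L" "norm (z - l) \<le> B" using cocompact by blast
      then have "h z = h (z - l)" using h_add[of l "z - l"] by simp
      then show "h z \<in> h ` cball 0 B" using l by auto
    qed
  qed
  then obtain c where c: "h z = c" for z
    using Liouville_theorem[OF h_hol] by (auto simp: constant_on_def)
  have h_eq: "h z = g z" if "z \<notin> X" for z
  proof -
    have "g analytic_on - X"
      using g_hol clX[of X] by (simp add: analytic_on_open open_Compl)
    then have "g analytic_on {z}" by (rule analytic_on_subset) (use that in auto)
    then show ?thesis unfolding h_def by simp
  qed
  have "u \<notin> X" using u uv by (auto simp: X_def)
  moreover have "g u = 0" using eq by (simp add: g_def f_def)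
  ultimately have "c = 0" using c h_eq by metis
  then have g_zero: "g z = 0" if "z \<notin> X" for z
    using that c h_eq by metis

  \<comment> \<open>The product vanishes while \<open>f\<close> is nonzero near its pole 0, so the
    other factor vanishes there, that is, \<open>f\<close> vanishes near \<open>v\<close>. The
    identity theorem extends this to the complement of the lattice, which contradicts the
    pole.\<close>
  have "\<forall>\<^sub>F z in at 0. f z \<noteq> 0"
    using tendsto_imp_eventually_ne[OF pole, of 0] by (auto elim: eventually_mono)
  moreover have "\<forall>\<^sub>F z in at 0. z \<notin> X"
  proof -
    have "\<forall>\<^sub>F z in at 0. z \<in> - (X - {0}) - {0}"
      by (rule eventually_at_in_open) (use clX[of "X - {0}"] in \<open>simp_all only: open_Compl Diff_subset\<close>, auto)
    then show ?thesis by (rule eventually_mono) auto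
  qed
  ultimately have "\<forall>\<^sub>F z in at 0. f (z + v) = 0"
    by eventually_elim (use g_zero in \<open>auto simp: g_def v_minus\<close>)
  then have "\<forall>\<^sub>F z in at v. f z = 0"
    unfolding at_to_0[of v] eventually_filtermap .
  then have lim: "v islimpt {z \<in> - L. f z = 0}"
  proof -
    assume ev: "\<forall>\<^sub>F z in at v. f z = 0"
    have "\<forall>\<^sub>F z in at v. z \<in> - L - {v}"
      by (rule eventually_at_in_open) (use opL v in auto)
    with ev have "\<forall>\<^sub>F z in at v. z \<in> {z \<in> - L. f z = 0}"
      by eventually_elim auto
    then show ?thesis
      by (metis islimpt_conv_frequently_at eventually_frequently trivial_limit_at)
  qed
  have conn: "connected (- L)"
    by (intro path_connected_imp_connected path_connected_complement_countable countable) simp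
  have f_zero: "f z = 0" if "z \<notin> L" for z
    by (rule analytic_continuation[OF f_hol opL conn _ _ lim]) (use v that in auto)
  have "\<forall>\<^sub>F z in at 0. z \<in> - (L - {0}) - {0}"
  proof (rule eventually_at_in_open)
    show "open (- (L - {0}))" by (intro open_Compl clX) (auto simp: X_def)
  qed auto
  then have "\<forall>\<^sub>F z in at 0. z\<^sup>2 * f z = 0"
    by eventually_elim (use f_zero in auto)
  then have "(\<lambda>z. z\<^sup>2 * f z) \<midarrow>0\<rightarrow> 0"
    by (rule tendsto_eventually)
  then show False using pole LIM_unique by fastforce
qed

end


subsection \<open>Path integrals of functions with double poles\<close>

text \<open>\<open>Q\<close> will be the identity for the integral defining zeta and
  \<open>Re\<close> for the integral of zeta. Primitives are available only on discs, but every path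
  is bounded: a given path and a reference path in the small disc lie together in a larger disc,
  whose primitive shows that their integrals agree under \<open>Q\<close>.\<close>

lemma the_elem_path_integral_values:
  fixes Q :: "complex \<Rightarrow> 'a :: ab_group_add"
  assumes fin: "\<And>R. finite {p \<in> P. norm p \<le> R}" and "0 \<notin> P"
    and ex: "\<And>R. R > 0 \<Longrightarrow> \<exists>\<Psi>. \<forall>\<gamma>. valid_path \<gamma> \<and> path_image \<gamma> \<subseteq> ball 0 R - P \<longrightarrow>
        Q (contour_integral \<gamma> g) = \<Psi> (pathfinish \<gamma>) - \<Psi> (pathstart \<gamma>)"
    and \<Psi>: "\<And>\<gamma>. valid_path \<gamma> \<Longrightarrow> path_image \<gamma> \<subseteq> ball 0 R - P \<Longrightarrow>
        Q (contour_integral \<gamma> g) = \<Psi> (pathfinish \<gamma>) - \<Psi> (pathstart \<gamma>)"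
    and z: "z \<in> ball 0 R - P"
  shows "Q ` path_integral_values (- P) g z = {\<Psi> z - \<Psi> 0}"
proof -
  have R: "R > 0" using z by (metis DiffE dist_0_norm mem_ball norm_ge_zero order_le_less_trans)
  have "open (ball 0 R - P)" "connected (ball 0 R - P)"
    using closed_if_locally_finite[OF fin] countable_if_locally_finite[OF fin]
    by (auto intro!: connected_open_diff_countable)
  then obtain \<gamma>\<^sub>0 where \<gamma>\<^sub>0: "valid_path \<gamma>\<^sub>0" "path_image \<gamma>\<^sub>0 \<subseteq> ball 0 R - P" "pathstart \<gamma>\<^sub>0 = 0" "pathfinish \<gamma>\<^sub>0 = z"
    using connected_open_polynomial_connected[of "ball 0 R - P" 0 z] z R \<open>0 \<notin> P\<close> valid_path_polynomial_function
    by auto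
  have "Q (contour_integral \<gamma> g) = \<Psi> z - \<Psi> 0"
    if \<gamma>: "valid_path \<gamma>" "path_image \<gamma> \<subseteq> - P" "pathstart \<gamma> = 0" "pathfinish \<gamma> = z" for \<gamma>
  proof -
    have "bounded (path_image \<gamma>)"
      using \<gamma>(1) by (simp add: bounded_valid_path_image)
    then obtain R1 where R1: "\<And>w. w \<in> path_image \<gamma> \<Longrightarrow> norm w \<le> R1"
      by (auto simp: bounded_iff)
    define R' where "R' = max (R1 + 1) R"
    have "R' > 0" "path_image \<gamma> \<subseteq> ball 0 R' - P" "path_image \<gamma>\<^sub>0 \<subseteq> ball 0 R' - P"
      using R R1 \<gamma>(2) \<gamma>\<^sub>0(2) by (force simp: R'_def)+
    with ex[of R'] obtain \<Psi>' where
      "Q (contour_integral \<gamma> g) = \<Psi>' z - \<Psi>' 0" "Q (contour_integral \<gamma>\<^sub>0 g) = \<Psi>' z - \<Psi>' 0"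
      using \<gamma> \<gamma>\<^sub>0 by metis
    then show ?thesis using \<Psi>[OF \<gamma>\<^sub>0(1,2)] \<gamma>\<^sub>0(3,4) by simp
  qed
  moreover have "\<gamma>\<^sub>0 \<in> {\<gamma>. valid_path \<gamma> \<and> path_image \<gamma> \<subseteq> - P \<and> pathstart \<gamma> = 0 \<and> pathfinish \<gamma> = z}"
    using \<gamma>\<^sub>0 by auto
  ultimately show ?thesis
    unfolding path_integral_values_def by (auto intro!: image_eqI[of _ Q "contour_integral \<gamma>\<^sub>0 g"])
qed

text \<open>The fundamental theorem of calculus for the real part alone. It covers domains where
  \<open>g\<close> has periods, as long as these are purely imaginary.\<close>

lemma Re_contour_integral_primitive:
  assumes U: "open U" and g: "g holomorphic_on U"
    and L: "\<And>z. z \<in> U \<Longrightarrow> (L has_derivative (\<lambda>v. Re (g z * v))) (at z)"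
    and \<gamma>: "valid_path \<gamma>" "path_image \<gamma> \<subseteq> U"
  shows "Re (contour_integral \<gamma> g) = L (pathfinish \<gamma>) - L (pathstart \<gamma>)"
proof -
  have "g contour_integrable_on \<gamma>"
    by (rule contour_integrable_holomorphic_simple[OF g U \<gamma>])
  then have "((\<lambda>t. g (\<gamma> t) * vector_derivative \<gamma> (at t)) has_integral contour_integral \<gamma> g) {0..1}"
    using has_contour_integral has_contour_integral_integral by blast
  from has_integral_linear[OF this bounded_linear_Re]
  have int: "((\<lambda>t. Re (g (\<gamma> t) * vector_derivative \<gamma> (at t))) has_integral Re (contour_integral \<gamma> g)) {0..1}"
    by (simp add: o_def)
  obtain S where S: "finite S" "\<And>t. t \<in> {0..1} - S \<Longrightarrow> \<gamma> differentiable at t" and cont: "continuous_on {0..1} \<gamma>"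
    using \<gamma>(1) unfolding valid_path_def piecewise_C1_differentiable_on_def C1_differentiable_on_eq by auto
  have mem: "\<gamma> t \<in> U" if "t \<in> {0..1}" for t
    using \<gamma>(2) that by (auto simp: path_image_def)
  have contL: "continuous_on U L"
    using L has_derivative_continuous continuous_at_imp_continuous_on by blast
  have "((\<lambda>t. Re (g (\<gamma> t) * vector_derivative \<gamma> (at t))) has_integral (L \<circ> \<gamma>) 1 - (L \<circ> \<gamma>) 0) {0..1}"
  proof (rule fundamental_theorem_of_calculus_interior_strong[OF S(1)])
    show "continuous_on {0..1} (L \<circ> \<gamma>)"
      by (rule continuous_on_compose[OF cont continuous_on_subset[OF contL]]) (use mem in auto)
    fix t :: real assume t: "t \<in> {0<..<1} - S"
    then have "(\<gamma> has_vector_derivative vector_derivative \<gamma> (at t)) (at t)"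
      using S(2)[of t] vector_derivative_works by auto
    moreover have "(L has_derivative (\<lambda>v. Re (g (\<gamma> t) * v))) (at (\<gamma> t) within range \<gamma>)"
      using L[OF mem[of t]] t by (auto intro: has_derivative_at_withinI)
    ultimately show "((L \<circ> \<gamma>) has_vector_derivative Re (g (\<gamma> t) * vector_derivative \<gamma> (at t))) (at t)"
      by (rule vector_derivative_diff_chain_within)
  qed simp
  then show ?thesis
    using has_integral_unique[OF int] by (simp add: pathfinish_def pathstart_def)
qed

text \<open>The derivative is brought into the form \<open>Re (g z * v)\<close> expected by
  \<open>Re_contour_integral_primitive\<close>, with \<open>g z = 1 / (z - p)\<close>; this takes
  the place of a branch of the complex logarithm.\<close>

lemma has_derivative_ln_norm:
  fixes z p :: complex
  assumes "z \<noteq> p"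
  shows "((\<lambda>z. ln (cmod (z - p))) has_derivative (\<lambda>v. Re (1 / (z - p) * v))) (at z)"
proof -
  have "((\<lambda>z. z - p) has_derivative (\<lambda>v. v)) (at z)"
    by (auto intro!: derivative_eq_intros)
  moreover have "(cmod has_derivative (\<lambda>v. sgn (z - p) \<bullet> v)) (at (z - p))"
    using has_derivative_norm[of "z - p"] assms by (simp add: inner_commute)
  ultimately have "((\<lambda>z. cmod (z - p)) has_derivative (\<lambda>v. sgn (z - p) \<bullet> v)) (at z)"
    by (rule has_derivative_compose)
  from has_derivative_ln[OF _ this] assms
  have "((\<lambda>z. ln (cmod (z - p))) has_derivative (\<lambda>v. (sgn (z - p) \<bullet> v) * inverse (cmod (z - p)))) (at z)"
    by simp
  moreover have "(sgn w \<bullet> v) * inverse (cmod w) = Re (1 / w * v)" for w v :: complex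
  proof (cases "w = 0")
    case False
    have "Re (1 / w * v) = (w \<bullet> v) / (cmod w)\<^sup>2"
      by (simp add: inner_complex_def Re_divide cmod_power2 field_simps)
    then show ?thesis
      by (simp add: sgn_div_norm inner_scaleR_left power2_eq_square field_simps)
  qed simp
  ultimately show ?thesis by simp
qed

lemma holomorphic_primitive_ball:
  assumes "f holomorphic_on ball (0::complex) R"
  obtains F where "F holomorphic_on ball 0 R" "\<And>z. z \<in> ball 0 R \<Longrightarrow> (F has_field_derivative f z) (at z)"
proof -
  obtain F where F: "\<And>z. z \<in> ball 0 R \<Longrightarrow> (F has_field_derivative f z) (at z within ball 0 R)"
    using holomorphic_convex_primitive[OF convex_ball finite.emptyI, of 0 R f]
      holomorphic_on_imp_continuous_on[OF assms] holomorphic_on_imp_differentiable_at[OF assms open_ball]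
    by (auto simp: interior_open)
  then have "(F has_field_derivative f z) (at z)" if "z \<in> ball 0 R" for z
    using that at_within_open[OF that open_ball] by metis
  moreover from this have "F holomorphic_on ball 0 R"
    by (subst holomorphic_on_open) blast+
  ultimately show ?thesis using that by blast
qed

text \<open>For \<open>f = sym_c * sym_P\<close>, \<open>zeta\<close> is \<open>sym_c * sym_zeta\<close> and \<open>logabs\<close> is \<open>- 2 * pi * sym_Z\<close>.\<close>

locale double_poles =
  fixes P :: "complex set" and f :: "complex \<Rightarrow> complex"
  assumes locally_finite: "finite {p \<in> P. norm p \<le> R}"
    and zero_notin: "0 \<notin> P"
    and local_form: "R > 0 \<Longrightarrow> \<exists>S U. finite S \<and> P \<inter> ball 0 R \<subseteq> S \<and> S \<subseteq> P \<and> U holomorphic_on ball 0 R \<and>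
        (\<forall>z\<in>ball 0 R - P. f z = (\<Sum>p\<in>S. 1 / (z - p)\<^sup>2) + U z)"
begin

definition zeta :: "complex \<Rightarrow> complex" where
  "zeta z = - the_elem (path_integral_values (- P) f z)"

definition logabs :: "complex \<Rightarrow> real" where
  "logabs z = the_elem (Re ` path_integral_values (- P) zeta z)"

lemma closed_poles: "closed P"
  by (rule closed_if_locally_finite[OF locally_finite])

lemma countable_poles: "countable P"
  by (rule countable_if_locally_finite[OF locally_finite])

lemma connected_compl: "connected (- P)"
  by (intro path_connected_imp_connected path_connected_complement_countable countable_poles) simp

text \<open>Each double pole has the single-valued primitive \<open>- 1 / (z - p)\<close>, and the
  holomorphic rest has one because a disc is convex.\<close>

lemma zeta_primitive:
  assumes "R > 0"
  shows "\<exists>S V. finite S \<and> P \<inter> ball 0 R \<subseteq> S \<and> S \<subseteq> P \<and> V holomorphic_on ball 0 R \<and>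
    (\<forall>z\<in>ball 0 R - P. ((\<lambda>z. V z - (\<Sum>p\<in>S. 1 / (z - p))) has_field_derivative f z) (at z))"
proof -
  obtain S U where S: "finite S" "P \<inter> ball 0 R \<subseteq> S" "S \<subseteq> P" and U: "U holomorphic_on ball 0 R"
    and f: "\<And>z. z \<in> ball 0 R - P \<Longrightarrow> f z = (\<Sum>p\<in>S. 1 / (z - p)\<^sup>2) + U z"
    using local_form[OF assms] by blast
  obtain V where V: "V holomorphic_on ball 0 R" "\<And>z. z \<in> ball 0 R \<Longrightarrow> (V has_field_derivative U z) (at z)"
    by (rule holomorphic_primitive_ball[OF U]) blast
  have "((\<lambda>z. V z - (\<Sum>p\<in>S. 1 / (z - p))) has_field_derivative f z) (at z)" if z: "z \<in> ball 0 R - P" for z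
  proof -
    have "((\<lambda>z. 1 / (z - p)) has_field_derivative - (1 / (z - p)\<^sup>2)) (at z)" if "p \<in> S" for p
    proof -
      have "z - p \<noteq> 0" using z that S by auto
      then show ?thesis by (auto intro!: derivative_eq_intros simp: power2_eq_square)
    qed
    then have "((\<lambda>z. \<Sum>p\<in>S. 1 / (z - p)) has_field_derivative (\<Sum>p\<in>S. - (1 / (z - p)\<^sup>2))) (at z)"
      by (rule DERIV_sum)
    from DERIV_diff[OF V(2) this] show ?thesis
      using z f[OF z] by (simp add: sum_negf add.commute)
  qed
  with S V(1) show ?thesis by blast
qed

lemma path_integral_f:
  assumes "\<And>z. z \<in> ball 0 R - P \<Longrightarrow> (F has_field_derivative f z) (at z)"
    and "valid_path \<gamma>" "path_image \<gamma> \<subseteq> ball 0 R - P"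
  shows "(f has_contour_integral (F (pathfinish \<gamma>) - F (pathstart \<gamma>))) \<gamma>"
  using contour_integral_primitive[of "ball 0 R - P" F f \<gamma>] assms
  by (auto intro: has_field_derivative_at_within)

lemma path_integral_values_f:
  assumes F: "\<And>z. z \<in> ball 0 R - P \<Longrightarrow> (F has_field_derivative f z) (at z)" and z: "z \<in> ball 0 R - P"
  shows "path_integral_values (- P) f z = {F z - F 0}"
proof -
  have "id ` path_integral_values (- P) f z = {F z - F 0}"
  proof (rule the_elem_path_integral_values[OF locally_finite zero_notin _ _ z])
    fix R :: real assume "R > 0"
    obtain S V where "finite S" "P \<inter> ball 0 R \<subseteq> S" "S \<subseteq> P" "V holomorphic_on ball 0 R" and
      *: "\<And>z. z \<in> ball 0 R - P \<Longrightarrow> ((\<lambda>z. V z - (\<Sum>p\<in>S. 1 / (z - p))) has_field_derivative f z) (at z)"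
      using zeta_primitive[OF \<open>R > 0\<close>] by blast
    show "\<exists>\<Psi>. \<forall>\<gamma>. valid_path \<gamma> \<and> path_image \<gamma> \<subseteq> ball 0 R - P \<longrightarrow>
        id (contour_integral \<gamma> f) = \<Psi> (pathfinish \<gamma>) - \<Psi> (pathstart \<gamma>)"
      using contour_integral_unique[OF path_integral_f, of R "\<lambda>z. V z - (\<Sum>p\<in>S. 1 / (z - p))", OF *]
      by (intro exI[of _ "\<lambda>z. V z - (\<Sum>p\<in>S. 1 / (z - p))"]) simp
  next
    fix \<gamma> assume "valid_path \<gamma>" "path_image \<gamma> \<subseteq> ball 0 R - P"
    then show "id (contour_integral \<gamma> f) = F (pathfinish \<gamma>) - F (pathstart \<gamma>)"
      using contour_integral_unique[OF path_integral_f, of R F, OF F] by simp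
  qed
  then show ?thesis by simp
qed

lemma zeta_eq:
  assumes "\<And>z. z \<in> ball 0 R - P \<Longrightarrow> (F has_field_derivative f z) (at z)" "z \<in> ball 0 R - P"
  shows "zeta z = F 0 - F z"
  using path_integral_values_f[OF assms] by (simp add: zeta_def)

lemma zeta_0: "zeta 0 = 0"
proof -
  obtain S V where "finite S" "P \<inter> ball 0 1 \<subseteq> S" "S \<subseteq> P" "V holomorphic_on ball 0 1" and
    *: "\<And>z. z \<in> ball 0 1 - P \<Longrightarrow> ((\<lambda>z. V z - (\<Sum>p\<in>S. 1 / (z - p))) has_field_derivative f z) (at z)"
    using zeta_primitive[OF zero_less_one] by blast
  then show ?thesis using zeta_eq[of 1 _ 0, OF *] zero_notin by simp
qed

lemma open_ball_diff: "open (ball 0 R - P)"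
  using closed_poles by auto

lemma zeta_deriv:
  assumes z: "z \<notin> P"
  shows "(zeta has_field_derivative - f z) (at z)"
proof -
  define R where "R = norm z + 1"
  have "R > 0" "z \<in> ball 0 R - P" using z by (auto simp: R_def add_nonneg_pos)
  obtain S V where "finite S" "P \<inter> ball 0 R \<subseteq> S" "S \<subseteq> P" "V holomorphic_on ball 0 R" and
    *: "\<And>z. z \<in> ball 0 R - P \<Longrightarrow> ((\<lambda>z. V z - (\<Sum>p\<in>S. 1 / (z - p))) has_field_derivative f z) (at z)"
    using zeta_primitive[OF \<open>R > 0\<close>] by blast
  define F where "F z = V z - (\<Sum>p\<in>S. 1 / (z - p))" for z
  have F: "(F has_field_derivative f z) (at z)" if "z \<in> ball 0 R - P" for z
    unfolding F_def[abs_def] by (rule *[OF that])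
  have "((\<lambda>z. F 0 - F z) has_field_derivative 0 - f z) (at z)"
    by (intro DERIV_diff DERIV_const F \<open>z \<in> ball 0 R - P\<close>)
  then have "((\<lambda>z. F 0 - F z) has_field_derivative - f z) (at z)" by simp
  then show ?thesis
    by (rule has_field_derivative_transform_within_open[OF _ open_ball_diff \<open>z \<in> ball 0 R - P\<close>])
       (rule zeta_eq[OF F, symmetric])
qed

lemma zeta_holomorphic: "zeta holomorphic_on - P"
  using zeta_deriv closed_poles by (auto simp: holomorphic_on_open open_Compl)

text \<open>Zeta has residue 1 at each pole, so every pole contributes one logarithm with
  coefficient 1. The remaining part, including the constant that makes zeta vanish at 0, is
  holomorphic and integrates to \<open>W\<close>.\<close>

lemma logabs_primitive:
  assumes "R > 0"
  shows "\<exists>S W. finite S \<and> P \<inter> ball 0 R \<subseteq> S \<and> S \<subseteq> P \<and> W holomorphic_on ball 0 R \<and>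
    (\<forall>z\<in>ball 0 R - P.
       ((\<lambda>z. (\<Sum>p\<in>S. ln (cmod (z - p))) + Re (W z)) has_derivative (\<lambda>v. Re (zeta z * v))) (at z))"
proof -
  obtain S V where S: "finite S" "P \<inter> ball 0 R \<subseteq> S" "S \<subseteq> P" and V: "V holomorphic_on ball 0 R" and
    *: "\<And>z. z \<in> ball 0 R - P \<Longrightarrow> ((\<lambda>z. V z - (\<Sum>p\<in>S. 1 / (z - p))) has_field_derivative f z) (at z)"
    using zeta_primitive[OF assms] by blast
  define c where "c = V 0 - (\<Sum>p\<in>S. 1 / (0 - p))"
  have "(\<lambda>z. c - V z) holomorphic_on ball 0 R"
    by (intro holomorphic_intros V)
  then obtain W where W: "W holomorphic_on ball 0 R" "\<And>z. z \<in> ball 0 R \<Longrightarrow> (W has_field_derivative c - V z) (at z)"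
    by (rule holomorphic_primitive_ball) blast
  have "((\<lambda>z. (\<Sum>p\<in>S. ln (cmod (z - p))) + Re (W z)) has_derivative (\<lambda>v. Re (zeta z * v))) (at z)"
    if z: "z \<in> ball 0 R - P" for z
  proof -
    have "((\<lambda>z. ln (cmod (z - p))) has_derivative (\<lambda>v. Re (1 / (z - p) * v))) (at z)" if "p \<in> S" for p
      by (rule has_derivative_ln_norm) (use that z S in auto)
    then have 1: "((\<lambda>z. \<Sum>p\<in>S. ln (cmod (z - p))) has_derivative (\<lambda>v. \<Sum>p\<in>S. Re (1 / (z - p) * v))) (at z)"
      by (rule has_derivative_sum)
    have "(W has_derivative (\<lambda>v. (c - V z) * v)) (at z)"
      using W(2)[of z] z by (auto simp: has_field_derivative_def)
    then have 2: "((\<lambda>z. Re (W z)) has_derivative (\<lambda>v. Re ((c - V z) * v))) (at z)"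
      by (rule has_derivative_Re)
    have "zeta z = (\<Sum>p\<in>S. 1 / (z - p)) + (c - V z)"
      using zeta_eq[OF * z] by (simp add: c_def)
    then have "(\<Sum>p\<in>S. Re (1 / (z - p) * v)) + Re ((c - V z) * v) = Re (zeta z * v)" for v
      by (simp only: Re_sum[symmetric] sum_distrib_right distrib_right plus_complex.sel)
    then show ?thesis using has_derivative_add[OF 1 2] by simp
  qed
  with S W(1) show ?thesis by blast
qed

lemma logabs_eq:
  assumes L: "\<And>z. z \<in> ball 0 R - P \<Longrightarrow> (L has_derivative (\<lambda>v. Re (zeta z * v))) (at z)"
    and z: "z \<in> ball 0 R - P"
  shows "logabs z = L z - L 0"
proof -
  have hol: "zeta holomorphic_on ball 0 R - P" for R
    using zeta_holomorphic by (rule holomorphic_on_subset) auto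
  have "Re ` path_integral_values (- P) zeta z = {L z - L 0}"
  proof (rule the_elem_path_integral_values[OF locally_finite zero_notin _ _ z])
    fix R :: real assume "R > 0"
    obtain S W where "finite S" "P \<inter> ball 0 R \<subseteq> S" "S \<subseteq> P" "W holomorphic_on ball 0 R" and
      *: "\<And>z. z \<in> ball 0 R - P \<Longrightarrow>
       ((\<lambda>z. (\<Sum>p\<in>S. ln (cmod (z - p))) + Re (W z)) has_derivative (\<lambda>v. Re (zeta z * v))) (at z)"
      using logabs_primitive[OF \<open>R > 0\<close>] by blast
    define L where "L z = (\<Sum>p\<in>S. ln (cmod (z - p))) + Re (W z)" for z
    have "(L has_derivative (\<lambda>v. Re (zeta z * v))) (at z)" if "z \<in> ball 0 R - P" for z
      unfolding L_def[abs_def] by (rule *[OF that])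
    from Re_contour_integral_primitive[OF open_ball_diff hol this]
    show "\<exists>\<Psi>. \<forall>\<gamma>. valid_path \<gamma> \<and> path_image \<gamma> \<subseteq> ball 0 R - P \<longrightarrow>
        Re (contour_integral \<gamma> zeta) = \<Psi> (pathfinish \<gamma>) - \<Psi> (pathstart \<gamma>)"
      by (intro exI[of _ L]) blast
  qed (rule Re_contour_integral_primitive[OF open_ball_diff hol L])
  then show ?thesis by (simp add: logabs_def)
qed

lemma logabs_local:
  assumes "R > 0"
  shows "\<exists>S W. finite S \<and> P \<inter> ball 0 R \<subseteq> S \<and> S \<subseteq> P \<and> W holomorphic_on ball 0 R \<and>
    (\<forall>z\<in>ball 0 R - P. logabs z = (\<Sum>p\<in>S. ln (cmod (z - p))) + Re (W z))"
proof -
  obtain S W where S: "finite S" "P \<inter> ball 0 R \<subseteq> S" "S \<subseteq> P" and W: "W holomorphic_on ball 0 R" and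
    *: "\<And>z. z \<in> ball 0 R - P \<Longrightarrow>
       ((\<lambda>z. (\<Sum>p\<in>S. ln (cmod (z - p))) + Re (W z)) has_derivative (\<lambda>v. Re (zeta z * v))) (at z)"
    using logabs_primitive[OF assms] by blast
  define c where "c = (\<Sum>p\<in>S. ln (cmod (0 - p))) + Re (W 0)"
  have "logabs z = (\<Sum>p\<in>S. ln (cmod (z - p))) + Re (W z - of_real c)" if "z \<in> ball 0 R - P" for z
    using logabs_eq[OF * that] by (simp add: c_def)
  moreover have "(\<lambda>z. W z - of_real c) holomorphic_on ball 0 R"
    by (intro holomorphic_intros W)
  ultimately show ?thesis using S by blast
qed

lemma logabs_deriv:
  assumes z: "z \<notin> P"
  shows "(logabs has_derivative (\<lambda>v. Re (zeta z * v))) (at z)"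
proof -
  define R where "R = norm z + 1"
  have "R > 0" "z \<in> ball 0 R - P" using z by (auto simp: R_def add_nonneg_pos)
  obtain S W where "finite S" "P \<inter> ball 0 R \<subseteq> S" "S \<subseteq> P" "W holomorphic_on ball 0 R" and
    *: "\<And>z. z \<in> ball 0 R - P \<Longrightarrow>
       ((\<lambda>z. (\<Sum>p\<in>S. ln (cmod (z - p))) + Re (W z)) has_derivative (\<lambda>v. Re (zeta z * v))) (at z)"
    using logabs_primitive[OF \<open>R > 0\<close>] by blast
  define L where "L z = (\<Sum>p\<in>S. ln (cmod (z - p))) + Re (W z)" for z
  have L: "(L has_derivative (\<lambda>v. Re (zeta z * v))) (at z)" if "z \<in> ball 0 R - P" for z
    unfolding L_def[abs_def] by (rule *[OF that])
  have "((\<lambda>z. L z - L 0) has_derivative (\<lambda>v. Re (zeta z * v) - 0)) (at z)"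
    by (intro has_derivative_diff has_derivative_const L \<open>z \<in> ball 0 R - P\<close>)
  then have "((\<lambda>z. L z - L 0) has_derivative (\<lambda>v. Re (zeta z * v))) (at z)" by simp
  then show ?thesis
    by (rule has_derivative_transform_within_open[OF _ open_ball_diff \<open>z \<in> ball 0 R - P\<close>])
       (rule logabs_eq[OF L, symmetric])
qed

lemma logabs_0: "logabs 0 = 0"
proof -
  obtain S W where "finite S" "P \<inter> ball 0 1 \<subseteq> S" "S \<subseteq> P" "W holomorphic_on ball 0 1" and
    *: "\<And>z. z \<in> ball 0 1 - P \<Longrightarrow>
       ((\<lambda>z. (\<Sum>p\<in>S. ln (cmod (z - p))) + Re (W z)) has_derivative (\<lambda>v. Re (zeta z * v))) (at z)"
    using logabs_primitive[OF zero_less_one] by blast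
  then show ?thesis using logabs_eq[of 1 _ 0, OF *] zero_notin by simp
qed

end


subsection \<open>The symmetric functions of a rhombic lattice\<close>

context double_poles
begin

text \<open>The complement of a closed countable set is open and connected. The symmetries below are
  thereby reduced to derivatives and, where the constant matters, to one evaluation.\<close>

lemma zero_deriv_const:
  fixes g :: "complex \<Rightarrow> 'b :: banach"
  assumes "\<And>z. z \<notin> P \<Longrightarrow> (g has_derivative (\<lambda>h. 0)) (at z)"
  shows "\<exists>c. \<forall>z. z \<notin> P \<longrightarrow> g z = c"
proof -
  have "open (- P)" using closed_poles by auto
  moreover have "continuous_on (- P) g"
    by (intro continuous_at_imp_continuous_on ballI has_derivative_continuous[OF assms]) simp
  ultimately have "g constant_on - P"
    using has_derivative_zero_connected_constant_on[OF connected_compl _ finite.emptyI] assms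
    by (auto intro: has_derivative_at_withinI)
  then show ?thesis by (auto simp: constant_on_def)
qed

lemma zero_field_deriv_const:
  assumes "\<And>z. z \<notin> P \<Longrightarrow> (g has_field_derivative 0) (at z)"
  shows "\<exists>c. \<forall>z. z \<notin> P \<longrightarrow> g z = c"
  by (rule zero_deriv_const) (use assms in \<open>simp add: has_field_derivative_def lambda_zero\<close>)

lemma zeta_uminus:
  assumes P: "\<And>z. z \<in> P \<Longrightarrow> - z \<in> P" and f: "\<And>z. f (- z) = f z" and z: "z \<notin> P"
  shows "zeta (- z) = - zeta z"
proof -
  have "((\<lambda>z. zeta z + zeta (- z)) has_field_derivative 0) (at z)" if "z \<notin> P" for z
  proof -
    have "- z \<notin> P" using P[of "- z"] that by auto
    from DERIV_chain2[OF zeta_deriv[OF this] DERIV_minus[OF DERIV_ident]]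
    have "((\<lambda>z. zeta (- z)) has_field_derivative f z) (at z)" by (simp add: f)
    from DERIV_add[OF zeta_deriv[OF that] this] show ?thesis by simp
  qed
  from zero_field_deriv_const[OF this] obtain c where "\<And>z. z \<notin> P \<Longrightarrow> zeta z + zeta (- z) = c"
    by blast
  from this[of 0] this[of z] show ?thesis
    using z zero_notin zeta_0 by (simp add: eq_neg_iff_add_eq_0 add.commute)
qed

lemma zeta_cnj:
  assumes P: "\<And>z. z \<in> P \<Longrightarrow> cnj z \<in> P" and f: "\<And>z. f (cnj z) = cnj (f z)" and z: "z \<notin> P"
  shows "zeta (cnj z) = cnj (zeta z)"
proof -
  have "((\<lambda>z. zeta z - cnj (zeta (cnj z))) has_field_derivative 0) (at z)" if "z \<notin> P" for z
  proof -
    have "cnj z \<notin> P" using P[of "cnj z"] that by auto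
    from has_field_derivative_cnj_cnj[OF zeta_deriv[OF this]]
    have "((\<lambda>z. cnj (zeta (cnj z))) has_field_derivative - f z) (at z)" by (simp add: f o_def)
    from DERIV_diff[OF zeta_deriv[OF that] this] show ?thesis by simp
  qed
  from zero_field_deriv_const[OF this] obtain c where c: "\<And>z. z \<notin> P \<Longrightarrow> zeta z - cnj (zeta (cnj z)) = c"
    by blast
  have "c = 0" using c[of 0] zero_notin zeta_0 by simp
  then have "zeta z = cnj (zeta (cnj z))" using c[OF z] by simp
  then show ?thesis by (metis complex_cnj_cnj)
qed

lemma logabs_uminus:
  assumes P: "\<And>z. z \<in> P \<Longrightarrow> - z \<in> P" and f: "\<And>z. f (- z) = f z" and z: "z \<notin> P"
  shows "logabs (- z) = logabs z"
proof -
  have "((\<lambda>z. logabs z - logabs (- z)) has_derivative (\<lambda>h. 0)) (at z)" if "z \<notin> P" for z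
  proof -
    have z': "- z \<notin> P" using P[of "- z"] that by auto
    have "((\<lambda>z. - z) has_derivative (\<lambda>v. - v)) (at z)"
      by (auto intro!: derivative_eq_intros)
    from has_derivative_compose[OF this logabs_deriv[OF z']]
    have "((\<lambda>z. logabs (- z)) has_derivative (\<lambda>v. Re (zeta z * v))) (at z)"
      by (simp add: zeta_uminus[OF P f that])
    from has_derivative_diff[OF logabs_deriv[OF that] this] show ?thesis by simp
  qed
  from zero_deriv_const[OF this] obtain c where "\<And>z. z \<notin> P \<Longrightarrow> logabs z - logabs (- z) = c"
    by blast
  from this[of 0] this[of z] show ?thesis using z zero_notin by simp
qed

lemma zeta_quasi_periodic:
  assumes P: "\<And>z. z + w \<in> P \<longleftrightarrow> z \<in> P" and f: "\<And>z. f (z + w) = f z"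
  shows "\<exists>K. \<forall>z. z \<notin> P \<longrightarrow> zeta (z + w) = zeta z + K"
proof -
  have "((\<lambda>z. zeta (z + w) - zeta z) has_field_derivative 0) (at z)" if "z \<notin> P" for z
  proof -
    have "((\<lambda>z. zeta (z + w)) has_field_derivative - f z) (at z)"
      using zeta_deriv[of "z + w"] that P[of z] f DERIV_shift[of zeta "- f z" z w] by simp
    from DERIV_diff[OF this zeta_deriv[OF that]] show ?thesis by simp
  qed
  from zero_field_deriv_const[OF this] show ?thesis
    by (metis add.commute diff_add_cancel)
qed

text \<open>Evenness of \<open>logabs\<close>, applied at \<open>- w / 2\<close>, determines the additive constant.\<close>

lemma logabs_quasi_periodic:
  assumes P: "\<And>z. z + w \<in> P \<longleftrightarrow> z \<in> P" and K: "\<And>z. z \<notin> P \<Longrightarrow> zeta (z + w) = zeta z + K"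
    and sym: "\<And>z. z \<in> P \<Longrightarrow> - z \<in> P" "\<And>z. f (- z) = f z" and half: "w / 2 \<notin> P" and z: "z \<notin> P"
  shows "logabs (z + w) = logabs z + Re (K * z) + Re (K * w) / 2"
proof -
  have "((\<lambda>z. logabs (z + w) - logabs z - Re (K * z)) has_derivative (\<lambda>h. 0)) (at z)" if "z \<notin> P" for z
  proof -
    have z': "z + w \<notin> P" using P that by auto
    have "((\<lambda>z. z + w) has_derivative (\<lambda>v. v)) (at z)"
      by (auto intro!: derivative_eq_intros)
    from has_derivative_compose[OF this logabs_deriv[OF z']]
    have 1: "((\<lambda>z. logabs (z + w)) has_derivative (\<lambda>v. Re ((zeta z + K) * v))) (at z)"
      by (simp only: K[OF that])
    have 2: "((\<lambda>z. Re (K * z)) has_derivative (\<lambda>v. Re (K * v))) (at z)"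
      by (intro has_derivative_Re has_derivative_mult_right has_derivative_ident)
    from has_derivative_diff[OF has_derivative_diff[OF 1 logabs_deriv[OF that]] 2]
    show ?thesis by (simp add: algebra_simps)
  qed
  from zero_deriv_const[OF this] obtain c where c: "\<And>z. z \<notin> P \<Longrightarrow> logabs (z + w) - logabs z - Re (K * z) = c"
    by blast
  have "- (w / 2) \<notin> P" using sym(1)[of "- (w / 2)"] half by auto
  from c[OF this] have "c = Re (K * w) / 2"
    using logabs_uminus[OF sym half] by simp
  then show ?thesis using c[OF z] by linarith
qed

end

section \<open>The rhombic lattice, its half-periods and the constant \<open>sym_c\<close>\<close>

lemma cnj_omega: "cnj (\<omega>\<^sub>1 a b) = \<omega>\<^sub>2 a b" "cnj (\<omega>\<^sub>2 a b) = \<omega>\<^sub>1 a b"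
  by (simp_all add: \<omega>\<^sub>1_def \<omega>\<^sub>2_def)

lemma omega_sum: "\<omega>\<^sub>1 a b + \<omega>\<^sub>2 a b = of_real (2 * a)"
  by (simp add: \<omega>\<^sub>1_def \<omega>\<^sub>2_def)

lemma sym_poles_eq: "sym_poles a b = (+) (of_real (2 * a)) ` \<Lambda> a b"
  by (auto simp: sym_poles_def)

lemma mem_sym_poles_iff: "z \<in> sym_poles a b \<longleftrightarrow> z - of_real (2 * a) \<in> \<Lambda> a b"
  unfolding sym_poles_eq by (auto simp: image_iff) (metis add_diff_cancel_left' diff_add_cancel add.commute)

lemma mem_Lambda_iff:
  "z \<in> \<Lambda> a b \<longleftrightarrow> (\<exists>m n::int. Re z = 2 * a * of_int (m + n) \<and> Im z = 2 * b * of_int (n - m))"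
  unfolding Lambda_eq by (auto simp: image_iff Re_lat_pt Im_lat_pt complex_eq_iff)

lemma Lambda_cnj: "z \<in> \<Lambda> a b \<Longrightarrow> cnj z \<in> \<Lambda> a b"
proof -
  assume "z \<in> \<Lambda> a b"
  then obtain m n :: int where "Re z = 2 * a * of_int (m + n)" "Im z = 2 * b * of_int (n - m)"
    by (auto simp: mem_Lambda_iff)
  then have "Re (cnj z) = 2 * a * of_int (n + m)" "Im (cnj z) = 2 * b * of_int (m - n)"
    by (auto simp: algebra_simps)
  then show ?thesis unfolding mem_Lambda_iff by blast
qed

text \<open>Subtracting the integer parts of the coordinates of \<open>z\<close> in the basis of
  periods leaves coordinates between 0 and 1.\<close>

lemma Lambda_cocompact:
  assumes "a > 0" "b > 0"
  shows "\<exists>l\<in>\<Lambda> a b. norm (z - l) \<le> 2 * norm (\<omega>\<^sub>1 a b) + 2 * norm (\<omega>\<^sub>2 a b)"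
proof -
  define s where "s = Re z / (4 * a) - Im z / (4 * b)"
  define t where "t = Re z / (4 * a) + Im z / (4 * b)"
  have z: "z = of_real s * (2 * \<omega>\<^sub>1 a b) + of_real t * (2 * \<omega>\<^sub>2 a b)"
    using assms by (simp add: complex_eq_iff s_def t_def \<omega>\<^sub>1_def \<omega>\<^sub>2_def field_simps)
  define l where "l = lat_pt a b (\<lfloor>s\<rfloor>, \<lfloor>t\<rfloor>)"
  have "z - l = of_real (frac s) * (2 * \<omega>\<^sub>1 a b) + of_real (frac t) * (2 * \<omega>\<^sub>2 a b)"
    unfolding z l_def lat_pt_def frac_def by (simp add: algebra_simps)
  then have "norm (z - l) \<le> \<bar>frac s\<bar> * (2 * norm (\<omega>\<^sub>1 a b)) + \<bar>frac t\<bar> * (2 * norm (\<omega>\<^sub>2 a b))"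
    using norm_triangle_ineq[of "of_real (frac s) * (2 * \<omega>\<^sub>1 a b)" "of_real (frac t) * (2 * \<omega>\<^sub>2 a b)"]
    by (simp add: norm_mult)
  also have "\<dots> \<le> 1 * (2 * norm (\<omega>\<^sub>1 a b)) + 1 * (2 * norm (\<omega>\<^sub>2 a b))"
    by (intro add_mono mult_right_mono) (auto simp: frac_lt_1 less_imp_le abs_le_iff)
  finally show ?thesis by (auto simp: l_def Lambda_eq)
qed

text \<open>The distinctness result is applied to \<open>\<omega>\<^sub>1 a b\<close> and to
  \<open>2 * a\<close>, the sum of both half-periods; their difference is
  \<open>- \<omega>\<^sub>2 a b\<close>. Membership of any of these three points in the lattice
  would make an integer equal to 1/2 up to sign.\<close>

lemma e1_neq_e3:
  assumes "a > 0" "b > 0"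
  shows "e\<^sub>1 a b \<noteq> e\<^sub>3 a b"
proof -
  interpret cubic_lattice "\<Lambda> a b" by (rule cubic_lattice_Lambda[OF assms])
  have odd: "2 * real_of_int k \<noteq> 1" for k
  proof
    assume "2 * real_of_int k = 1"
    then have "real_of_int (2 * k) = real_of_int 1" by simp
    then show False by (simp only: of_int_eq_iff) presburger
  qed
  have half: "\<omega>\<^sub>1 a b \<notin> \<Lambda> a b" "- \<omega>\<^sub>2 a b \<notin> \<Lambda> a b"
  proof -
    show "\<omega>\<^sub>1 a b \<notin> \<Lambda> a b"
    proof
      assume "\<omega>\<^sub>1 a b \<in> \<Lambda> a b"
      then obtain k :: int where "a = 2 * a * of_int k"
        by (auto simp: mem_Lambda_iff \<omega>\<^sub>1_def simp del: of_int_add)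
      then show False using assms odd[of k] by simp
    qed
    show "- \<omega>\<^sub>2 a b \<notin> \<Lambda> a b"
    proof
      assume "- \<omega>\<^sub>2 a b \<in> \<Lambda> a b"
      then obtain k :: int where "- a = 2 * a * of_int k"
        by (auto simp: mem_Lambda_iff \<omega>\<^sub>2_def simp del: of_int_add)
      then have "a * (2 * of_int (- k)) = a * 1" by simp
      then show False using assms odd[of "- k"] unfolding mult_cancel_left by simp
    qed
  qed
  have "of_real (2 * a) \<notin> \<Lambda> a b"
  proof
    assume "of_real (2 * a) \<in> \<Lambda> a b"
    then obtain m n :: int where "2 * a = 2 * a * of_int (m + n)" "0 = 2 * b * real_of_int (n - m)"
      by (auto simp: mem_Lambda_iff simp del: of_int_add of_int_diff)
    then have "real_of_int (m + n) = 1" "n = m" using assms by auto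
    then show False using odd[of n] by simp
  qed
  moreover have "2 * of_real (2 * a) \<in> \<Lambda> a b"
    unfolding mem_Lambda_iff by (intro exI[of _ 1]) simp
  moreover have "\<omega>\<^sub>1 a b - of_real (2 * a) = - \<omega>\<^sub>2 a b"
    by (simp add: \<omega>\<^sub>1_def \<omega>\<^sub>2_def)
  ultimately have "weierstrass_P (\<Lambda> a b) (\<omega>\<^sub>1 a b) \<noteq> weierstrass_P (\<Lambda> a b) (of_real (2 * a))"
    using half Lambda_cocompact[OF assms] by (intro weierstrass_P_half_periods_distinct) auto
  then show ?thesis by (simp only: e\<^sub>1_def e\<^sub>3_def omega_sum not_False_eq_True)
qed

lemma e_cnj:
  assumes "a > 0" "b > 0"
  shows "e\<^sub>2 a b = cnj (e\<^sub>1 a b)" "cnj (e\<^sub>3 a b) = e\<^sub>3 a b"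
proof -
  interpret cubic_lattice "\<Lambda> a b" by (rule cubic_lattice_Lambda[OF assms])
  note weierstrass_P_cnj[OF Lambda_cnj]
  from this[symmetric] show "e\<^sub>2 a b = cnj (e\<^sub>1 a b)" "cnj (e\<^sub>3 a b) = e\<^sub>3 a b"
    by (simp_all add: e\<^sub>1_def e\<^sub>2_def e\<^sub>3_def cnj_omega add.commute)
qed

text \<open>Since \<open>(e\<^sub>1 - e\<^sub>3) * (e\<^sub>3 - e\<^sub>2) = - \<bar>e\<^sub>1 - e\<^sub>3\<bar>\<^sup>2\<close>, the description of \<^const>\<open>sym_c\<close> is
  proper.\<close>

lemma sym_c_nonzero:
  assumes "a > 0" "b > 0"
  shows "sym_c a b \<noteq> 0"
proof -
  define d where "d = e\<^sub>1 a b - e\<^sub>3 a b"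
  have "e\<^sub>3 a b - e\<^sub>2 a b = - cnj d"
    using e_cnj[OF assms] by (simp add: d_def)
  then have prod: "(e\<^sub>1 a b - e\<^sub>3 a b) * (e\<^sub>3 a b - e\<^sub>2 a b) = - of_real ((cmod d)\<^sup>2)"
    unfolding d_def[symmetric] complex_norm_square by simp
  have "sym_c a b = - \<i> * of_real (cmod d)"
    unfolding sym_c_def prod
  proof (rule the_equality)
    show "(- \<i> * of_real (cmod d))\<^sup>2 = - of_real ((cmod d)\<^sup>2) \<and>
        - \<i> * of_real (cmod d) = - \<i> * of_real (cmod (- \<i> * of_real (cmod d)))"
      by (simp add: power_mult_distrib norm_mult)
  next
    fix c assume c: "c\<^sup>2 = - of_real ((cmod d)\<^sup>2) \<and> c = - \<i> * of_real (cmod c)"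
    then have "cmod (c\<^sup>2) = cmod (of_real ((cmod d)\<^sup>2) :: complex)" by simp
    then have "(cmod c)\<^sup>2 = (cmod d)\<^sup>2" by (simp add: norm_power)
    then have "cmod c = cmod d" by simp
    then show "c = - \<i> * of_real (cmod d)" using c by metis
  qed
  moreover have "d \<noteq> 0" using e1_neq_e3[OF assms] by (simp add: d_def)
  ultimately show ?thesis by simp
qed

section \<open>The unnormalized symmetric function and its symmetries\<close>

text \<open>This is \<open>sym_c a b * sym_P a b z\<close>. Working without the divisor gives the
  double poles leading coefficient 1, as the locale \<open>double_poles\<close> requires.\<close>

definition shifted_P :: "real \<Rightarrow> real \<Rightarrow> complex \<Rightarrow> complex" where
  "shifted_P a b z = weierstrass_P (\<Lambda> a b) (z - of_real (2 * a)) - e\<^sub>3 a b"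

lemma sym_P_eq: "sym_P a b z = shifted_P a b z / sym_c a b"
  using omega_sum[of a b] by (simp add: sym_P_def shifted_P_def diff_diff_add)

text \<open>It makes \<open>2 * a\<close> a half-period, so reflection in 0 preserves the set of
  poles and the value of \<open>shifted_P\<close>.\<close>

lemma four_a_mem: "of_real (4 * a) \<in> \<Lambda> a b"
  unfolding mem_Lambda_iff by (intro exI[of _ 1]) simp

lemma period_mem: "2 * \<omega>\<^sub>1 a b \<in> \<Lambda> a b" "2 * \<omega>\<^sub>2 a b \<in> \<Lambda> a b"
proof -
  show "2 * \<omega>\<^sub>1 a b \<in> \<Lambda> a b" unfolding mem_Lambda_iff
    by (intro exI[of _ 1] exI[of _ 0]) (simp add: \<omega>\<^sub>1_def)
  show "2 * \<omega>\<^sub>2 a b \<in> \<Lambda> a b" unfolding mem_Lambda_iff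
    by (intro exI[of _ 0] exI[of _ 1]) (simp add: \<omega>\<^sub>2_def)
qed

lemma notin_sym_polesI:
  assumes "a > 0" "b > 0"
    and "\<And>m n::int. Re z = 2 * a * (1 + of_int (m + n)) \<Longrightarrow> Im z = 2 * b * of_int (n - m) \<Longrightarrow> False"
  shows "z \<notin> sym_poles a b"
proof
  assume "z \<in> sym_poles a b"
  then obtain m n :: int where
    "Re z - 2 * a = 2 * a * of_int (m + n)" "Im z = 2 * b * of_int (n - m)"
    unfolding mem_sym_poles_iff mem_Lambda_iff by (auto simp del: of_int_add of_int_diff)
  then show False using assms(3)[of m n] by (simp add: distrib_left del: of_int_add of_int_diff)
qed

text \<open>These are the halves of the two periods; \<open>logabs_quasi_periodic\<close> determines
  its constant at their negatives.\<close>

lemma omega_notin_sym_poles: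
  assumes "a > 0" "b > 0"
  shows "\<omega>\<^sub>1 a b \<notin> sym_poles a b" "\<omega>\<^sub>2 a b \<notin> sym_poles a b"
proof -
  have *: "a \<noteq> 2 * a * (1 + real_of_int k)" for k
  proof
    assume "a = 2 * a * (1 + real_of_int k)"
    then have "a * 1 = a * (2 * (1 + real_of_int k))" by simp
    then have "2 * (1 + real_of_int k) = 1"
      using assms unfolding mult_cancel_left by simp
    then have "real_of_int (2 * (1 + k)) = real_of_int 1" by simp
    then show False unfolding of_int_eq_iff by presburger
  qed
  show "\<omega>\<^sub>1 a b \<notin> sym_poles a b"
    by (rule notin_sym_polesI[OF assms]) (use * in \<open>simp add: \<omega>\<^sub>1_def del: of_int_add of_int_diff\<close>)
  show "\<omega>\<^sub>2 a b \<notin> sym_poles a b"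
    by (rule notin_sym_polesI[OF assms]) (use * in \<open>simp add: \<omega>\<^sub>2_def del: of_int_add of_int_diff\<close>)
qed

lemma zero_notin_sym_poles:
  assumes "a > 0" "b > 0"
  shows "0 \<notin> sym_poles a b"
proof (rule notin_sym_polesI[OF assms])
  fix m n :: int
  assume "Re 0 = 2 * a * (1 + of_int (m + n))" "Im 0 = 2 * b * of_int (n - m)"
  then have "1 + real_of_int (m + n) = 0" "real_of_int (n - m) = 0"
    using assms by (simp_all del: of_int_add of_int_diff)
  then have "real_of_int (1 + (m + n)) = real_of_int 0" "real_of_int (n - m) = real_of_int 0"
    by simp_all
  then show False unfolding of_int_eq_iff by presburger
qed

lemma double_poles_shifted_P:
  assumes "a > 0" "b > 0"
  shows "double_poles (sym_poles a b) (shifted_P a b)"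
proof
  interpret cubic_lattice "\<Lambda> a b" by (rule cubic_lattice_Lambda[OF assms])
  show "finite {p \<in> sym_poles a b. norm p \<le> R}" for R
    unfolding sym_poles_eq by (rule finite_cball_translate[OF finite_cball])
  show "0 \<notin> sym_poles a b" by (rule zero_notin_sym_poles[OF assms])
  fix R :: real assume "R > 0"
  define c where "c = complex_of_real (2 * a)"
  have c: "norm c = 2 * a" using assms by (simp add: c_def)
  have "R + 2 * a > 0" using \<open>R > 0\<close> assms by simp
  then obtain S U where S: "finite S" "\<Lambda> a b \<inter> ball 0 (R + 2 * a) \<subseteq> S" "S \<subseteq> \<Lambda> a b"
    and U: "U holomorphic_on ball 0 (R + 2 * a)"
    and P: "\<And>z. z \<in> ball 0 (R + 2 * a) \<Longrightarrow> weierstrass_P (\<Lambda> a b) z = (\<Sum>l\<in>S. 1 / (z - l)\<^sup>2) + U z"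
    by (rule weierstrass_P_local) blast
  have ball: "z - c \<in> ball 0 (R + 2 * a)" if "z \<in> ball 0 R" for z
    using that norm_triangle_ineq4[of z c] c by auto
  show "\<exists>S U. finite S \<and> sym_poles a b \<inter> ball 0 R \<subseteq> S \<and> S \<subseteq> sym_poles a b \<and> U holomorphic_on ball 0 R \<and>
      (\<forall>z\<in>ball 0 R - sym_poles a b. shifted_P a b z = (\<Sum>p\<in>S. 1 / (z - p)\<^sup>2) + U z)"
  proof (intro exI conjI ballI)
    show "finite ((+) c ` S)" using S by simp
    show "(+) c ` S \<subseteq> sym_poles a b" using S by (auto simp: sym_poles_eq c_def)
    show "sym_poles a b \<inter> ball 0 R \<subseteq> (+) c ` S"
    proof
      fix z assume z: "z \<in> sym_poles a b \<inter> ball 0 R"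
      then have "z - c \<in> S"
        using S(2) ball[of z] by (auto simp: mem_sym_poles_iff c_def)
      then show "z \<in> (+) c ` S" by (intro image_eqI[of _ _ "z - c"]) auto
    qed
    have "U \<circ> (\<lambda>z. z - c) holomorphic_on ball 0 R"
      by (rule holomorphic_on_compose_gen[OF _ U]) (use ball in \<open>auto intro!: holomorphic_intros\<close>)
    then show "(\<lambda>z. U (z - c) - e\<^sub>3 a b) holomorphic_on ball 0 R"
      by (auto simp: o_def intro!: holomorphic_intros)
    fix z assume z: "z \<in> ball 0 R - sym_poles a b"
    have "(\<Sum>p\<in>(+) c ` S. 1 / (z - p)\<^sup>2) = (\<Sum>l\<in>S. 1 / (z - c - l)\<^sup>2)"
      by (subst sum.reindex) (auto simp: algebra_simps)
    then show "shifted_P a b z = (\<Sum>p\<in>(+) c ` S. 1 / (z - p)\<^sup>2) + (U (z - c) - e\<^sub>3 a b)"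
      using P[OF ball[of z]] z by (simp add: shifted_P_def c_def)
  qed
qed

lemma
  assumes "a > 0" "b > 0"
  shows sym_poles_add: "w \<in> \<Lambda> a b \<Longrightarrow> z + w \<in> sym_poles a b \<longleftrightarrow> z \<in> sym_poles a b"
    and sym_poles_uminus: "z \<in> sym_poles a b \<Longrightarrow> - z \<in> sym_poles a b"
    and sym_poles_cnj: "z \<in> sym_poles a b \<Longrightarrow> cnj z \<in> sym_poles a b"
    and shifted_P_add: "w \<in> \<Lambda> a b \<Longrightarrow> shifted_P a b (z + w) = shifted_P a b z"
    and shifted_P_uminus: "shifted_P a b (- z) = shifted_P a b z"
    and shifted_P_cnj: "shifted_P a b (cnj z) = cnj (shifted_P a b z)"
proof -
  interpret cubic_lattice "\<Lambda> a b" by (rule cubic_lattice_Lambda[OF assms])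
  show "z + w \<in> sym_poles a b \<longleftrightarrow> z \<in> sym_poles a b" if "w \<in> \<Lambda> a b"
  proof -
    have "z - of_real (2 * a) + w \<in> \<Lambda> a b \<longleftrightarrow> z - of_real (2 * a) \<in> \<Lambda> a b"
      using add_mem[OF _ that] diff_mem[OF _ that] by (metis add_diff_cancel_right')
    then show ?thesis by (simp add: mem_sym_poles_iff algebra_simps)
  qed
  show "- z \<in> sym_poles a b" if "z \<in> sym_poles a b"
  proof -
    have "- (z - of_real (2 * a)) - of_real (4 * a) \<in> \<Lambda> a b"
      by (rule diff_mem[OF uminus_mem four_a_mem]) (use that in \<open>simp only: mem_sym_poles_iff\<close>)
    then show ?thesis by (simp add: mem_sym_poles_iff algebra_simps)
  qed
  show "cnj z \<in> sym_poles a b" if "z \<in> sym_poles a b"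
    using Lambda_cnj[of "z - of_real (2 * a)"] that by (simp add: mem_sym_poles_iff)
  show "shifted_P a b (z + w) = shifted_P a b z" if "w \<in> \<Lambda> a b"
    using weierstrass_P_add[OF that, of "z - of_real (2 * a)"] by (simp add: shifted_P_def algebra_simps)
  show "shifted_P a b (- z) = shifted_P a b z"
    using weierstrass_P_uminus[of "z + of_real (2 * a)"]
      weierstrass_P_add[OF four_a_mem, of "z - of_real (2 * a)"]
    by (simp add: shifted_P_def algebra_simps)
  show "shifted_P a b (cnj z) = cnj (shifted_P a b z)"
    using weierstrass_P_cnj[OF Lambda_cnj, of "z - of_real (2 * a)"] e_cnj[OF assms]
    by (simp add: shifted_P_def)
qed

lemma path_integral_values_image:
  assumes "\<And>\<gamma>. valid_path \<gamma> \<Longrightarrow> path_image \<gamma> \<subseteq> S \<Longrightarrow> contour_integral \<gamma> f = h (contour_integral \<gamma> g)"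
  shows "path_integral_values S f w = h ` path_integral_values S g w"
  unfolding path_integral_values_def setcompr_eq_image image_image
  by (rule image_cong) (use assms in auto)

text \<open>Up to the real part of a quadratic polynomial this is the logarithm of the absolute
  value of the Weierstrass sigma function, shifted so that its zeros are the poles
  \<open>sym_poles a b\<close>.\<close>

definition logabs_sigma :: "real \<Rightarrow> real \<Rightarrow> complex \<Rightarrow> real" where
  "logabs_sigma a b = double_poles.logabs (sym_poles a b) (shifted_P a b)"

lemma sym_zeta_eq:
  assumes "a > 0" "b > 0" "z \<notin> sym_poles a b"
  shows "sym_c a b * sym_zeta a b z = double_poles.zeta (sym_poles a b) (shifted_P a b) z"
proof -
  interpret double_poles "sym_poles a b" "shifted_P a b"
    by (rule double_poles_shifted_P[OF assms(1,2)])
  let ?c = "sym_c a b"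
  have "contour_integral \<gamma> (sym_P a b) = contour_integral \<gamma> (shifted_P a b) / ?c"
    if \<gamma>: "valid_path \<gamma>" "path_image \<gamma> \<subseteq> - sym_poles a b" for \<gamma>
  proof -
    have "shifted_P a b contour_integrable_on \<gamma>"
    proof -
      have "((\<lambda>z. - zeta z) has_field_derivative shifted_P a b z) (at z within - sym_poles a b)"
        if "z \<in> - sym_poles a b" for z
        using DERIV_minus[OF zeta_deriv[of z]] that by (auto intro: has_field_derivative_at_within)
      from contour_integral_primitive[OF this \<gamma>] show ?thesis
        by (auto simp: contour_integrable_on_def)
    qed
    then show ?thesis
      unfolding sym_P_eq[abs_def] by (rule contour_integral_div)
  qed
  then have "path_integral_values (- sym_poles a b) (sym_P a b) z =
      (\<lambda>w. w / ?c) ` path_integral_values (- sym_poles a b) (shifted_P a b) z"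
    by (rule path_integral_values_image)
  \<comment> \<open>Division by \<open>sym_c\<close> may be moved through \<open>the_elem\<close>
    because the set of integral values is a singleton.\<close>
  moreover obtain w where "path_integral_values (- sym_poles a b) (shifted_P a b) z = {w}"
  proof -
    define R where "R = norm z + 1"
    have "R > 0" "z \<in> ball 0 R - sym_poles a b" using assms by (auto simp: R_def add_nonneg_pos)
    with zeta_primitive[OF this(1)] path_integral_values_f[of R _ z] show ?thesis
      using that by blast
  qed
  ultimately show ?thesis
    using sym_c_nonzero[OF assms(1,2)] by (simp add: sym_zeta_def zeta_def)
qed

lemma sym_Z_eq:
  assumes "a > 0" "b > 0"
  shows "sym_Z a b z = (if z \<in> sym_poles a b then \<infinity> else ereal (- 1 / (2 * pi) * logabs_sigma a b z))"
proof -
  interpret double_poles "sym_poles a b" "shifted_P a b"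
    by (rule double_poles_shifted_P[OF assms])
  have "contour_integral \<gamma> (\<lambda>z. sym_c a b * sym_zeta a b z) = contour_integral \<gamma> zeta"
    if "path_image \<gamma> \<subseteq> - sym_poles a b" for \<gamma>
    by (rule contour_integral_eq) (use that sym_zeta_eq[OF assms] in auto)
  then have "path_integral_values (- sym_poles a b) (\<lambda>z. sym_c a b * sym_zeta a b z) z =
      (\<lambda>w. w) ` path_integral_values (- sym_poles a b) zeta z"
    by (rule path_integral_values_image)
  then show ?thesis by (simp add: sym_Z_def logabs_sigma_def logabs_def)
qed

lemma sym_Z_hat_eq:
  assumes "a > 0" "b > 0" "z \<notin> sym_poles a b"
  shows "sym_Z_hat a b A B C z =
    ereal (- 1 / (2 * pi) * logabs_sigma a b z + (A * (Re z)\<^sup>2 + B * (Im z)\<^sup>2 + C * Re z * Im z))"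
  using assms by (simp add: sym_Z_hat_def sym_Z_eq)

section \<open>Existence and uniqueness of the quadratic correction\<close>

lemma exists_periodic_correction:
  assumes "a > 0" "b > 0"
  shows "\<exists>A B. doubly_periodic (2 * \<omega>\<^sub>1 a b) (2 * \<omega>\<^sub>2 a b) (sym_Z_hat a b A B 0)"
proof -
  interpret double_poles "sym_poles a b" "shifted_P a b"
    by (rule double_poles_shifted_P[OF assms])
  note sym = sym_poles_uminus[OF assms] shifted_P_uminus[OF assms]
  note add = sym_poles_add[OF assms] shifted_P_add[OF assms]
  let ?p = "2 * \<omega>\<^sub>1 a b" and ?q = "2 * \<omega>\<^sub>2 a b"
  obtain K where K: "\<And>z. z \<notin> sym_poles a b \<Longrightarrow> zeta (z + ?p) = zeta z + K"
    using zeta_quasi_periodic[of ?p] add[OF period_mem(1)] by blast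
  have K': "zeta (z + ?q) = zeta z + cnj K" if "z \<notin> sym_poles a b" for z
  proof -
    have z': "cnj z \<notin> sym_poles a b"
      using that sym_poles_cnj[OF assms, of "cnj z"] by auto
    then have z'': "cnj z + ?p \<notin> sym_poles a b" using add(1)[OF period_mem(1)] by simp
    have cnj: "zeta (cnj w) = cnj (zeta w)" if "w \<notin> sym_poles a b" for w
      using that by (intro zeta_cnj sym_poles_cnj[OF assms] shifted_P_cnj[OF assms])
    have "zeta (z + ?q) = zeta (cnj (cnj z + ?p))" by (simp add: cnj_omega)
    also have "\<dots> = cnj (zeta (cnj z) + K)" by (simp only: cnj[OF z''] K[OF z'])
    finally show ?thesis by (simp add: cnj[OF that])
  qed
  have Lp: "logabs_sigma a b (z + ?p) = logabs_sigma a b z + Re (K * z) + Re (K * ?p) / 2"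
    if "z \<notin> sym_poles a b" for z
    unfolding logabs_sigma_def
    by (rule logabs_quasi_periodic[OF add(1)[OF period_mem(1)] K sym _ that])
       (use omega_notin_sym_poles[OF assms] in simp_all)
  have Lq: "logabs_sigma a b (z + ?q) = logabs_sigma a b z + Re (cnj K * z) + Re (cnj K * ?q) / 2"
    if "z \<notin> sym_poles a b" for z
    unfolding logabs_sigma_def
    by (rule logabs_quasi_periodic[OF add(1)[OF period_mem(2)] K' sym _ that])
       (use omega_notin_sym_poles[OF assms] in simp_all)
  \<comment> \<open>Found by comparing coefficients: translation by \<open>?p\<close> changes the
    quadratic form by \<open>4 * a * A * Re z - 4 * b * B * Im z\<close> plus a constant, which must
    cancel \<open>Re (K * z) / (2 * pi)\<close>. The constants then match as well, and
    \<open>?q\<close> leads to the complex conjugate equations with the same solution.\<close>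
  define A where "A = Re K / (8 * pi * a)"
  define B where "B = Im K / (8 * pi * b)"
  have KAB: "Re K = 8 * pi * a * A" "Im K = 8 * pi * b * B"
    using assms by (auto simp: A_def B_def)
  have p: "sym_Z_hat a b A B 0 (z + ?p) = sym_Z_hat a b A B 0 z" for z
  proof (cases "z \<in> sym_poles a b")
    case False
    have "- 1 / (2 * pi) * (Re (K * z) + Re (K * ?p) / 2) + A * (Re (z + ?p))\<^sup>2 + B * (Im (z + ?p))\<^sup>2
        = A * (Re z)\<^sup>2 + B * (Im z)\<^sup>2"
      by (simp add: KAB \<omega>\<^sub>1_def field_simps power2_eq_square)
    then have "- 1 / (2 * pi) * logabs_sigma a b (z + ?p) + (A * (Re (z + ?p))\<^sup>2 + B * (Im (z + ?p))\<^sup>2)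
        = - 1 / (2 * pi) * logabs_sigma a b z + (A * (Re z)\<^sup>2 + B * (Im z)\<^sup>2)"
      unfolding Lp[OF False] distrib_left[of "- 1 / (2 * pi)"] by linarith
    moreover have "z + ?p \<notin> sym_poles a b" using False add(1)[OF period_mem(1), of z] by simp
    ultimately show ?thesis
      using False by (simp only: sym_Z_hat_eq[OF assms] mult_zero_left add_0_right not_False_eq_True)
  qed (use add(1)[OF period_mem(1)] in \<open>simp add: sym_Z_hat_def sym_Z_eq[OF assms]\<close>)
  have q: "sym_Z_hat a b A B 0 (z + ?q) = sym_Z_hat a b A B 0 z" for z
  proof (cases "z \<in> sym_poles a b")
    case False
    have "- 1 / (2 * pi) * (Re (cnj K * z) + Re (cnj K * ?q) / 2) + A * (Re (z + ?q))\<^sup>2 + B * (Im (z + ?q))\<^sup>2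
        = A * (Re z)\<^sup>2 + B * (Im z)\<^sup>2"
      by (simp add: KAB \<omega>\<^sub>2_def field_simps power2_eq_square)
    then have "- 1 / (2 * pi) * logabs_sigma a b (z + ?q) + (A * (Re (z + ?q))\<^sup>2 + B * (Im (z + ?q))\<^sup>2)
        = - 1 / (2 * pi) * logabs_sigma a b z + (A * (Re z)\<^sup>2 + B * (Im z)\<^sup>2)"
      unfolding Lq[OF False] distrib_left[of "- 1 / (2 * pi)"] by linarith
    moreover have "z + ?q \<notin> sym_poles a b" using False add(1)[OF period_mem(2), of z] by simp
    ultimately show ?thesis
      using False by (simp only: sym_Z_hat_eq[OF assms] mult_zero_left add_0_right not_False_eq_True)
  qed (use add(1)[OF period_mem(2)] in \<open>simp add: sym_Z_hat_def sym_Z_eq[OF assms]\<close>)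
  show ?thesis unfolding doubly_periodic_def using p q by blast
qed

text \<open>The two quadratic forms differ by a function that vanishes at all periods. At
  \<open>?p + ?q\<close>, which is real, only the first coefficient survives; sum and difference of
  the equations at \<open>?p\<close> and \<open>?q\<close> then separate the other two.\<close>

lemma periodic_correction_unique:
  assumes ab: "a > 0" "b > 0"
    and 0: "doubly_periodic (2 * \<omega>\<^sub>1 a b) (2 * \<omega>\<^sub>2 a b) (sym_Z_hat a b A0 B0 C0)"
    and 1: "doubly_periodic (2 * \<omega>\<^sub>1 a b) (2 * \<omega>\<^sub>2 a b) (sym_Z_hat a b A B C)"
  shows "A = A0 \<and> B = B0 \<and> C = C0"
proof -
  let ?p = "2 * \<omega>\<^sub>1 a b" and ?q = "2 * \<omega>\<^sub>2 a b"
  have zero: "sym_Z_hat a b A B C w = sym_Z_hat a b A B C 0"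
    if "doubly_periodic ?p ?q (sym_Z_hat a b A B C)" "w = ?p \<or> w = ?q \<or> w = ?p + ?q" for A B C w
    using that unfolding doubly_periodic_def by (metis add_0)
  have np: "w \<notin> sym_poles a b" if "w = ?p \<or> w = ?q \<or> w = ?p + ?q" for w
    using that sym_poles_add[OF ab period_mem(1), of 0] sym_poles_add[OF ab period_mem(2), of 0]
      sym_poles_add[OF ab period_mem(2), of ?p] zero_notin_sym_poles[OF ab]
    by auto
  have eq: "A * (Re w)\<^sup>2 + B * (Im w)\<^sup>2 + C * Re w * Im w = A0 * (Re w)\<^sup>2 + B0 * (Im w)\<^sup>2 + C0 * Re w * Im w"
    if "w = ?p \<or> w = ?q \<or> w = ?p + ?q" for w
    using zero[OF 0 that] zero[OF 1 that] np[OF that] zero_notin_sym_poles[OF ab]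
    by (simp add: sym_Z_hat_def sym_Z_eq[OF ab])
  have "A * (4 * a)\<^sup>2 = A0 * (4 * a)\<^sup>2"
    using eq[of "?p + ?q"] by (simp add: \<omega>\<^sub>1_def \<omega>\<^sub>2_def)
  then have A: "A = A0" using ab by simp
  have "A * (2 * a)\<^sup>2 + B * (2 * b)\<^sup>2 - 4 * (C * a * b) = A0 * (2 * a)\<^sup>2 + B0 * (2 * b)\<^sup>2 - 4 * (C0 * a * b)"
    using eq[of ?p] by (simp add: \<omega>\<^sub>1_def)
  moreover have "A * (2 * a)\<^sup>2 + B * (2 * b)\<^sup>2 + 4 * (C * a * b) = A0 * (2 * a)\<^sup>2 + B0 * (2 * b)\<^sup>2 + 4 * (C0 * a * b)"
    using eq[of ?q] by (simp add: \<omega>\<^sub>2_def)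
  ultimately have "B * (2 * b)\<^sup>2 = B0 * (2 * b)\<^sup>2" "C * a * b = C0 * a * b"
    unfolding A by linarith+
  then show ?thesis using A ab by simp
qed


subsection \<open>Integration by parts in the plane\<close>

text \<open>This gives access to Fubini's theorem in the coordinates \<open>x\<close> and
  \<open>y\<close>; it suffices to compare the two measures on boxes.\<close>

lemma lborel_complex: "lborel = distr (lborel \<Otimes>\<^sub>M lborel) borel (\<lambda>(x, y). Complex x y)"
proof (rule lborel_eqI)
  have [measurable]: "(\<lambda>(x, y). Complex x y) \<in> borel_measurable (lborel \<Otimes>\<^sub>M lborel)"
    unfolding Complex_eq by measurable
  fix l u :: complex assume lu: "\<And>b. b \<in> Basis \<Longrightarrow> l \<bullet> b \<le> u \<bullet> b"
  then have le: "Re l \<le> Re u" "Im l \<le> Im u"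
    using lu[of 1] lu[of \<i>] by (simp_all add: Basis_complex_def)
  have "(\<lambda>(x, y). Complex x y) -` box l u \<inter> space (lborel \<Otimes>\<^sub>M lborel) = {Re l<..<Re u} \<times> {Im l<..<Im u}"
    by (auto simp: box_def Basis_complex_def space_pair_measure)
  then show "emeasure (distr (lborel \<Otimes>\<^sub>M lborel) borel (\<lambda>(x, y). Complex x y)) (box l u) = (\<Prod>b\<in>Basis. (u - l) \<bullet> b)"
    using le by (simp add: emeasure_distr lborel.emeasure_pair_measure_Times Basis_complex_def ennreal_mult)
qed simp

lemma measurable_Complex [measurable]:
  "(\<lambda>p. Complex (fst p) (snd p)) \<in> borel_measurable (lborel \<Otimes>\<^sub>M lborel)"
  unfolding Complex_eq by measurable

lemma nn_integral_complex:
  assumes [measurable]: "f \<in> borel_measurable borel"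
  shows "(\<integral>\<^sup>+z. f z \<partial>lborel) = (\<integral>\<^sup>+y. \<integral>\<^sup>+x. f (Complex x y) \<partial>lborel \<partial>lborel)"
proof -
  have "(\<integral>\<^sup>+z. f z \<partial>lborel) = (\<integral>\<^sup>+p. f (Complex (fst p) (snd p)) \<partial>(lborel \<Otimes>\<^sub>M lborel))"
    by (subst lborel_complex, subst nn_integral_distr) (simp_all add: case_prod_beta')
  also have "\<dots> = (\<integral>\<^sup>+y. \<integral>\<^sup>+x. f (Complex x y) \<partial>lborel \<partial>lborel)"
    by (subst lborel_pair.nn_integral_snd[symmetric]) simp_all
  finally show ?thesis .
qed

lemma
  fixes f :: "complex \<Rightarrow> real"
  assumes "integrable lborel f"
  shows integral_complex_fst: "(\<integral>z. f z \<partial>lborel) = (\<integral>y. \<integral>x. f (Complex x y) \<partial>lborel \<partial>lborel)"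
    and integral_complex_snd: "(\<integral>z. f z \<partial>lborel) = (\<integral>x. \<integral>y. f (Complex x y) \<partial>lborel \<partial>lborel)"
proof -
  have [measurable]: "f \<in> borel_measurable borel" using assms by auto
  have eq: "(\<integral>z. f z \<partial>lborel) = (\<integral>p. f (Complex (fst p) (snd p)) \<partial>(lborel \<Otimes>\<^sub>M lborel))"
    by (subst lborel_complex, subst integral_distr) (simp_all add: case_prod_beta')
  have "integrable (distr (lborel \<Otimes>\<^sub>M lborel) borel (\<lambda>(x, y). Complex x y)) f"
    using assms by (subst (asm) lborel_complex)
  then have int: "integrable (lborel \<Otimes>\<^sub>M lborel) (\<lambda>(x, y). f (Complex x y))"
    by (subst (asm) integrable_distr_eq) (simp_all add: case_prod_beta')
  show "(\<integral>z. f z \<partial>lborel) = (\<integral>y. \<integral>x. f (Complex x y) \<partial>lborel \<partial>lborel)"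
    unfolding eq using lborel_pair.integral_snd[OF int] by (simp add: case_prod_beta')
  show "(\<integral>z. f z \<partial>lborel) = (\<integral>x. \<integral>y. f (Complex x y) \<partial>lborel \<partial>lborel)"
    unfolding eq using lborel_pair.integral_fst[OF int] by (simp add: case_prod_beta')
qed

section \<open>Directional derivatives and Green's identity\<close>

text \<open>Only lines through \<open>z\<close> are considered, with the derivative as an explicit
  function. This is all that integration by parts along one axis uses, and for open \<open>U\<close>
  it depends only on the values of \<open>f\<close> on \<open>U\<close>.\<close>

definition dir_deriv_on :: "complex \<Rightarrow> complex set \<Rightarrow> (complex \<Rightarrow> real) \<Rightarrow> (complex \<Rightarrow> real) \<Rightarrow> bool" where
  "dir_deriv_on d U f f' \<longleftrightarrow>
     (\<forall>z\<in>U. ((\<lambda>t::real. f (z + of_real t * d)) has_real_derivative f' z) (at 0))"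

lemma dir_deriv_onD:
  "dir_deriv_on d U f f' \<Longrightarrow> z \<in> U \<Longrightarrow> ((\<lambda>t::real. f (z + of_real t * d)) has_real_derivative f' z) (at 0)"
  by (simp add: dir_deriv_on_def)

lemma eventually_line_in_open:
  fixes d :: complex
  assumes "open U" "z \<in> U"
  shows "\<forall>\<^sub>F t in nhds (0::real). z + of_real t * d \<in> U"
proof -
  have "((\<lambda>t::real. z + of_real t * d) \<longlongrightarrow> z + of_real 0 * d) (nhds 0)"
    by (intro tendsto_intros) (auto simp: filterlim_def)
  then show ?thesis
    using assms topological_tendstoD by fastforce
qed

lemma dir_deriv_zero_outside:
  assumes "dir_deriv_on d UNIV f f'" "closed K" "\<And>z. z \<notin> K \<Longrightarrow> f z = 0" "z \<notin> K"
  shows "f' z = 0"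
proof -
  have "\<forall>\<^sub>F t in nhds (0::real). z + of_real t * d \<in> - K"
    by (rule eventually_line_in_open) (use assms in auto)
  then have "\<forall>\<^sub>F t in nhds (0::real). f (z + of_real t * d) = 0"
    by eventually_elim (use assms in auto)
  then have "((\<lambda>t::real. f (z + of_real t * d)) has_real_derivative f' z) (at 0) \<longleftrightarrow>
      ((\<lambda>t::real. 0) has_real_derivative f' z) (at 0)"
    by (intro DERIV_cong_ev) auto
  then show ?thesis
    using dir_deriv_onD[OF assms(1), of z] DERIV_unique[OF DERIV_const] by fastforce
qed

lemma integrable_compact_support:
  fixes f :: "complex \<Rightarrow> real"
  assumes "continuous_on UNIV f" "compact K" "\<And>z. z \<notin> K \<Longrightarrow> f z = 0"
  shows "integrable lborel f"
proof -
  have "integrable lborel (\<lambda>z. indicator K z *\<^sub>R f z)"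
    by (rule borel_integrable_compact) (use assms in \<open>auto intro: continuous_on_subset[OF assms(1)]\<close>)
  also have "(\<lambda>z. indicator K z *\<^sub>R f z) = f"
    using assms(3) by (auto simp: indicator_def fun_eq_iff)
  finally show ?thesis .
qed

lemma integral_deriv_zero:
  fixes f f' :: "real \<Rightarrow> real"
  assumes d: "\<And>x. (f has_real_derivative f' x) (at x)" and "continuous_on UNIV f'"
    and zero: "\<And>x. \<bar>x\<bar> > M \<Longrightarrow> f x = 0" "\<And>x. \<bar>x\<bar> > M \<Longrightarrow> f' x = 0" and "M > 0"
  shows "(\<integral>x. f' x \<partial>lborel) = 0"
proof -
  \<comment> \<open>The bound \<open>M + 1\<close> puts the end points strictly beyond
    \<open>M\<close>, where \<open>f\<close> is known to vanish.\<close>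
  have "(\<integral>x. f' x * indicator {- (M + 1)..M + 1} x \<partial>lborel) = f (M + 1) - f (- (M + 1))"
    by (rule integral_FTC_Icc_real) (use assms in \<open>auto simp: continuous_on_eq_continuous_at\<close>)
  moreover have "(\<lambda>x. f' x * indicator {- (M + 1)..M + 1} x) = f'"
  proof
    show "f' x * indicator {- (M + 1)..M + 1} x = f' x" for x
      using zero(2)[of x] by (cases "\<bar>x\<bar> > M") (auto simp: indicator_def)
  qed
  ultimately show ?thesis using zero(1) \<open>M > 0\<close> by simp
qed

lemma Complex_add_of_real_i: "Complex x y + of_real t * \<i> = Complex x (t + y)"
  by (simp add: complex_eq_iff)

text \<open>Fubini's theorem with the inner integral along \<open>d\<close>: on each such line the
  integrand is the derivative of a function with compact support.\<close>

lemma integral_dir_deriv_zero: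
  assumes d: "d \<in> {1, \<i>}" and f: "dir_deriv_on d UNIV f f'" "continuous_on UNIV f'"
    and K: "compact K" "\<And>z. z \<notin> K \<Longrightarrow> f z = 0"
  shows "(\<integral>z. f' z \<partial>lborel) = 0"
proof -
  have z': "f' z = 0" if "z \<notin> K" for z
    using dir_deriv_zero_outside[OF f(1) compact_imp_closed[OF K(1)] K(2) that] .
  have int: "integrable lborel f'"
    by (rule integrable_compact_support[OF f(2) K(1) z'])
  obtain M where M: "M > 0" "\<And>z. z \<in> K \<Longrightarrow> norm z \<le> M"
    using compact_imp_bounded[OF K(1)] bounded_pos by metis
  have out: "Complex x y \<notin> K" if "\<bar>x\<bar> > M \<or> \<bar>y\<bar> > M" for x y
    using that M(2)[of "Complex x y"] abs_Re_le_cmod[of "Complex x y"] abs_Im_le_cmod[of "Complex x y"]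
    by auto
  from d consider "d = 1" | "d = \<i>" by auto
  then show ?thesis
  proof cases
    case 1
    have "(\<integral>x. f' (Complex x y) \<partial>lborel) = 0" for y
    proof (rule integral_deriv_zero[where M = M])
      show "((\<lambda>x. f (Complex x y)) has_real_derivative f' (Complex x y)) (at x)" for x
        using dir_deriv_onD[OF f(1), of "Complex x y"] DERIV_at_within_shift[of "\<lambda>x. f (Complex x y)" "f' (Complex x y)" x 0 UNIV]
        by (simp add: 1 complex_of_real_def complex_add add.commute)
      show "continuous_on UNIV (\<lambda>x. f' (Complex x y))"
        by (rule continuous_on_compose2[OF f(2)]) (auto simp: Complex_eq intro!: continuous_intros)
    qed (use out K z' M in auto)
    then show ?thesis by (simp add: integral_complex_fst[OF int])
  next
    case 2
    have "(\<integral>y. f' (Complex x y) \<partial>lborel) = 0" for x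
    proof (rule integral_deriv_zero[where M = M])
      show "((\<lambda>y. f (Complex x y)) has_real_derivative f' (Complex x y)) (at y)" for y
        using dir_deriv_onD[OF f(1), of "Complex x y"] DERIV_at_within_shift[of "\<lambda>y. f (Complex x y)" "f' (Complex x y)" y 0 UNIV]
        by (simp add: 2 Complex_add_of_real_i add.commute)
      show "continuous_on UNIV (\<lambda>y. f' (Complex x y))"
        by (rule continuous_on_compose2[OF f(2)]) (auto simp: Complex_eq intro!: continuous_intros)
    qed (use out K z' M in auto)
    then show ?thesis by (simp add: integral_complex_snd[OF int])
  qed
qed

text \<open>The open sets \<open>U\<close> and \<open>- K\<close> cover the plane, and on the second
  one the product is 0 whatever \<open>f\<close> does there.\<close>

lemma continuous_on_mult_support:
  fixes f g :: "complex \<Rightarrow> real"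
  assumes "open U" "closed K" "K \<subseteq> U" "continuous_on U f" "continuous_on UNIV g"
    and "\<And>z. z \<notin> K \<Longrightarrow> g z = 0"
  shows "continuous_on UNIV (\<lambda>z. f z * g z)"
proof -
  have "continuous_on (U \<union> - K) (\<lambda>z. f z * g z)"
  proof (rule continuous_on_open_Un)
    show "continuous_on U (\<lambda>z. f z * g z)"
      using assms by (auto intro!: continuous_intros continuous_on_subset[OF assms(5)])
    show "continuous_on (- K) (\<lambda>z. f z * g z)"
      by (rule continuous_on_cong[THEN iffD1, OF refl _ continuous_on_const[of _ 0]]) (use assms(6) in auto)
  qed (use assms in auto)
  moreover have "U \<union> - K = UNIV" using assms by auto
  ultimately show ?thesis by (simp only:)
qed

text \<open>The second argument assigns to \<open>1\<close> and \<open>\<i>\<close> the two first partial derivatives, the third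
  one the two pure second partial derivatives; no mixed derivatives are needed for the
  Laplacian.\<close>

definition C2_on :: "complex set \<Rightarrow> (complex \<Rightarrow> real) \<Rightarrow> (complex \<Rightarrow> complex \<Rightarrow> real) \<Rightarrow>
    (complex \<Rightarrow> complex \<Rightarrow> real) \<Rightarrow> bool" where
  "C2_on U f D DD \<longleftrightarrow> continuous_on U f \<and>
     (\<forall>d\<in>{1, \<i>}. dir_deriv_on d U f (D d) \<and> dir_deriv_on d U (D d) (DD d) \<and>
        continuous_on U (D d) \<and> continuous_on U (DD d))"

lemma C2_on_continuous:
  assumes "C2_on U f D DD"
  shows "continuous_on U f" "d \<in> {1, \<i>} \<Longrightarrow> continuous_on U (D d)" "d \<in> {1, \<i>} \<Longrightarrow> continuous_on U (DD d)"
  using assms by (auto simp: C2_on_def)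

lemma C2_on_deriv:
  assumes "C2_on U f D DD" "d \<in> {1, \<i>}"
  shows "dir_deriv_on d U f (D d)" "dir_deriv_on d U (D d) (DD d)"
  using assms by (auto simp: C2_on_def)

lemma C2_on_zero_outside:
  assumes "C2_on UNIV f D DD" "closed K" "\<And>z. z \<notin> K \<Longrightarrow> f z = 0" "d \<in> {1, \<i>}" "z \<notin> K"
  shows "D d z = 0" "DD d z = 0"
proof -
  have D: "D d z = 0" if "z \<notin> K" for z
    using C2_on_deriv(1)[OF assms(1,4)] assms(2,3) that by (rule dir_deriv_zero_outside)
  then show "D d z = 0" using assms(5) .
  show "DD d z = 0"
    using C2_on_deriv(2)[OF assms(1,4)] assms(2) D assms(5) by (rule dir_deriv_zero_outside)
qed

text \<open>Differentiating \<open>h * D d - H d * f\<close> along \<open>d\<close> cancels the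
  products of first derivatives and leaves the difference of the two integrands. As \<open>h\<close>
  is controlled only on \<open>U\<close>, points off \<open>U\<close> are handled by the vanishing
  of \<open>f\<close> near them.\<close>

lemma integral_by_parts_dir:
  assumes d: "d \<in> {1, \<i>}" and U: "open U" and K: "compact K" "K \<subseteq> U"
    and f: "C2_on UNIV f D DD" "\<And>z. z \<notin> K \<Longrightarrow> f z = 0"
    and h: "C2_on U h H HH"
  shows "integrable lborel (\<lambda>z. h z * DD d z)" "integrable lborel (\<lambda>z. HH d z * f z)"
    "(\<integral>z. h z * DD d z \<partial>lborel) = (\<integral>z. HH d z * f z \<partial>lborel)"
proof -
  note clK = compact_imp_closed[OF K(1)]
  note out = C2_on_zero_outside[OF f(1) clK f(2) d]
  note cont_h = C2_on_continuous[OF h] and cont_f = C2_on_continuous[OF f(1)]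
  have cont1: "continuous_on UNIV (\<lambda>z. h z * DD d z)"
    by (rule continuous_on_mult_support[OF U clK K(2) cont_h(1) cont_f(3)[OF d] out(2)])
  have "continuous_on UNIV (\<lambda>z. HH d z * f z)"
    by (rule continuous_on_mult_support[OF U clK K(2) cont_h(3)[OF d] cont_f(1) f(2)])
  note cont = cont1 this
  show int: "integrable lborel (\<lambda>z. h z * DD d z)" "integrable lborel (\<lambda>z. HH d z * f z)"
    using integrable_compact_support[OF cont(1) K(1)] integrable_compact_support[OF cont(2) K(1)]
    by (auto simp: out(2) f(2))
  have "dir_deriv_on d UNIV (\<lambda>z. h z * D d z - H d z * f z) (\<lambda>z. h z * DD d z - HH d z * f z)"
    unfolding dir_deriv_on_def
  proof (intro ballI)
    fix z
    show "((\<lambda>t. h (z + of_real t * d) * D d (z + of_real t * d) - H d (z + of_real t * d) * f (z + of_real t * d))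
      has_real_derivative h z * DD d z - HH d z * f z) (at 0)"
    proof (cases "z \<in> U")
      case True
      note D = C2_on_deriv[OF f(1) d, THEN dir_deriv_onD, OF UNIV_I, of z]
        C2_on_deriv[OF h d, THEN dir_deriv_onD, OF True]
      show ?thesis
        by (rule derivative_eq_intros D refl)+ simp
    next
      case False
      then have z: "z \<in> - K" using K by auto
      have "\<forall>\<^sub>F t in nhds (0::real). z + of_real t * d \<in> - K"
        by (rule eventually_line_in_open) (use clK z in auto)
      then have "\<forall>\<^sub>F t in nhds (0::real).
          h (z + of_real t * d) * D d (z + of_real t * d) - H d (z + of_real t * d) * f (z + of_real t * d) = 0"
        by eventually_elim (use out f(2) in auto)
      then have "((\<lambda>t. h (z + of_real t * d) * D d (z + of_real t * d) - H d (z + of_real t * d) * f (z + of_real t * d))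
          has_real_derivative 0) (at 0) \<longleftrightarrow> ((\<lambda>t::real. 0::real) has_real_derivative 0) (at 0)"
        by (intro DERIV_cong_ev) auto
      then show ?thesis using z out f(2) by simp
    qed
  qed
  then have "(\<integral>z. h z * DD d z - HH d z * f z \<partial>lborel) = 0"
    by (rule integral_dir_deriv_zero[OF d _ _ K(1)]) (use cont out f(2) in \<open>auto intro: continuous_on_diff\<close>)
  then show "(\<integral>z. h z * DD d z \<partial>lborel) = (\<integral>z. HH d z * f z \<partial>lborel)"
    using int by simp
qed

lemma integral_laplacian_by_parts:
  assumes U: "open U" and K: "compact K" "K \<subseteq> U"
    and f: "C2_on UNIV f D DD" "\<And>z. z \<notin> K \<Longrightarrow> f z = 0"
    and h: "C2_on U h H HH"
  shows "integrable lborel (\<lambda>z. h z * (DD 1 z + DD \<i> z))"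
    "(\<integral>z. h z * (DD 1 z + DD \<i> z) \<partial>lborel) = (\<integral>z. (HH 1 z + HH \<i> z) * f z \<partial>lborel)"
proof -
  note * = integral_by_parts_dir[OF _ U K f h]
  show "integrable lborel (\<lambda>z. h z * (DD 1 z + DD \<i> z))"
    using *(1)[of 1] *(1)[of \<i>] by (simp add: distrib_left)
  show "(\<integral>z. h z * (DD 1 z + DD \<i> z) \<partial>lborel) = (\<integral>z. (HH 1 z + HH \<i> z) * f z \<partial>lborel)"
    using *(1,2,3)[of 1] *(1,2,3)[of \<i>] by (simp add: distrib_left distrib_right)
qed


subsection \<open>The fundamental solution\<close>

lemma
  fixes f F :: "real \<Rightarrow> real"
  assumes F: "\<And>x. (F has_real_derivative f x) (at x)" and f: "\<And>x. isCont f x" "\<And>x. 0 \<le> f x"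
    and A: "(F \<longlongrightarrow> A) at_bot" and B: "(F \<longlongrightarrow> B) at_top"
  shows integrable_FTC_UNIV: "integrable lborel f"
    and integral_FTC_UNIV: "(\<integral>x. f x \<partial>lborel) = B - A"
proof -
  have A': "((F \<circ> real_of_ereal) \<longlongrightarrow> A) (at_right (-\<infinity>))"
    using A by (simp add: at_right_MInf filterlim_filtermap o_def)
  have B': "((F \<circ> real_of_ereal) \<longlongrightarrow> B) (at_left \<infinity>)"
    using B by (simp add: at_left_PInf filterlim_filtermap o_def)
  have U: "einterval (-\<infinity>) \<infinity> = UNIV" by (auto simp: einterval_def)
  note * = interval_integral_FTC_nonneg[of "-\<infinity>" \<infinity> F f, OF _ F f(1) _ A' B']
  show "integrable lborel f"
    using *(1) f(2) by (simp add: U set_integrable_def)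
  show "(\<integral>x. f x \<partial>lborel) = B - A"
    using *(2) f(2) by (simp add: U interval_lebesgue_integral_def set_lebesgue_integral_def)
qed

text \<open>The inner integral for the mass of the mollified Laplacian, where \<open>A\<close> will
  be \<open>sqrt (1 + y\<^sup>2)\<close>. Its antiderivative comes from integrating
  \<open>1 / (A\<^sup>2 + x\<^sup>2)\<close> by parts.\<close>

lemma
  assumes A: "A > (0::real)"
  shows integrable_inverse_square_sum: "integrable lborel (\<lambda>x. 2 / (A\<^sup>2 + x\<^sup>2)\<^sup>2)"
    and integral_inverse_square_sum: "(\<integral>x. 2 / (A\<^sup>2 + x\<^sup>2)\<^sup>2 \<partial>lborel) = pi / A ^ 3"
proof -
  define F where "F x = x / (A\<^sup>2 * (A\<^sup>2 + x\<^sup>2)) + arctan (x / A) / A ^ 3" for x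
  have nz: "A\<^sup>2 + x\<^sup>2 \<noteq> 0" for x using A by (simp add: sum_power2_eq_zero_iff)
  have F: "(F has_real_derivative 2 / (A\<^sup>2 + x\<^sup>2)\<^sup>2) (at x)" for x
  proof -
    define Q where "Q = A\<^sup>2 + x\<^sup>2"
    have Q: "Q > 0" using A by (simp add: Q_def add_pos_nonneg)
    have "((\<lambda>x. x / (A\<^sup>2 * (A\<^sup>2 + x\<^sup>2))) has_real_derivative
        (1 * (A\<^sup>2 * Q) - x * (A\<^sup>2 * (2 * x))) / ((A\<^sup>2 * Q) * (A\<^sup>2 * Q))) (at x)"
      unfolding Q_def using A nz[of x]
      by (intro DERIV_divide) (auto intro!: derivative_eq_intros)
    moreover have "((\<lambda>x. arctan (x / A) / A ^ 3) has_real_derivative inverse (1 + (x / A)\<^sup>2) * (1 / A) / A ^ 3) (at x)"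
      using A by (intro DERIV_cdivide) (auto intro!: derivative_eq_intros)
    ultimately have "(F has_real_derivative (1 * (A\<^sup>2 * Q) - x * (A\<^sup>2 * (2 * x))) / ((A\<^sup>2 * Q) * (A\<^sup>2 * Q))
        + inverse (1 + (x / A)\<^sup>2) * (1 / A) / A ^ 3) (at x)"
      unfolding F_def[abs_def] by (rule DERIV_add)
    moreover have "(1 * (A\<^sup>2 * Q) - x * (A\<^sup>2 * (2 * x))) / ((A\<^sup>2 * Q) * (A\<^sup>2 * Q))
        + inverse (1 + (x / A)\<^sup>2) * (1 / A) / A ^ 3 = 2 / Q\<^sup>2"
    proof -
      have 1: "inverse (1 + (x / A)\<^sup>2) * (1 / A) / A ^ 3 = 1 / (A\<^sup>2 * Q)"
      proof -
        have "1 + (x / A)\<^sup>2 = Q / A\<^sup>2"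
          using A by (simp add: Q_def field_simps)
        then show ?thesis using A Q by (simp add: field_simps power2_eq_square power3_eq_cube)
      qed
      have 2: "(1 * (A\<^sup>2 * Q) - x * (A\<^sup>2 * (2 * x))) / ((A\<^sup>2 * Q) * (A\<^sup>2 * Q)) = (Q - 2 * x\<^sup>2) / (A\<^sup>2 * Q\<^sup>2)"
        using A Q by (simp add: divide_simps) (simp add: power2_eq_square algebra_simps)
      have "(Q - 2 * x\<^sup>2) / (A\<^sup>2 * Q\<^sup>2) + 1 / (A\<^sup>2 * Q) = (2 * Q - 2 * x\<^sup>2) / (A\<^sup>2 * Q\<^sup>2)"
        using A Q by (simp add: divide_simps) (simp add: power2_eq_square algebra_simps)
      also have "\<dots> = 2 / Q\<^sup>2"
        using A Q by (simp add: Q_def)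
      finally show ?thesis unfolding 1 2 .
    qed
    ultimately show ?thesis by (simp add: Q_def)
  qed
  have cont: "isCont (\<lambda>x. 2 / (A\<^sup>2 + x\<^sup>2)\<^sup>2) x" for x
    using nz by (intro continuous_intros) auto
  have nonneg: "0 \<le> 2 / (A\<^sup>2 + x\<^sup>2)\<^sup>2" for x by simp
  have lim: "(F \<longlongrightarrow> - (pi * inverse (A ^ 3) / 2)) at_bot" "(F \<longlongrightarrow> pi * inverse (A ^ 3) / 2) at_top"
    unfolding F_def[abs_def] using A by real_asymp+
  show "integrable lborel (\<lambda>x. 2 / (A\<^sup>2 + x\<^sup>2)\<^sup>2)"
    by (rule integrable_FTC_UNIV[OF F cont nonneg lim])
  show "(\<integral>x. 2 / (A\<^sup>2 + x\<^sup>2)\<^sup>2 \<partial>lborel) = pi / A ^ 3"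
  proof -
    have "(\<integral>x. 2 / (A\<^sup>2 + x\<^sup>2)\<^sup>2 \<partial>lborel) = pi * inverse (A ^ 3) / 2 - - (pi * inverse (A ^ 3) / 2)"
      by (rule integral_FTC_UNIV[OF F cont nonneg lim])
    also have "\<dots> = pi / A ^ 3"
      by (simp add: inverse_eq_divide)
    finally show ?thesis .
  qed
qed

text \<open>The outer integral for the same mass; its antiderivative
  \<open>pi * (y / sqrt (1 + y\<^sup>2))\<close> runs from \<open>- pi\<close> to
  \<open>pi\<close>.\<close>

lemma
  shows integrable_inverse_sqrt_cube: "integrable lborel (\<lambda>y. pi / sqrt (1 + y\<^sup>2) ^ 3)"
    and integral_inverse_sqrt_cube: "(\<integral>y. pi / sqrt (1 + y\<^sup>2) ^ 3 \<partial>lborel) = 2 * pi"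
proof -
  define F where "F y = pi * (y / sqrt (1 + y\<^sup>2))" for y :: real
  have pos: "1 + y\<^sup>2 > 0" for y :: real by (simp add: add_pos_nonneg)
  have F: "(F has_real_derivative pi / sqrt (1 + y\<^sup>2) ^ 3) (at y)" for y
  proof -
    define s where "s = sqrt (1 + y\<^sup>2)"
    have s: "s > 0" "s\<^sup>2 = 1 + y\<^sup>2" using pos[of y] by (auto simp: s_def)
    have "(F has_real_derivative pi * ((s - y * (inverse s / 2 * (2 * y))) / s\<^sup>2)) (at y)"
      unfolding F_def[abs_def] s_def using pos[of y]
      by (intro DERIV_cmult) (auto intro!: derivative_eq_intros simp: power2_eq_square)
    also have "(s - y * (inverse s / 2 * (2 * y))) / s\<^sup>2 = (s\<^sup>2 - y\<^sup>2) / s ^ 3"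
      using s(1) by (simp add: field_simps power2_eq_square power3_eq_cube)
    finally show ?thesis using s(2) by (simp add: s_def)
  qed
  have cont: "isCont (\<lambda>y. pi / sqrt (1 + y\<^sup>2) ^ 3) y" for y
    using pos[of y] by (intro continuous_intros) auto
  have lim: "(F \<longlongrightarrow> - pi) at_bot" "(F \<longlongrightarrow> pi) at_top"
    unfolding F_def[abs_def] by real_asymp+
  have nonneg: "0 \<le> pi / sqrt (1 + y\<^sup>2) ^ 3" for y :: real by simp
  show "integrable lborel (\<lambda>y. pi / sqrt (1 + y\<^sup>2) ^ 3)"
    by (rule integrable_FTC_UNIV[OF F cont nonneg lim])
  show "(\<integral>y. pi / sqrt (1 + y\<^sup>2) ^ 3 \<partial>lborel) = 2 * pi"
    by (subst integral_FTC_UNIV[OF F cont nonneg lim]) simp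
qed

text \<open>The integrand is the Laplacian of \<open>ln (1 + (cmod z)\<^sup>2) / 2\<close>. The
  double integral is evaluated first in \<open>x\<close>, with \<open>1 + y\<^sup>2\<close> as a
  constant, and then in \<open>y\<close>.\<close>

lemma
  shows integrable_log_mollifier: "integrable lborel (\<lambda>z::complex. 2 / (1 + (cmod z)\<^sup>2)\<^sup>2)"
    and integral_log_mollifier: "(\<integral>z. 2 / (1 + (cmod z)\<^sup>2)\<^sup>2 \<partial>lborel) = 2 * pi"
proof -
  let ?f = "\<lambda>z::complex. 2 / (1 + (cmod z)\<^sup>2)\<^sup>2"
  have inner: "(\<integral>\<^sup>+x. ennreal (?f (Complex x y)) \<partial>lborel) = ennreal (pi / sqrt (1 + y\<^sup>2) ^ 3)" for y
  proof -
    have pos: "sqrt (1 + y\<^sup>2) > 0" by (simp add: add_pos_nonneg)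
    have eq: "?f (Complex x y) = 2 / ((sqrt (1 + y\<^sup>2))\<^sup>2 + x\<^sup>2)\<^sup>2" for x
      by (simp add: cmod_power2 add_ac)
    show ?thesis
      unfolding eq integral_inverse_square_sum[OF pos, symmetric]
      by (rule nn_integral_eq_integral[OF integrable_inverse_square_sum[OF pos]]) auto
  qed
  have "(\<integral>\<^sup>+z. ennreal (?f z) \<partial>lborel) = (\<integral>\<^sup>+y. ennreal (pi / sqrt (1 + y\<^sup>2) ^ 3) \<partial>lborel)"
    by (subst nn_integral_complex) (simp_all only: inner, measurable)
  also have "\<dots> = ennreal (2 * pi)"
    by (subst nn_integral_eq_integral) (auto simp: integrable_inverse_sqrt_cube integral_inverse_sqrt_cube)
  finally have nn: "(\<integral>\<^sup>+z. ennreal (?f z) \<partial>lborel) = ennreal (2 * pi)" .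
  then show int: "integrable lborel ?f"
    by (intro integrableI_nn_integral_finite[of _ _ "2 * pi"]) auto
  show "(\<integral>z. ?f z \<partial>lborel) = 2 * pi"
    by (rule integral_eq_nn_integral[THEN trans]) (auto simp: nn)
qed

section \<open>Changes of variable and local integrability of the logarithm\<close>

lemma
  fixes f :: "'a::euclidean_space \<Rightarrow> real"
  shows integrable_translate: "integrable lborel f \<Longrightarrow> integrable lborel (\<lambda>z. f (z + c))"
    and integral_translate: "integrable lborel f \<Longrightarrow> (\<integral>z. f (z + c) \<partial>lborel) = (\<integral>z. f z \<partial>lborel)"
proof -
  assume f: "integrable lborel f"
  then have [measurable]: "f \<in> borel_measurable borel" by auto
  have "integrable (distr lborel borel ((+) c)) f"
    using f by (simp add: lborel_distr_plus)
  then show "integrable lborel (\<lambda>z. f (z + c))"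
    by (subst (asm) integrable_distr_eq) (auto simp: add.commute)
  have "(\<integral>z. f z \<partial>lborel) = (\<integral>z. f z \<partial>(distr lborel borel ((+) c)))"
    by (simp add: lborel_distr_plus)
  also have "\<dots> = (\<integral>z. f (z + c) \<partial>lborel)"
    by (subst integral_distr) (auto simp: add.commute)
  finally show "(\<integral>z. f (z + c) \<partial>lborel) = (\<integral>z. f z \<partial>lborel)" ..
qed

lemma integral_complex_affine:
  fixes f :: "complex \<Rightarrow> real"
  assumes [measurable]: "f \<in> borel_measurable borel" and c: "c > (0::real)"
  shows "(\<integral>z. f z \<partial>lborel) = (\<integral>w. c\<^sup>2 * f (p + of_real c * w) \<partial>lborel)"
proof -
  have "(\<integral>z. f z \<partial>lborel) = (\<integral>z. f z \<partial>density (distr lborel borel (\<lambda>x. p + c *\<^sub>R x)) (\<lambda>_. \<bar>c\<bar> ^ DIM(complex)))"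
    using lborel_affine[of c p] c by simp
  also have "\<dots> = (\<integral>z. c\<^sup>2 * f z \<partial>distr lborel borel (\<lambda>x. p + c *\<^sub>R x))"
    using c by (subst integral_real_density[symmetric]) (auto simp: ennreal_power)
  also have "\<dots> = (\<integral>w. c\<^sup>2 * f (p + of_real c * w) \<partial>lborel)"
    by (subst integral_distr) (auto simp: scaleR_conv_of_real)
  finally show ?thesis .
qed

text \<open>The bound \<open>ln s \<le> s - 1\<close> is used for \<open>s = r\<close> and for
  \<open>s = r powr (-1/2)\<close>. The exponent -1/2 is chosen because it is integrable at 0
  already in one variable.\<close>

lemma abs_ln_le:
  assumes "r > (0::real)"
  shows "\<bar>ln r\<bar> \<le> r + 2 * r powr (-1/2)"
proof -
  have "ln r \<le> r - 1" using assms by (rule ln_le_minus_one)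
  moreover have "- ln r = 2 * ln (r powr (-1/2))"
    using assms by (simp add: ln_powr)
  moreover have "ln (r powr (-1/2)) \<le> r powr (-1/2) - 1"
    using assms by (intro ln_le_minus_one) auto
  ultimately show ?thesis
    using assms powr_ge_zero[of r "-1/2"] by linarith
qed

lemma integrable_powr_half: "integrable lborel (\<lambda>x::real. indicator {0..M} x * x powr (-1/2))"
proof (cases "M \<ge> 0")
  case True
  have "(\<lambda>x. x powr (-1/2)) integrable_on {0..M}"
    using has_integral_powr_from_0[of "-1/2" M] True by (auto simp: integrable_on_def)
  then have "(\<lambda>x. x powr (-1/2)) absolutely_integrable_on {0..M}"
    by (intro nonnegative_absolutely_integrable_1) auto
  then have "integrable lebesgue (\<lambda>x. indicator {0..M} x * x powr (-1/2))"
    by (simp add: set_integrable_def)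
  then show ?thesis by (subst (asm) integrable_completion) auto
qed simp

text \<open>Since \<open>\<bar>x\<bar> \<le> cmod z\<close>, the singular part of the bound from
  \<open>abs_ln_le\<close> may be replaced by a function of \<open>x\<close> alone. The dominating
  function is then a product of functions of one variable.\<close>

lemma integrable_ln_norm_box:
  "integrable lborel (\<lambda>z::complex. indicator {z. \<bar>Re z\<bar> \<le> M \<and> \<bar>Im z\<bar> \<le> M} z * ln (cmod z))"
proof -
  define S where "S = {z. \<bar>Re z\<bar> \<le> M \<and> \<bar>Im z\<bar> \<le> M}"
  define q where "q x = indicator {0..M} x * x powr (-1/2)" for x :: real
  define g where "g x = indicator {-M..M} x * (2 * M) + 2 * (q x + q (- x))" for x
  have [measurable]: "S \<in> sets borel" unfolding S_def by measurable
  have q: "integrable lborel q" unfolding q_def[abs_def] by (rule integrable_powr_half)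
  have qm: "integrable lborel (\<lambda>x. q (- x))"
    using lborel_integrable_real_affine[OF q, of "-1" 0] by simp
  have "integrable lborel (\<lambda>x::real. indicator {-M..M} x * (2 * M))"
    by (intro integrable_mult_left integrable_real_indicator) (auto simp: emeasure_lborel_Icc_eq)
  then have g: "integrable lborel g"
    unfolding g_def[abs_def] using q qm by (intro Bochner_Integration.integrable_add integrable_mult_right)
  have [measurable]: "g \<in> borel_measurable borel" using g by auto
  \<comment> \<open>The line \<open>x = 0\<close> must be left out, because
    \<open>0 powr (-1/2)\<close> is 0 and so bounds nothing there. It is a null set in the inner
    integral.\<close>
  have bound: "norm (indicator S (Complex x y) * ln (cmod (Complex x y))) \<le> indicator {-M..M} y * g x"
    if "x \<noteq> 0" for x y
  proof (cases "Complex x y \<in> S")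
    case True
    then have xy: "\<bar>x\<bar> \<le> M" "\<bar>y\<bar> \<le> M" by (auto simp: S_def)
    define r where "r = cmod (Complex x y)"
    have "Complex x y \<noteq> 0" using that by (simp add: complex_eq_iff)
    then have r: "r > 0" "\<bar>x\<bar> \<le> r" "r \<le> 2 * M"
      using abs_Re_le_cmod[of "Complex x y"] cmod_le[of "Complex x y"] xy by (auto simp: r_def)
    have "\<bar>ln r\<bar> \<le> r + 2 * r powr (-1/2)" using r by (intro abs_ln_le) auto
    also have "\<dots> \<le> 2 * M + 2 * \<bar>x\<bar> powr (-1/2)"
      using r that by (intro add_mono mult_left_mono powr_mono2') auto
    also have "\<bar>x\<bar> powr (-1/2) \<le> q x + q (- x)"
      using xy by (auto simp: q_def abs_if)
    finally have "\<bar>ln r\<bar> \<le> 2 * M + 2 * (q x + q (- x))" by simp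
    moreover have "x \<in> {-M..M}" "y \<in> {-M..M}" using xy by auto
    ultimately show ?thesis using True by (simp add: g_def r_def)
  next
    case False
    have "0 \<le> q x" for x by (simp add: q_def)
    then show ?thesis using False by (auto simp: g_def indicator_def add_nonneg_nonneg)
  qed
  have "(\<integral>\<^sup>+z. ennreal (norm (indicator S z * ln (cmod z))) \<partial>lborel)
      = (\<integral>\<^sup>+y. \<integral>\<^sup>+x. ennreal (norm (indicator S (Complex x y) * ln (cmod (Complex x y)))) \<partial>lborel \<partial>lborel)"
  proof (rule nn_integral_complex)
    have [measurable]: "(\<lambda>z::complex. ln (cmod z)) \<in> borel_measurable borel"
      by measurable
    show "(\<lambda>z. ennreal (norm (indicator S z * ln (cmod z)))) \<in> borel_measurable borel"
      by measurable
  qed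
  also have "\<dots> \<le> (\<integral>\<^sup>+y. \<integral>\<^sup>+x. ennreal (indicator {-M..M} y * g x) \<partial>lborel \<partial>lborel)"
  proof (rule nn_integral_mono, rule nn_integral_mono_AE)
    fix y :: real
    have "AE x in lborel. x \<noteq> (0::real)" by (rule AE_lborel_singleton)
    then show "AE x in lborel. ennreal (norm (indicator S (Complex x y) * ln (cmod (Complex x y))))
        \<le> ennreal (indicator {-M..M} y * g x)"
    proof eventually_elim
      case (elim x)
      then show ?case by (intro ennreal_leI bound)
    qed
  qed
  also have "\<dots> = (\<integral>\<^sup>+y. indicator {-M..M} y * (\<integral>\<^sup>+x. ennreal (g x) \<partial>lborel) \<partial>lborel)"
    by (intro nn_integral_cong) (auto simp: indicator_def)
  also have "\<dots> = emeasure lborel {-M..M} * (\<integral>\<^sup>+x. ennreal (g x) \<partial>lborel)"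
    by (subst nn_integral_multc) auto
  also have "\<dots> < \<infinity>"
  proof -
    have "(\<integral>\<^sup>+x. ennreal (g x) \<partial>lborel) < \<infinity>"
    proof (rule le_less_trans)
      show "(\<integral>\<^sup>+x. ennreal (g x) \<partial>lborel) \<le> (\<integral>\<^sup>+x. ennreal (norm (g x)) \<partial>lborel)"
        by (intro nn_integral_mono ennreal_leI) simp
      show "(\<integral>\<^sup>+x. ennreal (norm (g x)) \<partial>lborel) < \<infinity>"
        using g by (simp add: integrable_iff_bounded)
    qed
    then show ?thesis by (auto simp: emeasure_lborel_Icc_eq ennreal_mult_less_top)
  qed
  finally show ?thesis
    unfolding S_def[symmetric] by (intro integrableI_bounded) auto
qed

lemma set_integrable_ln_norm:
  assumes "compact K"
  shows "set_integrable lborel K (\<lambda>z. ln (cmod (z - p)))"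
proof -
  obtain M where M: "\<And>z. z \<in> K \<Longrightarrow> norm z \<le> M"
    using compact_imp_bounded[OF assms] bounded_pos by metis
  define S where "S = {z. \<bar>Re z\<bar> \<le> M + norm p \<and> \<bar>Im z\<bar> \<le> M + norm p}"
  have "integrable lborel (\<lambda>z. indicator S (z + - p) * ln (cmod (z + - p)))"
    unfolding S_def by (rule integrable_translate[OF integrable_ln_norm_box])
  then have "integrable lborel (\<lambda>z. indicator K z * (indicator S (z - p) * ln (cmod (z - p))))"
    using integrable_real_mult_indicator[of K lborel "\<lambda>z. indicator S (z - p) * ln (cmod (z - p))"]
      compact_imp_closed[OF assms] by (simp add: mult.commute borel_closed)
  also have "(\<lambda>z. indicator K z * (indicator S (z - p) * ln (cmod (z - p)))) = (\<lambda>z. indicator K z *\<^sub>R ln (cmod (z - p)))"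
  proof
    fix z show "indicator K z * (indicator S (z - p) * ln (cmod (z - p))) = indicator K z *\<^sub>R ln (cmod (z - p))"
    proof (cases "z \<in> K")
      case True
      then have "norm (z - p) \<le> M + norm p"
        using M[of z] norm_triangle_ineq4[of z p] by linarith
      then have "z - p \<in> S"
        using abs_Re_le_cmod[of "z - p"] abs_Im_le_cmod[of "z - p"] by (auto simp: S_def)
      then show ?thesis by simp
    qed simp
  qed
  finally show ?thesis by (simp add: set_integrable_def)
qed

lemma integrable_ln_norm_mult:
  assumes "continuous_on UNIV g" "compact K" "\<And>z. z \<notin> K \<Longrightarrow> g z = (0::real)"
  shows "integrable lborel (\<lambda>z. ln (cmod (z - p)) * g z)"
proof -
  have [measurable]: "g \<in> borel_measurable borel"
    using assms by (simp add: borel_measurable_continuous_onI)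
  have "bounded (g ` K)"
    using assms by (intro compact_imp_bounded compact_continuous_image) (auto intro: continuous_on_subset)
  then obtain C where C: "\<And>z. z \<in> K \<Longrightarrow> \<bar>g z\<bar> \<le> C"
    by (auto simp: bounded_iff)
  have "integrable lborel (\<lambda>z. C * (indicator K z *\<^sub>R ln (cmod (z - p))))"
    using set_integrable_ln_norm[OF assms(2)] by (simp add: set_integrable_def)
  then show ?thesis
  proof (rule Bochner_Integration.integrable_bound)
    show "AE z in lborel. norm (ln (cmod (z - p)) * g z) \<le> norm (C * (indicator K z *\<^sub>R ln (cmod (z - p))))"
    proof (rule AE_I2)
      fix z
      show "norm (ln (cmod (z - p)) * g z) \<le> norm (C * (indicator K z *\<^sub>R ln (cmod (z - p))))"
      proof (cases "z \<in> K")
        case True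
        then have "\<bar>g z\<bar> \<le> \<bar>C\<bar>" using C[of z] by linarith
        then show ?thesis using True by (simp add: abs_mult mult.commute mult_right_mono)
      qed (simp add: assms)
    qed
  qed measurable
qed

section \<open>The mollified logarithm\<close>

definition moll_N :: "real \<Rightarrow> complex \<Rightarrow> complex \<Rightarrow> real" where
  "moll_N e p z = (cmod (z - p))\<^sup>2 + e\<^sup>2"

text \<open>\<open>Re ((z - p) * cnj d)\<close> is the component of \<open>z - p\<close> along
  \<open>d\<close>. The squares of the two components add up to
  \<open>(cmod (z - p))\<^sup>2\<close>, so the numerators of the second derivatives add up to
  \<open>2 * e\<^sup>2\<close>.\<close>

lemma C2_on_log_mollified:
  assumes e: "e > 0"
  shows "C2_on UNIV (\<lambda>z. ln (moll_N e p z) / 2) (\<lambda>d z. Re ((z - p) * cnj d) / moll_N e p z)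
    (\<lambda>d z. (moll_N e p z - 2 * (Re ((z - p) * cnj d))\<^sup>2) / (moll_N e p z)\<^sup>2)"
proof -
  have pos: "moll_N e p z > 0" for z
    using e by (simp add: moll_N_def add_nonneg_pos)
  have contN: "continuous_on UNIV (moll_N e p)"
    unfolding moll_N_def[abs_def] by (intro continuous_intros)
  have N: "((\<lambda>t::real. moll_N e p (z + of_real t * d)) has_real_derivative 2 * Re ((z - p) * cnj d)) (at 0)" for z d
    unfolding moll_N_def cmod_power2 by (auto intro!: derivative_eq_intros)
  have R: "((\<lambda>t::real. Re ((z + of_real t * d - p) * cnj d)) has_real_derivative 1) (at 0)"
    if "d \<in> {1, \<i>}" for z d
    using that by (auto intro!: derivative_eq_intros)
  have d1: "dir_deriv_on d UNIV (\<lambda>z. ln (moll_N e p z) / 2) (\<lambda>z. Re ((z - p) * cnj d) / moll_N e p z)" for d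
    unfolding dir_deriv_on_def
  proof (intro ballI)
    fix z
    have "((\<lambda>t::real. ln (moll_N e p (z + of_real t * d))) has_real_derivative
        1 / moll_N e p (z + of_real 0 * d) * (2 * Re ((z - p) * cnj d))) (at 0)"
      by (rule DERIV_chain2[OF DERIV_ln_divide N]) (rule pos)
    from DERIV_cdivide[OF this, of 2]
    have "((\<lambda>t::real. ln (moll_N e p (z + of_real t * d)) / 2) has_real_derivative
        1 / moll_N e p (z + of_real 0 * d) * (2 * Re ((z - p) * cnj d)) / 2) (at 0)" .
    moreover have "1 / N * (2 * R) / 2 = R / N" for N R :: real
      by simp
    ultimately show "((\<lambda>t::real. ln (moll_N e p (z + of_real t * d)) / 2) has_real_derivative
        Re ((z - p) * cnj d) / moll_N e p z) (at 0)"
      by (simp only: of_real_0 mult_zero_left add_0_right)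
  qed
  have d2: "dir_deriv_on d UNIV (\<lambda>z. Re ((z - p) * cnj d) / moll_N e p z)
      (\<lambda>z. (moll_N e p z - 2 * (Re ((z - p) * cnj d))\<^sup>2) / (moll_N e p z)\<^sup>2)" if "d \<in> {1, \<i>}" for d
    unfolding dir_deriv_on_def
  proof (intro ballI)
    fix z
    show "((\<lambda>t. Re ((z + of_real t * d - p) * cnj d) / moll_N e p (z + of_real t * d)) has_real_derivative
           (moll_N e p z - 2 * (Re ((z - p) * cnj d))\<^sup>2) / (moll_N e p z)\<^sup>2) (at 0)"
      using DERIV_divide[OF R[OF that, of z] N[of z d]] pos[of z]
      by (simp add: power2_eq_square algebra_simps)
  qed
  show ?thesis
    unfolding C2_on_def
    using d1 d2 pos by (auto intro!: continuous_intros contN simp: less_imp_neq[symmetric])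
qed

text \<open>\<open>ln \<bar>z - p\<bar>\<close> is approximated by \<open>ln (\<bar>z - p\<bar>\<^sup>2 + e\<^sup>2) / 2\<close>, whose Laplacian
  \<open>2 * e\<^sup>2 / (\<bar>z - p\<bar>\<^sup>2 + e\<^sup>2)\<^sup>2\<close> is an approximate identity of total mass \<open>2 * pi\<close>.\<close>

lemma integral_ln_laplacian:
  assumes K: "compact K" and f: "C2_on UNIV f D DD" "\<And>z. z \<notin> K \<Longrightarrow> f z = 0"
  shows "(\<integral>z. ln (cmod (z - p)) * (DD 1 z + DD \<i> z) \<partial>lborel) = 2 * pi * f p"
proof -
  define lap where "lap z = DD 1 z + DD \<i> z" for z
  define e where "e n = 1 / real (Suc n)" for n
  have e: "e n > 0" "e n \<le> 1" for n by (auto simp: e_def)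
  have e0: "e \<longlonglongrightarrow> 0" unfolding e_def by (rule LIMSEQ_Suc[OF lim_1_over_n])
  note clK = compact_imp_closed[OF K]
  have lap_cont: "continuous_on UNIV lap"
    unfolding lap_def[abs_def] using C2_on_continuous(3)[OF f(1)] by (intro continuous_intros) auto
  have lap_out: "lap z = 0" if "z \<notin> K" for z
    using C2_on_zero_outside(2)[OF f(1) clK f(2) _ that] by (simp add: lap_def)
  have fcont: "continuous_on UNIV f" by (rule C2_on_continuous[OF f(1)])
  have [measurable]: "lap \<in> borel_measurable borel" "f \<in> borel_measurable borel"
    using lap_cont fcont by (simp_all add: borel_measurable_continuous_onI)
  have [measurable]: "moll_N c p \<in> borel_measurable borel" for c p
    unfolding moll_N_def[abs_def] by measurable
  have pos: "moll_N c p z > 0" if "c > 0" for c z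
    using that by (simp add: moll_N_def add_nonneg_pos)
  have lim: "(\<lambda>n. \<integral>z. ln (moll_N (e n) p z) / 2 * lap z \<partial>lborel) \<longlonglongrightarrow> (\<integral>z. ln (cmod (z - p)) * lap z \<partial>lborel)"
  proof (rule integral_dominated_convergence)
    \<comment> \<open>For a parameter between 0 and 1 the mollified logarithm lies between
      \<open>ln (cmod (z - p))\<close> and its value for parameter 1, so the absolute values of
      these two extremes dominate it.\<close>
    let ?w = "\<lambda>z. norm (ln (cmod (z - p)) * lap z) + norm (ln (moll_N 1 p z) / 2 * lap z)"
    show "integrable lborel ?w"
    proof (intro Bochner_Integration.integrable_add integrable_norm)
      show "integrable lborel (\<lambda>z. ln (cmod (z - p)) * lap z)"
        by (rule integrable_ln_norm_mult[OF lap_cont K lap_out])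
      have "continuous_on UNIV (\<lambda>z. ln (moll_N 1 p z) / 2 * lap z)"
        using C2_on_continuous(1)[OF C2_on_log_mollified[of 1 p]] lap_cont
        by (intro continuous_on_mult) auto
      then show "integrable lborel (\<lambda>z. ln (moll_N 1 p z) / 2 * lap z)"
        by (rule integrable_compact_support[OF _ K]) (simp add: lap_out)
    qed
    have ne: "AE z in lborel. z \<noteq> p" by (rule AE_lborel_singleton)
    then show "AE z in lborel. (\<lambda>n. ln (moll_N (e n) p z) / 2 * lap z) \<longlonglongrightarrow> ln (cmod (z - p)) * lap z"
    proof eventually_elim
      case (elim z)
      then have "(\<lambda>n. ln (moll_N (e n) p z) / 2 * lap z) \<longlonglongrightarrow> ln ((cmod (z - p))\<^sup>2 + 0\<^sup>2) / 2 * lap z"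
        unfolding moll_N_def by (intro tendsto_intros e0) auto
      also have "ln ((cmod (z - p))\<^sup>2 + 0\<^sup>2) / 2 = ln (cmod (z - p))"
        using elim by (simp add: ln_realpow)
      finally show ?case .
    qed
    show "AE z in lborel. norm (ln (moll_N (e n) p z) / 2 * lap z) \<le> ?w z" for n
      using ne
    proof eventually_elim
      case (elim z)
      have "e n ^ 2 \<le> 1" using e[of n] by (simp add: power_le_one)
      then have le: "(cmod (z - p))\<^sup>2 \<le> moll_N (e n) p z" "moll_N (e n) p z \<le> moll_N 1 p z"
        by (auto simp: moll_N_def)
      have "ln (cmod (z - p)) = ln ((cmod (z - p))\<^sup>2) / 2"
        using elim by (simp add: ln_realpow)
      also have "\<dots> \<le> ln (moll_N (e n) p z) / 2"
        using ln_mono[OF le(1)] elim by simp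
      finally have 1: "ln (cmod (z - p)) \<le> ln (moll_N (e n) p z) / 2" .
      have 2: "ln (moll_N (e n) p z) / 2 \<le> ln (moll_N 1 p z) / 2"
        using le pos[OF e(1)[of n], of z] by simp
      from 1 2 have "\<bar>ln (moll_N (e n) p z) / 2\<bar> \<le> \<bar>ln (cmod (z - p))\<bar> + \<bar>ln (moll_N 1 p z) / 2\<bar>"
        by linarith
      then have "\<bar>ln (moll_N (e n) p z) / 2\<bar> * \<bar>lap z\<bar> \<le> (\<bar>ln (cmod (z - p))\<bar> + \<bar>ln (moll_N 1 p z) / 2\<bar>) * \<bar>lap z\<bar>"
        by (rule mult_right_mono) simp
      then show ?case by (simp only: abs_mult real_norm_def distrib_right)
    qed
  qed measurable
  \<comment> \<open>After Green's identity, scaling about \<open>p\<close> by \<open>e n\<close>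
    turns the kernel into one independent of \<open>n\<close> and moves the parameter into the
    argument of \<open>f\<close>.\<close>
  have eq: "(\<integral>z. ln (moll_N (e n) p z) / 2 * lap z \<partial>lborel)
      = (\<integral>w. 2 / (1 + (cmod w)\<^sup>2)\<^sup>2 * f (p + of_real (e n) * w) \<partial>lborel)" for n
  proof -
    have "(\<integral>z. ln (moll_N (e n) p z) / 2 * lap z \<partial>lborel) = (\<integral>z. 2 * (e n)\<^sup>2 / (moll_N (e n) p z)\<^sup>2 * f z \<partial>lborel)"
    proof -
      have eq: "(moll_N (e n) p z - 2 * (Re ((z - p) * cnj 1))\<^sup>2) / (moll_N (e n) p z)\<^sup>2 +
          (moll_N (e n) p z - 2 * (Re ((z - p) * cnj \<i>))\<^sup>2) / (moll_N (e n) p z)\<^sup>2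
          = 2 * (e n)\<^sup>2 / (moll_N (e n) p z)\<^sup>2" for z
        by (simp add: moll_N_def cmod_power2 flip: add_divide_distrib)
      show ?thesis
        unfolding lap_def eq[symmetric]
        by (rule integral_laplacian_by_parts(2)[OF open_UNIV K subset_UNIV f C2_on_log_mollified[OF e(1)]])
    qed
    also have "\<dots> = (\<integral>w. (e n)\<^sup>2 * (2 * (e n)\<^sup>2 / (moll_N (e n) p (p + of_real (e n) * w))\<^sup>2 * f (p + of_real (e n) * w)) \<partial>lborel)"
      by (rule integral_complex_affine) (use e in auto)
    also have "\<dots> = (\<integral>w. 2 / (1 + (cmod w)\<^sup>2)\<^sup>2 * f (p + of_real (e n) * w) \<partial>lborel)"
    proof (rule Bochner_Integration.integral_cong[OF refl])
      fix w
      have "moll_N (e n) p (p + of_real (e n) * w) = (e n)\<^sup>2 * (1 + (cmod w)\<^sup>2)"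
        by (simp add: moll_N_def norm_mult power_mult_distrib algebra_simps)
      then have "(e n)\<^sup>2 * (2 * (e n)\<^sup>2 / (moll_N (e n) p (p + of_real (e n) * w))\<^sup>2) = 2 / (1 + (cmod w)\<^sup>2)\<^sup>2"
        using e(1)[of n] by (simp add: power_mult_distrib power2_eq_square)
      then show "(e n)\<^sup>2 * (2 * (e n)\<^sup>2 / (moll_N (e n) p (p + of_real (e n) * w))\<^sup>2 * f (p + of_real (e n) * w))
          = 2 / (1 + (cmod w)\<^sup>2)\<^sup>2 * f (p + of_real (e n) * w)"
        by (simp only: mult.assoc[symmetric])
    qed
    finally show ?thesis .
  qed
  have lim': "(\<lambda>n. \<integral>w. 2 / (1 + (cmod w)\<^sup>2)\<^sup>2 * f (p + of_real (e n) * w) \<partial>lborel)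
      \<longlonglongrightarrow> (\<integral>w. 2 / (1 + (cmod w)\<^sup>2)\<^sup>2 * f p \<partial>lborel)"
  proof -
    have "bounded (f ` K)"
      using K fcont by (intro compact_imp_bounded compact_continuous_image) (auto intro: continuous_on_subset)
    then obtain C0 where C0: "\<And>z. z \<in> K \<Longrightarrow> \<bar>f z\<bar> \<le> C0" by (auto simp: bounded_iff)
    have C: "\<bar>f z\<bar> \<le> \<bar>C0\<bar>" for z
      using C0[of z] f(2)[of z] by (cases "z \<in> K") auto
    show ?thesis
    proof (rule integral_dominated_convergence)
      show "integrable lborel (\<lambda>w::complex. 2 / (1 + (cmod w)\<^sup>2)\<^sup>2 * \<bar>C0\<bar>)"
        by (intro integrable_mult_left integrable_log_mollifier)
      show "AE w in lborel. (\<lambda>n. 2 / (1 + (cmod w)\<^sup>2)\<^sup>2 * f (p + of_real (e n) * w))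
          \<longlonglongrightarrow> 2 / (1 + (cmod w)\<^sup>2)\<^sup>2 * f p"
      proof (intro AE_I2 tendsto_intros)
        fix w
        have "(\<lambda>n. p + of_real (e n) * w) \<longlonglongrightarrow> p + of_real 0 * w"
          by (intro tendsto_intros e0)
        then show "(\<lambda>n. f (p + of_real (e n) * w)) \<longlonglongrightarrow> f p"
          using fcont by (intro isCont_tendsto_compose[of p f]) (auto simp: continuous_on_eq_continuous_at)
      qed
      show "AE w in lborel. norm (2 / (1 + (cmod w)\<^sup>2)\<^sup>2 * f (p + of_real (e n) * w))
          \<le> 2 / (1 + (cmod w)\<^sup>2)\<^sup>2 * \<bar>C0\<bar>" for n
      proof (rule AE_I2)
        fix w
        have "2 / (1 + (cmod w)\<^sup>2)\<^sup>2 * \<bar>f (p + of_real (e n) * w)\<bar> \<le> 2 / (1 + (cmod w)\<^sup>2)\<^sup>2 * \<bar>C0\<bar>"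
          by (intro mult_left_mono C) auto
        then show "norm (2 / (1 + (cmod w)\<^sup>2)\<^sup>2 * f (p + of_real (e n) * w)) \<le> 2 / (1 + (cmod w)\<^sup>2)\<^sup>2 * \<bar>C0\<bar>"
          by (simp add: abs_mult)
      qed
    qed measurable
  qed
  have mass: "(\<integral>w. 2 / (1 + (cmod w)\<^sup>2)\<^sup>2 * f p \<partial>lborel) = 2 * pi * f p"
    by (simp only: integral_mult_left_zero integral_log_mollifier)
  have "(\<integral>z. ln (cmod (z - p)) * lap z \<partial>lborel) = 2 * pi * f p"
    by (rule LIMSEQ_unique[OF lim[unfolded eq] lim'[unfolded mass]])
  then show ?thesis by (simp only: lap_def)
qed


subsection \<open>Cutoff functions and folding onto the torus\<close>

lemma dir_deriv_Re:
  assumes "(F has_field_derivative F') (at z)"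
  shows "((\<lambda>t::real. Re (F (z + of_real t * d))) has_real_derivative Re (F' * d)) (at 0)"
proof -
  have "((\<lambda>t::real. z + of_real t * d) has_vector_derivative d) (at 0)"
    by (auto intro!: derivative_eq_intros simp: has_vector_derivative_def scaleR_conv_of_real)
  then have "(F \<circ> (\<lambda>t::real. z + of_real t * d) has_vector_derivative d * F') (at 0)"
    by (rule field_vector_diff_chain_at) (use assms in simp)
  from bounded_linear.has_vector_derivative[OF bounded_linear_Re this]
  show ?thesis
    by (simp only: has_real_derivative_iff_has_vector_derivative o_def mult.commute)
qed

text \<open>With the second derivative written as a multiple of \<open>d * d\<close>, harmonicity is
  the equation \<open>1 * 1 + \<i> * \<i> = 0\<close>.\<close>

lemma C2_on_Re_holomorphic:
  assumes U: "open U" and W: "W holomorphic_on U"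
  shows "C2_on U (\<lambda>z. Re (W z)) (\<lambda>d z. Re (deriv W z * d)) (\<lambda>d z. Re (deriv (deriv W) z * d * d))"
proof -
  have W': "deriv W holomorphic_on U" "deriv (deriv W) holomorphic_on U"
    using holomorphic_deriv[OF W U] holomorphic_deriv[OF holomorphic_deriv[OF W U] U] by auto
  have "((\<lambda>t::real. Re (W (z + of_real t * d))) has_real_derivative Re (deriv W z * d)) (at 0)" if "z \<in> U" for d z
    by (rule dir_deriv_Re[OF holomorphic_derivI[OF W U that]])
  moreover have "((\<lambda>t::real. Re (deriv W (z + of_real t * d) * d)) has_real_derivative Re (deriv (deriv W) z * d * d)) (at 0)"
    if "z \<in> U" for d z
    by (rule dir_deriv_Re[of "\<lambda>z. deriv W z * d"])
       (rule DERIV_cmult_right[OF holomorphic_derivI[OF W'(1) U that]])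
  ultimately show ?thesis
    using holomorphic_on_imp_continuous_on[OF W] holomorphic_on_imp_continuous_on[OF W'(1)]
      holomorphic_on_imp_continuous_on[OF W'(2)]
    unfolding C2_on_def dir_deriv_on_def by (auto intro!: continuous_intros)
qed

lemma C2_on_quadratic:
  "C2_on U (\<lambda>z. A * (Re z)\<^sup>2 + B * (Im z)\<^sup>2) (\<lambda>d z. 2 * A * Re z * Re d + 2 * B * Im z * Im d)
     (\<lambda>d z. 2 * A * (Re d)\<^sup>2 + 2 * B * (Im d)\<^sup>2)"
  unfolding C2_on_def dir_deriv_on_def
  by (auto intro!: continuous_intros derivative_eq_intros simp: power2_eq_square)

lemma C2_on_add:
  assumes f: "C2_on U f D DD" and g: "C2_on U g E EE"
  shows "C2_on U (\<lambda>z. f z + g z) (\<lambda>d z. D d z + E d z) (\<lambda>d z. DD d z + EE d z)"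
  using assms unfolding C2_on_def dir_deriv_on_def
  by (intro conjI ballI continuous_on_add DERIV_add) auto

lemma C2_on_cmult:
  assumes "C2_on U f D DD"
  shows "C2_on U (\<lambda>z. c * f z) (\<lambda>d z. c * D d z) (\<lambda>d z. c * DD d z)"
  using assms unfolding C2_on_def dir_deriv_on_def
  by (intro conjI ballI continuous_on_mult_left DERIV_cmult) auto

lemma C2_on_mult:
  assumes f: "C2_on UNIV f D DD" and g: "C2_on UNIV g E EE"
  shows "C2_on UNIV (\<lambda>z. f z * g z) (\<lambda>d z. D d z * g z + f z * E d z)
    (\<lambda>d z. DD d z * g z + 2 * (D d z * E d z) + f z * EE d z)"
proof -
  note cf = C2_on_continuous[OF f] and cg = C2_on_continuous[OF g]
  note df = C2_on_deriv[OF f, THEN dir_deriv_onD, OF _ UNIV_I] and dg = C2_on_deriv[OF g, THEN dir_deriv_onD, OF _ UNIV_I]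
  have "((\<lambda>t::real. f (z + of_real t * d) * g (z + of_real t * d)) has_real_derivative
      D d z * g z + f z * E d z) (at 0)" if d: "d \<in> {1, \<i>}" for d z
    using DERIV_mult[OF df(1)[OF d, of z] dg(1)[OF d, of z]] by (simp add: algebra_simps)
  moreover have "((\<lambda>t::real. D d (z + of_real t * d) * g (z + of_real t * d) + f (z + of_real t * d) * E d (z + of_real t * d))
      has_real_derivative DD d z * g z + 2 * (D d z * E d z) + f z * EE d z) (at 0)" if d: "d \<in> {1, \<i>}" for d z
    using DERIV_add[OF DERIV_mult[OF df(2)[OF d, of z] dg(1)[OF d, of z]]
        DERIV_mult[OF df(1)[OF d, of z] dg(2)[OF d, of z]]] by (simp add: algebra_simps)
  ultimately show ?thesis
    unfolding C2_on_def dir_deriv_on_def using cf cg by (auto intro!: continuous_intros)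
qed

lemma C2_on_periodic:
  assumes f: "C2_on UNIV f D DD" and per: "\<And>z. f (z + w) = f z" and d: "d \<in> {1, \<i>}"
  shows "D d (z + w) = D d z" "DD d (z + w) = DD d z"
proof -
  note df = C2_on_deriv[OF f d, THEN dir_deriv_onD, OF UNIV_I]
  have D: "D d (z + w) = D d z" for z
  proof (rule DERIV_unique[OF _ df(1)])
    show "((\<lambda>t. f (z + complex_of_real t * d)) has_real_derivative D d (z + w)) (at 0)"
      using df(1)[of "z + w"] per[of "z + complex_of_real _ * d"] by (simp add: add_ac)
  qed
  then show "D d (z + w) = D d z" .
  show "DD d (z + w) = DD d z"
  proof (rule DERIV_unique[OF _ df(2)])
    show "((\<lambda>t. D d (z + complex_of_real t * d)) has_real_derivative DD d (z + w)) (at 0)"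
      using df(2)[of "z + w"] D[of "z + complex_of_real _ * d"] by (simp add: add_ac)
  qed
qed

lemma smooth_C2_on:
  assumes "smooth \<phi>"
  shows "C2_on UNIV \<phi> (\<lambda>d z. frechet_derivative \<phi> (at z) d)
    (\<lambda>d z. frechet_derivative (\<lambda>w. frechet_derivative \<phi> (at w) d) (at z) d)"
proof -
  have dir: "((\<lambda>t::real. f (z + of_real t * d)) has_real_derivative frechet_derivative f (at z) d) (at 0)"
    if f: "f differentiable (at z)" for f :: "complex \<Rightarrow> real" and z d
  proof -
    have "((\<lambda>t::real. z + of_real t * d) has_vector_derivative d) (at 0)"
      by (auto intro!: derivative_eq_intros simp: has_vector_derivative_def scaleR_conv_of_real)
    moreover have "(f has_derivative frechet_derivative f (at z))
        (at (z + of_real 0 * d) within range (\<lambda>t::real. z + of_real t * d))"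
      using f by (auto simp: frechet_derivative_works intro: has_derivative_at_withinI)
    ultimately have "(f \<circ> (\<lambda>t::real. z + of_real t * d) has_vector_derivative frechet_derivative f (at z) d) (at 0)"
      by (rule vector_derivative_diff_chain_within)
    then show ?thesis
      by (simp add: has_real_derivative_iff_has_vector_derivative o_def)
  qed
  have cont: "continuous_on UNIV f" if "\<And>z. f differentiable (at z)" for f :: "complex \<Rightarrow> real"
    by (intro continuous_at_imp_continuous_on ballI differentiable_imp_continuous_within that)
  have "Ck (Suc (Suc 0)) \<phi>" using assms by (simp add: smooth_def)
  then have 1: "\<phi> differentiable (at z)" and 2: "(\<lambda>w. frechet_derivative \<phi> (at w) d) differentiable (at z)"
    and 3: "continuous_on UNIV (\<lambda>z. frechet_derivative (\<lambda>w. frechet_derivative \<phi> (at w) d) (at z) e)" for z d e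
    by auto
  show ?thesis
    unfolding C2_on_def dir_deriv_on_def
    by (intro conjI ballI cont dir 1 2 3)
qed

lemma laplacian_eq:
  "laplacian \<phi> z = frechet_derivative (\<lambda>w. frechet_derivative \<phi> (at w) 1) (at z) 1 +
     frechet_derivative (\<lambda>w. frechet_derivative \<phi> (at w) \<i>) (at z) \<i>"
  by (simp add: laplacian_def)

section \<open>Cubic B-splines\<close>

text \<open>The fourth central difference divided by 3!. It commutes with differentiation and turns
  the truncated cubic into the cubic B-spline with knots -2, ..., 2.\<close>

definition bspline :: "(real \<Rightarrow> real) \<Rightarrow> real \<Rightarrow> real" where
  "bspline c x = (c (x + 2) - 4 * c (x + 1) + 6 * c x - 4 * c (x - 1) + c (x - 2)) / 6"

text \<open>For \<open>k < 3\<close> the list entries are the truncated cubic and its first two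
  derivatives, so \<open>bump k\<close> is the \<open>k\<close>-th derivative of the B-spline. Two
  continuous derivatives are what \<open>C2_on\<close> asks for.\<close>

definition bump :: "nat \<Rightarrow> real \<Rightarrow> real" where
  "bump k = bspline ([\<lambda>x. max 0 x ^ 3, \<lambda>x. 3 * max 0 x ^ 2, \<lambda>x. 6 * max 0 x] ! k)"

lemma DERIV_max_zero_power:
  assumes "n \<ge> 1"
  shows "((\<lambda>x::real. max 0 x ^ Suc n) has_real_derivative of_nat (Suc n) * max 0 x ^ n) (at x)"
proof -
  have n0: "(0::real) ^ n = 0" using assms by simp
  consider "x < 0" | "x > 0" | "x = 0" by linarith
  then show ?thesis
  proof cases
    case 1
    have "\<forall>\<^sub>F y in nhds x. y < 0"
      using 1 eventually_nhds_in_open[of "{..<0}" x] by simp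
    then have "\<forall>\<^sub>F y in nhds x. max 0 y ^ Suc n = (0::real)"
      by eventually_elim simp
    from DERIV_cong_ev[OF refl this refl] show ?thesis using 1 assms by (simp add: zero_power)
  next
    case 2
    have "\<forall>\<^sub>F y in nhds x. y > 0"
      using 2 eventually_nhds_in_open[of "{0<..}" x] by simp
    then have "\<forall>\<^sub>F y in nhds x. max 0 y ^ Suc n = y ^ Suc n"
      by eventually_elim simp
    from DERIV_cong_ev[OF refl this refl] show ?thesis
      using 2 DERIV_pow[of "Suc n" x] by simp
  next
    case 3
    have "(\<lambda>h::real. max 0 h ^ Suc n / h) \<midarrow>0\<rightarrow> 0"
    proof (rule Lim_transform_eventually)
      have "(\<lambda>h::real. max 0 h ^ n) \<midarrow>0\<rightarrow> max 0 0 ^ n" by (intro tendsto_intros)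
      then show "(\<lambda>h::real. max 0 h ^ n) \<midarrow>0\<rightarrow> 0" by (simp only: max.idem n0)
      show "\<forall>\<^sub>F h in at 0. max 0 h ^ n = max 0 h ^ Suc n / (h::real)"
        unfolding eventually_at_filter
        by (rule always_eventually) (use assms in \<open>auto simp: max_def\<close>)
    qed
    then show ?thesis unfolding 3 DERIV_def by (simp add: n0)
  qed
qed

lemma DERIV_bspline:
  assumes "\<And>x. (c has_real_derivative c' x) (at x)"
  shows "(bspline c has_real_derivative bspline c' x) (at x)"
proof -
  have *: "((\<lambda>x. c (x + k)) has_real_derivative c' (x + k)) (at x)" for k
    using assms[of "x + k"] by (simp add: DERIV_shift)
  have "((\<lambda>x. (c (x + 2) - 4 * c (x + 1) + 6 * c (x + 0) - 4 * c (x + (-1)) + c (x + (-2))) / 6) has_real_derivative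
      (c' (x + 2) - 4 * c' (x + 1) + 6 * c' (x + 0) - 4 * c' (x + (-1)) + c' (x + (-2))) / 6) (at x)"
    by (intro DERIV_cdivide DERIV_add DERIV_diff DERIV_cmult *)
  then show ?thesis by (simp add: bspline_def[abs_def])
qed

lemma DERIV_bump: "k < 2 \<Longrightarrow> (bump k has_real_derivative bump (Suc k) x) (at x)"
proof -
  assume "k < 2"
  then consider "k = 0" | "k = 1" by linarith
  then show ?thesis
  proof cases
    case 1
    show ?thesis
      using DERIV_max_zero_power[of 2] unfolding 1 bump_def
      by (intro DERIV_bspline) (simp add: numeral_3_eq_3 numeral_2_eq_2)
  next
    case 2
    show ?thesis
      using DERIV_cmult[OF DERIV_max_zero_power[of 1], of 3] unfolding 2 bump_def
      by (intro DERIV_bspline) (simp add: numeral_2_eq_2)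
  qed
qed

lemma continuous_bump: "k < 3 \<Longrightarrow> continuous_on UNIV (bump k)"
proof -
  assume "k < 3"
  then consider "k = 0" | "k = 1" | "k = 2" by linarith
  then show ?thesis
    by cases (auto simp: bump_def bspline_def[abs_def] intro!: continuous_intros)
qed

text \<open>Left of the first knot all truncated powers vanish; right of the last one they are
  polynomials of degree at most 3, which the fourth difference annihilates. The half-open form fits
  the half-open fundamental domain.\<close>

lemma bump_zero:
  assumes "k < 3" "x < - 2 \<or> 2 \<le> x"
  shows "bump k x = 0"
proof -
  from assms(1) consider "k = 0" | "k = 1" | "k = 2" by linarith
  then show ?thesis
    using assms(2) by cases (auto simp: bump_def bspline_def max_def power2_eq_square power3_eq_cube algebra_simps)
qed

text \<open>Integer translates of a B-spline form a partition of unity, so those of its derivatives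
  cancel. On \<open>[0, 1)\<close> only the translates by -2, ..., 1 can be nonzero.\<close>

lemma bump_sum:
  assumes "k < 3" "0 \<le> x" "x < 1"
  shows "(\<Sum>i\<in>{-2..1::int}. bump k (x + of_int i)) = (if k = 0 then 1 else 0)"
proof -
  have I: "{-2..1::int} = {-2, -1, 0, 1}" by auto
  from assms(1) consider "k = 0" | "k = 1" | "k = 2" by linarith
  then show ?thesis
    using assms(2,3)
    by cases (simp_all add: I bump_def bspline_def max_def power2_eq_square power3_eq_cube field_simps)
qed

section \<open>Coordinates relative to the periods, cutoffs and folding\<close>

definition lat_fst :: "real \<Rightarrow> real \<Rightarrow> complex \<Rightarrow> real" where
  "lat_fst a b z = Re z / (4 * a) - Im z / (4 * b)"

definition lat_snd :: "real \<Rightarrow> real \<Rightarrow> complex \<Rightarrow> real" where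
  "lat_snd a b z = Re z / (4 * a) + Im z / (4 * b)"

lemma lat_coord_add:
  "lat_fst a b (z + w) = lat_fst a b z + lat_fst a b w" "lat_snd a b (z + w) = lat_snd a b z + lat_snd a b w"
  by (simp_all add: lat_fst_def lat_snd_def add_divide_distrib)

lemma lat_coord_line:
  "lat_fst a b (z + of_real t * d) = lat_fst a b z + t * lat_fst a b d"
  "lat_snd a b (z + of_real t * d) = lat_snd a b z + t * lat_snd a b d"
  by (simp_all add: lat_fst_def lat_snd_def add_divide_distrib right_diff_distrib distrib_left)

lemma lat_coord_continuous: "continuous_on UNIV (lat_fst a b)" "continuous_on UNIV (lat_snd a b)"
  unfolding lat_fst_def[abs_def] lat_snd_def[abs_def] divide_inverse by (intro continuous_intros)+

lemma lat_coord_expand: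
  assumes "a > 0" "b > 0"
  shows "z = of_real (lat_fst a b z) * (2 * \<omega>\<^sub>1 a b) + of_real (lat_snd a b z) * (2 * \<omega>\<^sub>2 a b)"
  using assms by (simp add: complex_eq_iff lat_fst_def lat_snd_def \<omega>\<^sub>1_def \<omega>\<^sub>2_def field_simps)

lemma lat_coord_unique:
  assumes "a > 0" "b > 0"
  shows "lat_fst a b (of_real s * (2 * \<omega>\<^sub>1 a b) + of_real t * (2 * \<omega>\<^sub>2 a b)) = s"
    "lat_snd a b (of_real s * (2 * \<omega>\<^sub>1 a b) + of_real t * (2 * \<omega>\<^sub>2 a b)) = t"
  using assms by (simp_all add: lat_fst_def lat_snd_def \<omega>\<^sub>1_def \<omega>\<^sub>2_def field_simps)

lemma lat_coord_lat_pt: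
  assumes "a > 0" "b > 0"
  shows "lat_fst a b (lat_pt a b (i, j)) = of_int i" "lat_snd a b (lat_pt a b (i, j)) = of_int j"
  using lat_coord_unique[OF assms, of "of_int i" "of_int j"] by (simp_all add: lat_pt_def)

lemma lat_coord_pole:
  assumes "a > 0" "b > 0"
  shows "lat_fst a b (of_real (2 * a)) = 1 / 2" "lat_snd a b (of_real (2 * a)) = 1 / 2"
  using assms by (simp_all add: lat_fst_def lat_snd_def)

abbreviation rhombus :: "real \<Rightarrow> real \<Rightarrow> complex set" where
  "rhombus a b \<equiv> fundamental_domain (2 * \<omega>\<^sub>1 a b) (2 * \<omega>\<^sub>2 a b)"

lemma mem_rhombus_iff:
  assumes "a > 0" "b > 0"
  shows "z \<in> rhombus a b \<longleftrightarrow> 0 \<le> lat_fst a b z \<and> lat_fst a b z < 1 \<and> 0 \<le> lat_snd a b z \<and> lat_snd a b z < 1"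
proof
  assume "z \<in> rhombus a b"
  then show "0 \<le> lat_fst a b z \<and> lat_fst a b z < 1 \<and> 0 \<le> lat_snd a b z \<and> lat_snd a b z < 1"
    using lat_coord_unique[OF assms] by (auto simp: fundamental_domain_def)
next
  assume "0 \<le> lat_fst a b z \<and> lat_fst a b z < 1 \<and> 0 \<le> lat_snd a b z \<and> lat_snd a b z < 1"
  then show "z \<in> rhombus a b"
    using lat_coord_expand[OF assms, of z] unfolding fundamental_domain_def by blast
qed

lemma lat_coord_measurable [measurable]:
  "lat_fst a b \<in> borel_measurable borel" "lat_snd a b \<in> borel_measurable borel"
  using lat_coord_continuous by (auto intro: borel_measurable_continuous_onI)

lemma rhombus_sets:
  assumes "a > 0" "b > 0"
  shows "rhombus a b \<in> sets borel"
proof -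
  have "rhombus a b = {z. 0 \<le> lat_fst a b z \<and> lat_fst a b z < 1 \<and> 0 \<le> lat_snd a b z \<and> lat_snd a b z < 1}"
    using mem_rhombus_iff[OF assms] by blast
  also have "\<dots> \<in> sets borel" by measurable
  finally show ?thesis .
qed

lemma norm_le_lat_coord:
  assumes "a > 0" "b > 0" "\<bar>lat_fst a b z\<bar> \<le> M" "\<bar>lat_snd a b z\<bar> \<le> M"
  shows "norm z \<le> M * (norm (2 * \<omega>\<^sub>1 a b) + norm (2 * \<omega>\<^sub>2 a b))"
proof -
  have "norm z \<le> norm (of_real (lat_fst a b z) * (2 * \<omega>\<^sub>1 a b)) + norm (of_real (lat_snd a b z) * (2 * \<omega>\<^sub>2 a b))"
    using lat_coord_expand[OF assms(1,2), of z] norm_triangle_ineq by metis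
  also have "\<dots> \<le> M * norm (2 * \<omega>\<^sub>1 a b) + M * norm (2 * \<omega>\<^sub>2 a b)"
    unfolding norm_mult[of "of_real _"] norm_of_real
    by (intro add_mono mult_right_mono assms) auto
  finally show ?thesis by (simp add: distrib_left)
qed

text \<open>The indices \<open>k\<close> and \<open>l\<close> count derivatives in the two lattice
  coordinates; the cutoff proper is \<open>cutoff a b 0 0\<close>.\<close>

definition cutoff :: "real \<Rightarrow> real \<Rightarrow> nat \<Rightarrow> nat \<Rightarrow> complex \<Rightarrow> real" where
  "cutoff a b k l z = bump k (lat_fst a b z) * bump l (lat_snd a b z)"

lemma cutoff_deriv:
  assumes "k < 2" "l < 2"
  shows "((\<lambda>t::real. cutoff a b k l (z + of_real t * d)) has_real_derivative
    lat_fst a b d * cutoff a b (Suc k) l z + lat_snd a b d * cutoff a b k (Suc l) z) (at 0)"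
proof -
  have 1: "((\<lambda>t::real. lat_fst a b z + t * lat_fst a b d) has_real_derivative lat_fst a b d) (at 0)"
    "((\<lambda>t::real. lat_snd a b z + t * lat_snd a b d) has_real_derivative lat_snd a b d) (at 0)"
    by (auto intro!: derivative_eq_intros)
  have "((\<lambda>t::real. bump k (lat_fst a b z + t * lat_fst a b d) * bump l (lat_snd a b z + t * lat_snd a b d)) has_real_derivative
      (bump (Suc k) (lat_fst a b z + 0 * lat_fst a b d) * lat_fst a b d) * bump l (lat_snd a b z + 0 * lat_snd a b d) +
      (bump (Suc l) (lat_snd a b z + 0 * lat_snd a b d) * lat_snd a b d) * bump k (lat_fst a b z + 0 * lat_fst a b d)) (at 0)"
    by (intro DERIV_mult DERIV_chain2[OF DERIV_bump] assms 1)
  then show ?thesis unfolding cutoff_def lat_coord_line by (simp add: algebra_simps)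
qed

lemma cutoff_continuous: "k < 3 \<Longrightarrow> l < 3 \<Longrightarrow> continuous_on UNIV (cutoff a b k l)"
  unfolding cutoff_def[abs_def]
  by (intro continuous_on_mult continuous_on_compose2[OF continuous_bump lat_coord_continuous(1)]
      continuous_on_compose2[OF continuous_bump lat_coord_continuous(2)]) auto

lemma C2_on_cutoff:
  "C2_on UNIV (cutoff a b 0 0)
    (\<lambda>d z. lat_fst a b d * cutoff a b 1 0 z + lat_snd a b d * cutoff a b 0 1 z)
    (\<lambda>d z. (lat_fst a b d)\<^sup>2 * cutoff a b 2 0 z + 2 * (lat_fst a b d * lat_snd a b d) * cutoff a b 1 1 z
       + (lat_snd a b d)\<^sup>2 * cutoff a b 0 2 z)"
proof -
  have 1: "((\<lambda>t::real. cutoff a b 0 0 (z + of_real t * d)) has_real_derivative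
      lat_fst a b d * cutoff a b 1 0 z + lat_snd a b d * cutoff a b 0 1 z) (at 0)" for d z
    using cutoff_deriv[of 0 0 a b z d] by simp
  have 2: "((\<lambda>t::real. lat_fst a b d * cutoff a b 1 0 (z + of_real t * d) + lat_snd a b d * cutoff a b 0 1 (z + of_real t * d))
      has_real_derivative
      (lat_fst a b d)\<^sup>2 * cutoff a b 2 0 z + 2 * (lat_fst a b d * lat_snd a b d) * cutoff a b 1 1 z
       + (lat_snd a b d)\<^sup>2 * cutoff a b 0 2 z) (at 0)" for d z
    using DERIV_add[OF DERIV_cmult[OF cutoff_deriv[of 1 0 a b z d], of "lat_fst a b d"]
        DERIV_cmult[OF cutoff_deriv[of 0 1 a b z d], of "lat_snd a b d"]]
    by (simp add: numeral_2_eq_2 algebra_simps)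
  show ?thesis
    unfolding C2_on_def dir_deriv_on_def
    by (intro conjI ballI 1 2 continuous_intros cutoff_continuous) auto
qed

lemma cutoff_zero:
  assumes "k < 3" "l < 3" "\<not> (-2 \<le> lat_fst a b z \<and> lat_fst a b z < 2 \<and> -2 \<le> lat_snd a b z \<and> lat_snd a b z < 2)"
  shows "cutoff a b k l z = 0"
  using assms bump_zero[OF assms(1), of "lat_fst a b z"] bump_zero[OF assms(2), of "lat_snd a b z"]
  by (auto simp: cutoff_def not_le not_less)

text \<open>The translates of the fundamental domain by these sixteen lattice points tile the set
  where both coordinates lie in \<open>[-2, 2)\<close>, outside which the cutoffs vanish.\<close>

abbreviation cells :: "(int \<times> int) set" where
  "cells \<equiv> {-2..1} \<times> {-2..1}"

lemma cutoff_sum: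
  assumes ab: "a > 0" "b > 0" and kl: "k < 3" "l < 3" and z: "z \<in> rhombus a b"
  shows "(\<Sum>c\<in>cells. cutoff a b k l (z + lat_pt a b c)) = (if k = 0 \<and> l = 0 then 1 else 0)"
proof -
  have "(\<Sum>c\<in>cells. cutoff a b k l (z + lat_pt a b c)) =
      (\<Sum>(i, j)\<in>cells. bump k (lat_fst a b z + of_int i) * bump l (lat_snd a b z + of_int j))"
    by (rule sum.cong) (auto simp: cutoff_def lat_coord_add lat_coord_lat_pt[OF ab])
  also have "\<dots> = (\<Sum>i\<in>{-2..1::int}. bump k (lat_fst a b z + of_int i)) * (\<Sum>j\<in>{-2..1::int}. bump l (lat_snd a b z + of_int j))"
    by (simp add: sum_product sum.cartesian_product)
  also have "\<dots> = (if k = 0 \<and> l = 0 then 1 else 0)"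
    using z kl by (simp add: bump_sum mem_rhombus_iff[OF ab])
  finally show ?thesis .
qed

lemma doubly_periodic_lat_pt:
  assumes "doubly_periodic (2 * \<omega>\<^sub>1 a b) (2 * \<omega>\<^sub>2 a b) f"
  shows "f (z + lat_pt a b c) = f z"
proof -
  have step: "f (z + of_int i * p) = f z" if "\<And>z. f (z + p) = f z" for i p z
  proof (induction i rule: int_induct[where k = 0])
    case (step1 i)
    then show ?case using that[of "z + of_int i * p"] by (simp add: algebra_simps)
  next
    case (step2 i)
    then show ?case using that[of "z + of_int (i - 1) * p"] by (simp add: algebra_simps)
  qed simp
  obtain i j where c: "c = (i, j)" by force
  have "f (z + of_int i * (2 * \<omega>\<^sub>1 a b) + of_int j * (2 * \<omega>\<^sub>2 a b)) = f (z + of_int i * (2 * \<omega>\<^sub>1 a b))"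
    by (rule step) (use assms in \<open>simp add: doubly_periodic_def\<close>)
  also have "\<dots> = f z"
    by (rule step) (use assms in \<open>simp add: doubly_periodic_def\<close>)
  finally show ?thesis by (simp add: c lat_pt_def add.assoc)
qed

text \<open>The integral is cut along the tiles and each piece is translated back to the fundamental
  domain. The one tile containing a point is found from the integer parts of its
  coordinates.\<close>

lemma integral_fold:
  assumes ab: "a > 0" "b > 0" and H: "integrable lborel H"
    and out: "\<And>z. \<not> (-2 \<le> lat_fst a b z \<and> lat_fst a b z < 2 \<and> -2 \<le> lat_snd a b z \<and> lat_snd a b z < 2) \<Longrightarrow> H z = (0::real)"
  shows "(\<integral>z. H z \<partial>lborel) = (LINT z:rhombus a b|lborel. (\<Sum>c\<in>cells. H (z + lat_pt a b c)))"
proof -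
  let ?F = "rhombus a b"
  note [measurable] = rhombus_sets[OF ab]
  have part: "integrable lborel (\<lambda>z. indicator ?F (z - lat_pt a b c) * H z)" for c
  proof (rule Bochner_Integration.integrable_bound[OF H])
    have "H \<in> borel_measurable borel" using H by auto
    then show "(\<lambda>z. indicator ?F (z - lat_pt a b c) * H z) \<in> borel_measurable lborel" by measurable
  qed (auto simp: indicator_def)
  have int: "integrable lborel (\<lambda>z. indicator ?F z * H (z + lat_pt a b c))"
    and eq: "(\<integral>z. indicator ?F z * H (z + lat_pt a b c) \<partial>lborel) = (\<integral>z. indicator ?F (z - lat_pt a b c) * H z \<partial>lborel)" for c
    using integrable_translate[OF part[of c], of "lat_pt a b c"] integral_translate[OF part[of c], of "lat_pt a b c"]
    by simp_all
  have "H z = (\<Sum>c\<in>cells. indicator ?F (z - lat_pt a b c) * H z)" for z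
  proof (cases "-2 \<le> lat_fst a b z \<and> lat_fst a b z < 2 \<and> -2 \<le> lat_snd a b z \<and> lat_snd a b z < 2")
    case True
    define c where "c = (\<lfloor>lat_fst a b z\<rfloor>, \<lfloor>lat_snd a b z\<rfloor>)"
    have c: "c \<in> cells" using True by (auto simp: c_def le_floor_iff floor_le_iff)
    have "z - lat_pt a b (i, j) \<in> ?F \<longleftrightarrow> (i, j) = c" for i j
    proof -
      have "lat_fst a b (z - lat_pt a b (i, j)) = lat_fst a b z - of_int i"
        "lat_snd a b (z - lat_pt a b (i, j)) = lat_snd a b z - of_int j"
        using lat_coord_add[of a b "z - lat_pt a b (i, j)" "lat_pt a b (i, j)"] lat_coord_lat_pt[OF ab, of i j] by simp_all
      moreover have "0 \<le> x - of_int k \<and> x - of_int k < 1 \<longleftrightarrow> \<lfloor>x\<rfloor> = k" for x :: real and k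
        unfolding floor_eq_iff by linarith
      ultimately show ?thesis
        unfolding mem_rhombus_iff[OF ab] c_def prod.inject by metis
    qed
    then have "z - lat_pt a b c' \<in> ?F \<longleftrightarrow> c' = c" for c'
      by (cases c') simp
    then have "(\<Sum>c\<in>cells. indicator ?F (z - lat_pt a b c) * H z) = (\<Sum>c'\<in>cells. if c' = c then H z else 0)"
      by (intro sum.cong) (auto simp: indicator_def)
    also have "\<dots> = H z" using c by simp
    finally show ?thesis ..
  qed (use out in simp)
  then have "(\<integral>z. H z \<partial>lborel) = (\<integral>z. (\<Sum>c\<in>cells. indicator ?F (z - lat_pt a b c) * H z) \<partial>lborel)"
    by (intro Bochner_Integration.integral_cong) auto
  also have "\<dots> = (\<Sum>c\<in>cells. \<integral>z. indicator ?F z * H (z + lat_pt a b c) \<partial>lborel)"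
    by (simp only: Bochner_Integration.integral_sum[OF part] eq)
  also have "\<dots> = (\<integral>z. (\<Sum>c\<in>cells. indicator ?F z * H (z + lat_pt a b c)) \<partial>lborel)"
    by (simp only: Bochner_Integration.integral_sum[OF int])
  also have "\<dots> = (LINT z:?F|lborel. (\<Sum>c\<in>cells. H (z + lat_pt a b c)))"
    by (simp add: set_lebesgue_integral_def sum_distrib_left)
  finally show ?thesis .
qed


subsection \<open>The Green function\<close>

text \<open>Taking the mixed coefficient to be 0 is no restriction: by
  \<open>periodic_correction_unique\<close> every admissible triple equals the one found by
  \<open>exists_periodic_correction\<close>.\<close>

locale periodic_correction =
  fixes a b A B :: real
  assumes a_pos: "a > 0" and b_pos: "b > 0"
    and periodic: "doubly_periodic (2 * \<omega>\<^sub>1 a b) (2 * \<omega>\<^sub>2 a b) (sym_Z_hat a b A B 0)"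
begin

abbreviation P :: "complex set" where "P \<equiv> sym_poles a b"
abbreviation G :: "complex \<Rightarrow> ereal" where "G \<equiv> sym_G a b A B"

text \<open>At the poles \<open>g\<close> is 0, since \<open>real_of_ereal\<close> maps infinity to
  0. The poles are countable, hence a null set, and integrals do not see this value.\<close>

definition g :: "complex \<Rightarrow> real" where
  "g z = real_of_ereal (G z)"

sublocale double_poles P "shifted_P a b"
  by (rule double_poles_shifted_P[OF a_pos b_pos])

lemma G_eq: "z \<notin> P \<Longrightarrow> G z = ereal (g z)"
  "z \<notin> P \<Longrightarrow> g z = - 1 / (2 * pi) * logabs_sigma a b z + (A * (Re z)\<^sup>2 + B * (Im z)\<^sup>2)"
  "z \<in> P \<Longrightarrow> G z = \<infinity>"
  by (simp_all add: g_def sym_G_def sym_Z_eq[OF a_pos b_pos])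

lemma G_periodic: "doubly_periodic (2 * \<omega>\<^sub>1 a b) (2 * \<omega>\<^sub>2 a b) G"
proof -
  have "sym_Z_hat a b A B 0 = G"
    by (simp add: sym_Z_hat_def[abs_def] sym_G_def[abs_def])
  then show ?thesis using periodic by simp
qed

lemma G_zero: "G 0 = 0"
  using G_eq(1,2)[OF zero_notin] logabs_0 by (simp add: logabs_sigma_def)

text \<open>The regular part \<open>h\<close> has constant Laplacian, because its holomorphic
  contribution is harmonic and only the quadratic form remains.\<close>

lemma g_local:
  assumes "R > 0"
  shows "\<exists>S h H HH. finite S \<and> P \<inter> ball 0 R \<subseteq> S \<and> S \<subseteq> P \<and> C2_on (ball 0 R) h H HH \<and>
    (\<forall>z. HH 1 z + HH \<i> z = 2 * A + 2 * B) \<and>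
    (\<forall>z\<in>ball 0 R - P. g z = - 1 / (2 * pi) * (\<Sum>p\<in>S. ln (cmod (z - p))) + h z)"
proof -
  obtain S W where S: "finite S" "P \<inter> ball 0 R \<subseteq> S" "S \<subseteq> P" and W: "W holomorphic_on ball 0 R"
    and L: "\<And>z. z \<in> ball 0 R - P \<Longrightarrow> logabs z = (\<Sum>p\<in>S. ln (cmod (z - p))) + Re (W z)"
    using logabs_local[OF assms] by blast
  define h where "h z = - 1 / (2 * pi) * Re (W z) + (A * (Re z)\<^sup>2 + B * (Im z)\<^sup>2)" for z
  define H where "H d z = - 1 / (2 * pi) * Re (deriv W z * d) + (2 * A * Re z * Re d + 2 * B * Im z * Im d)" for d z
  define HH where "HH d z = - 1 / (2 * pi) * Re (deriv (deriv W) z * d * d) + (2 * A * (Re d)\<^sup>2 + 2 * B * (Im d)\<^sup>2)" for d z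
  have "C2_on (ball 0 R) h H HH"
    unfolding h_def[abs_def] H_def[abs_def] HH_def[abs_def]
    by (intro C2_on_add C2_on_cmult C2_on_Re_holomorphic[OF open_ball W] C2_on_quadratic)
  moreover have "HH 1 z + HH \<i> z = 2 * A + 2 * B" for z
    by (simp add: HH_def)
  moreover have "g z = - 1 / (2 * pi) * (\<Sum>p\<in>S. ln (cmod (z - p))) + h z" if "z \<in> ball 0 R - P" for z
    using that unfolding h_def by (simp only: G_eq(2) logabs_sigma_def L Diff_iff distrib_left add.assoc not_False_eq_True)
  ultimately show ?thesis using S by blast
qed

text \<open>Near a pole only its own logarithm is singular, and the negative factor in front of it
  drives the function to plus infinity, the value assigned there. All other terms are collected in
  \<open>k\<close>, which is continuous at the pole.\<close>

lemma isCont_G: "isCont G z"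
proof (cases "z \<in> P")
  case False
  have "isCont (\<lambda>z. ereal (- 1 / (2 * pi) * logabs z + (A * (Re z)\<^sup>2 + B * (Im z)\<^sup>2))) z"
    using has_derivative_continuous[OF logabs_deriv[OF False]]
    by (intro continuous_intros) auto
  moreover have "\<forall>\<^sub>F w in nhds z. w \<in> - P"
    using closed_poles False by (intro eventually_nhds_in_open) auto
  then have "\<forall>\<^sub>F w in nhds z. G w = ereal (- 1 / (2 * pi) * logabs w + (A * (Re w)\<^sup>2 + B * (Im w)\<^sup>2))"
    by eventually_elim (simp add: G_eq logabs_sigma_def)
  ultimately show ?thesis by (subst isCont_cong) auto
next
  case True
  define R where "R = norm z + 1"
  have R: "R > 0" "z \<in> ball 0 R" by (auto simp: R_def add_nonneg_pos)
  obtain S h H HH where S: "finite S" "P \<inter> ball 0 R \<subseteq> S" "S \<subseteq> P" and h: "C2_on (ball 0 R) h H HH"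
    and g: "\<And>z. z \<in> ball 0 R - P \<Longrightarrow> g z = - 1 / (2 * pi) * (\<Sum>p\<in>S. ln (cmod (z - p))) + h z"
    using g_local[OF R(1)] by blast
  have zS: "z \<in> S" using S True R by auto
  define k where "k w = - 1 / (2 * pi) * (\<Sum>p\<in>S - {z}. ln (cmod (w - p))) + h w" for w
  have "isCont h z"
    using C2_on_continuous(1)[OF h] R by (simp add: continuous_on_eq_continuous_at)
  then have "isCont k z"
    unfolding k_def by (intro continuous_intros) auto
  then have k: "(k \<longlongrightarrow> k z) (at z)" by (rule isContD)
  have "filterlim (\<lambda>w. cmod (w - z)) (at_right 0) (at z)"
    unfolding filterlim_at
    by (auto intro!: tendsto_eq_intros simp: eventually_at_filter)
  then have "filterlim (\<lambda>w. ln (cmod (w - z))) at_bot (at z)"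
    by (rule filterlim_compose[OF ln_at_0])
  then have "filterlim (\<lambda>w. 1 / (2 * pi) * - ln (cmod (w - z))) at_top (at z)"
    by (intro filterlim_tendsto_pos_mult_at_top[OF tendsto_const])
       (simp_all add: filterlim_uminus_at_bot)
  from filterlim_tendsto_add_at_top[OF k this]
  have "((\<lambda>w. ereal (k w + 1 / (2 * pi) * - ln (cmod (w - z)))) \<longlongrightarrow> \<infinity>) (at z)"
    by (simp only: tendsto_PInfty_eq_at_top)
  moreover have "\<forall>\<^sub>F w in at z. ereal (k w + 1 / (2 * pi) * - ln (cmod (w - z))) = G w"
  proof -
    have "\<forall>\<^sub>F w in at z. w \<in> ball 0 R - (S - {z}) - {z}"
      using R S by (intro eventually_at_in_open) (auto intro: finite_imp_closed)
    then show ?thesis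
    proof eventually_elim
      case (elim w)
      then have w: "w \<in> ball 0 R - P" using S by auto
      have "g w = k w + 1 / (2 * pi) * - ln (cmod (w - z))"
        unfolding g[OF w] k_def sum.remove[OF S(1) zS] by (simp add: algebra_simps)
      then show ?case using w by (simp add: G_eq(1))
    qed
  qed
  ultimately have "(G \<longlongrightarrow> \<infinity>) (at z)"
    by (rule Lim_transform_eventually)
  then show ?thesis using True by (simp add: isCont_def G_eq(3))
qed

lemma continuous_G: "continuous_on UNIV G"
  by (intro continuous_at_imp_continuous_on ballI isCont_G)

lemma g_measurable [measurable]: "g \<in> borel_measurable borel"
  unfolding g_def[abs_def]
  using borel_measurable_continuous_onI[OF continuous_G] by measurable

lemma AE_not_pole: "AE z in lborel. z \<notin> P"
  using countable_imp_null_set_lborel[OF countable_poles] by (rule AE_not_in)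

lemma set_integrable_g:
  assumes K: "compact K"
  shows "set_integrable lborel K g"
proof -
  obtain R where R: "R > 0" "K \<subseteq> ball 0 R"
    using bounded_subset_ballD[OF compact_imp_bounded[OF K], of 0] by blast
  obtain S h H HH where S: "finite S" and h: "C2_on (ball 0 R) h H HH"
    and g: "\<And>z. z \<in> ball 0 R - P \<Longrightarrow> g z = - 1 / (2 * pi) * (\<Sum>p\<in>S. ln (cmod (z - p))) + h z"
    using g_local[OF R(1)] by blast
  have "K \<in> sets borel" using compact_imp_closed[OF K] by (rule borel_closed)
  then have meas: "(\<lambda>z. indicator K z *\<^sub>R g z) \<in> borel_measurable lborel"
    using borel_measurable_times[OF borel_measurable_indicator g_measurable] by simp
  have "integrable lborel (\<lambda>z. indicator K z *\<^sub>R h z)"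
    using C2_on_continuous(1)[OF h] R K by (intro borel_integrable_compact) (auto intro: continuous_on_subset)
  moreover have "integrable lborel (\<lambda>z. - 1 / (2 * pi) * (\<Sum>p\<in>S. indicator K z *\<^sub>R ln (cmod (z - p))))"
    using set_integrable_ln_norm[OF K]
    by (intro integrable_mult_right Bochner_Integration.integrable_sum) (simp add: set_integrable_def)
  ultimately have int: "integrable lborel (\<lambda>z. - 1 / (2 * pi) * (\<Sum>p\<in>S. indicator K z *\<^sub>R ln (cmod (z - p))) + indicator K z *\<^sub>R h z)"
    by (intro Bochner_Integration.integrable_add)
  have "AE z in lborel. - 1 / (2 * pi) * (\<Sum>p\<in>S. indicator K z *\<^sub>R ln (cmod (z - p))) + indicator K z *\<^sub>R h z
      = indicator K z *\<^sub>R g z"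
    using AE_not_pole
  proof eventually_elim
    case (elim z)
    show ?case
    proof (cases "z \<in> K")
      case True
      then show ?thesis using elim R g[of z] by auto
    qed simp
  qed
  then show ?thesis
    unfolding set_integrable_def by (rule integrable_cong_AE_imp[OF int meas])
qed

text \<open>Serves both the plane, where \<open>f\<close> is a test function, and the torus, where
  it is a cutoff times a periodic function. The set \<open>S'\<close> lets each application choose
  its own finite list of poles.\<close>

lemma laplacian_g:
  assumes f: "C2_on UNIV f D DD" and K: "compact K" "\<And>z. z \<notin> K \<Longrightarrow> f z = 0"
    and S': "finite S'" "S' \<subseteq> P" "\<And>p. p \<in> P - S' \<Longrightarrow> f p = 0"
  shows "integrable lborel (\<lambda>z. g z * (DD 1 z + DD \<i> z))"
    "(\<integral>z. g z * (DD 1 z + DD \<i> z) \<partial>lborel) = - (\<Sum>p\<in>S'. f p) + (2 * A + 2 * B) * (\<integral>z. f z \<partial>lborel)"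
proof -
  define lap where "lap z = DD 1 z + DD \<i> z" for z
  have clK: "closed K" using K(1) by (rule compact_imp_closed)
  have lap_cont: "continuous_on UNIV lap"
    unfolding lap_def[abs_def] using C2_on_continuous(3)[OF f] by (intro continuous_intros) auto
  have lap_out: "lap z = 0" if "z \<notin> K" for z
    using C2_on_zero_outside(2)[OF f clK K(2) _ that] by (simp add: lap_def)
  have [measurable]: "lap \<in> borel_measurable borel"
    using lap_cont by (rule borel_measurable_continuous_onI)
  then have meas: "(\<lambda>z. g z * lap z) \<in> borel_measurable lborel"
    using borel_measurable_times[OF g_measurable] by simp
  obtain R where R: "R > 0" "K \<subseteq> ball 0 R"
    using bounded_subset_ballD[OF compact_imp_bounded[OF K(1)], of 0] by blast
  obtain S h H HH where S: "finite S" "P \<inter> ball 0 R \<subseteq> S" "S \<subseteq> P" and h: "C2_on (ball 0 R) h H HH"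
    and HH: "\<And>z. HH 1 z + HH \<i> z = 2 * A + 2 * B"
    and g: "\<And>z. z \<in> ball 0 R - P \<Longrightarrow> g z = - 1 / (2 * pi) * (\<Sum>p\<in>S. ln (cmod (z - p))) + h z"
    using g_local[OF R(1)] by blast
  let ?L = "\<lambda>z. - 1 / (2 * pi) * (\<Sum>p\<in>S. ln (cmod (z - p)) * lap z) + h z * lap z"
  have AE: "AE z in lborel. ?L z = g z * lap z"
    using AE_not_pole
  proof eventually_elim
    case (elim z)
    show ?case
    proof (cases "z \<in> K")
      case True
      then have z: "z \<in> ball 0 R - P" using elim R by auto
      show ?thesis unfolding g[OF z] by (simp only: distrib_right sum_distrib_right mult.assoc)
    qed (simp add: lap_out)
  qed
  have int_ln: "integrable lborel (\<lambda>z. ln (cmod (z - p)) * lap z)" for p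
    by (rule integrable_ln_norm_mult[OF lap_cont K(1) lap_out])
  have int_h: "integrable lborel (\<lambda>z. h z * lap z)"
    unfolding lap_def by (rule integral_laplacian_by_parts(1)[OF open_ball K(1) R(2) f _ h]) (rule K(2))
  have int_L: "integrable lborel ?L"
    by (intro Bochner_Integration.integrable_add integrable_mult_right Bochner_Integration.integrable_sum int_ln int_h)
  show "integrable lborel (\<lambda>z. g z * (DD 1 z + DD \<i> z))"
    unfolding lap_def[symmetric]
    by (rule integrable_cong_AE_imp[OF int_L meas AE])
  have "(\<integral>z. g z * lap z \<partial>lborel) = (\<integral>z. ?L z \<partial>lborel)"
    using int_L AE by (intro integral_cong_AE) (auto simp: eq_commute meas)
  also have "\<dots> = - 1 / (2 * pi) * (\<Sum>p\<in>S. \<integral>z. ln (cmod (z - p)) * lap z \<partial>lborel) + (\<integral>z. h z * lap z \<partial>lborel)"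
    by (subst Bochner_Integration.integral_add)
       (use int_ln int_h in \<open>auto simp: Bochner_Integration.integral_sum intro!: integrable_mult_right Bochner_Integration.integrable_sum\<close>)
  also have "(\<integral>z. h z * lap z \<partial>lborel) = (\<integral>z. (HH 1 z + HH \<i> z) * f z \<partial>lborel)"
    unfolding lap_def by (rule integral_laplacian_by_parts(2)[OF open_ball K(1) R(2) f _ h]) (rule K(2))
  also have "\<dots> = (2 * A + 2 * B) * (\<integral>z. f z \<partial>lborel)"
    unfolding HH by simp
  also have "(\<Sum>p\<in>S. \<integral>z. ln (cmod (z - p)) * lap z \<partial>lborel) = (\<Sum>p\<in>S. 2 * pi * f p)"
    unfolding lap_def by (intro sum.cong refl integral_ln_laplacian[OF K(1) f]) (rule K(2))
  also have "- 1 / (2 * pi) * (\<Sum>p\<in>S. 2 * pi * f p) = - (\<Sum>p\<in>S. f p)"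
    by (simp add: sum_distrib_left[symmetric])
  \<comment> \<open>On \<open>S' - S\<close> the function vanishes because those poles lie outside
    the disc containing \<open>K\<close>; on \<open>S - S'\<close> it vanishes by the hypothesis on
    \<open>S'\<close>.\<close>
  also have "(\<Sum>p\<in>S. f p) = (\<Sum>p\<in>S \<union> S'. f p)"
  proof (rule sum.mono_neutral_left)
    show "\<forall>p\<in>S \<union> S' - S. f p = 0"
      using S S' R K(2) by (metis Diff_iff IntI UnE subsetD)
  qed (use S S' in auto)
  also have "(\<Sum>p\<in>S \<union> S'. f p) = (\<Sum>p\<in>S'. f p)"
    by (rule sum.mono_neutral_right) (use S S' in auto)
  finally show "(\<integral>z. g z * (DD 1 z + DD \<i> z) \<partial>lborel) = - (\<Sum>p\<in>S'. f p) + (2 * A + 2 * B) * (\<integral>z. f z \<partial>lborel)"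
    by (simp only: lap_def)
qed

lemma g_lat_pt: "g (z + lat_pt a b c) = g z"
  unfolding g_def doubly_periodic_lat_pt[OF G_periodic] ..

lemma rhombus_subset_cball: "\<exists>M. rhombus a b \<subseteq> cball 0 M"
proof -
  have "z \<in> cball 0 (1 * (norm (2 * \<omega>\<^sub>1 a b) + norm (2 * \<omega>\<^sub>2 a b)))" if "z \<in> rhombus a b" for z
    using norm_le_lat_coord[OF a_pos b_pos, of z 1] that by (auto simp: mem_rhombus_iff[OF a_pos b_pos])
  then show ?thesis by blast
qed

lemma set_integrable_rhombus:
  fixes f :: "complex \<Rightarrow> real"
  assumes "\<And>K. compact K \<Longrightarrow> set_integrable lborel K f"
  shows "set_integrable lborel (rhombus a b) f"
proof -
  obtain M where M: "rhombus a b \<subseteq> cball 0 M" using rhombus_subset_cball by blast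
  have "set_integrable lborel (cball 0 M) f" by (rule assms) simp
  then show ?thesis
    by (rule set_integrable_subset[OF _ _ M]) (simp add: rhombus_sets[OF a_pos b_pos])
qed

text \<open>The identity in the plane is applied to the cutoff times \<open>f\<close>. When the
  integral is folded, the translated cutoffs add up to 1 and their derivatives to 0, so by the
  product rule only the derivatives of \<open>f\<close> survive.\<close>

lemma laplacian_g_torus:
  assumes f: "C2_on UNIV f D DD" and per: "\<And>c z. f (z + lat_pt a b c) = f z"
  shows "(LINT z:rhombus a b|lborel. g z * (DD 1 z + DD \<i> z)) =
    - f (of_real (2 * a)) + (2 * A + 2 * B) * (LINT z:rhombus a b|lborel. f z)"
proof -
  note ab = a_pos b_pos
  note pole = lat_coord_pole[OF ab, unfolded of_real_mult of_real_numeral]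
  define X where "X d z = lat_fst a b d * cutoff a b 1 0 z + lat_snd a b d * cutoff a b 0 1 z" for d z
  define XX where "XX d z = (lat_fst a b d)\<^sup>2 * cutoff a b 2 0 z + 2 * (lat_fst a b d * lat_snd a b d) * cutoff a b 1 1 z
       + (lat_snd a b d)\<^sup>2 * cutoff a b 0 2 z" for d z
  define \<eta> where "\<eta> = cutoff a b 0 0"
  define E where "E d z = X d z * f z + \<eta> z * D d z" for d z
  define EE where "EE d z = XX d z * f z + 2 * (X d z * D d z) + \<eta> z * DD d z" for d z
  have C2: "C2_on UNIV (\<lambda>z. \<eta> z * f z) E EE"
    unfolding E_def[abs_def] EE_def[abs_def] \<eta>_def X_def XX_def
    by (rule C2_on_mult[OF C2_on_cutoff f])
  let ?in = "\<lambda>z. -2 \<le> lat_fst a b z \<and> lat_fst a b z < 2 \<and> -2 \<le> lat_snd a b z \<and> lat_snd a b z < 2"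
  have out: "\<eta> z = 0" "X d z = 0" "XX d z = 0" if "\<not> ?in z" for z d
    using cutoff_zero[OF _ _ that] by (simp_all add: \<eta>_def X_def XX_def)
  define K where "K = cball (0::complex) (2 * (norm (2 * \<omega>\<^sub>1 a b) + norm (2 * \<omega>\<^sub>2 a b)))"
  have K: "compact K" "\<And>z. z \<notin> K \<Longrightarrow> \<eta> z * f z = 0"
  proof -
    fix z assume "z \<notin> K"
    then have "\<not> ?in z" using norm_le_lat_coord[OF ab, of z 2] by (auto simp: K_def abs_le_iff)
    then show "\<eta> z * f z = 0" by (simp add: out)
  qed (simp add: K_def)
  have sums: "(\<Sum>c\<in>cells. \<eta> (z + lat_pt a b c)) = 1" "(\<Sum>c\<in>cells. X d (z + lat_pt a b c)) = 0"
    "(\<Sum>c\<in>cells. XX d (z + lat_pt a b c)) = 0" if "z \<in> rhombus a b" for z d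
    unfolding \<eta>_def X_def XX_def sum.distrib sum_distrib_left[symmetric]
    using that by (simp_all add: cutoff_sum[OF ab])
  let ?pt = "\<lambda>c. of_real (2 * a) + lat_pt a b c"
  define S' where "S' = ?pt ` cells"
  have inj: "inj_on ?pt cells"
    using inj_lat_pt[OF ab] by (auto simp: inj_on_def)
  have "finite S'" by (simp add: S'_def)
  moreover have "S' \<subseteq> P" by (auto simp: S'_def sym_poles_eq Lambda_eq)
  \<comment> \<open>The pole with indices \<open>i\<close> and \<open>j\<close> has coordinates
    \<open>i + 1/2\<close> and \<open>j + 1/2\<close>, so for indices outside \<open>cells\<close>
    it lies outside the box where the cutoff can be nonzero.\<close>
  moreover have "\<eta> p * f p = 0" if p: "p \<in> P - S'" for p
  proof -
    obtain i j where ij: "p = ?pt (i, j)" using p by (auto simp: sym_poles_eq Lambda_eq)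
    then have "(i, j) \<notin> cells" using p by (auto simp: S'_def)
    then have "\<not> ?in p"
      by (auto simp: ij lat_coord_add pole lat_coord_lat_pt[OF ab])
    then show ?thesis by (simp add: out)
  qed
  ultimately have int: "integrable lborel (\<lambda>z. g z * (EE 1 z + EE \<i> z))"
    and eq: "(\<integral>z. g z * (EE 1 z + EE \<i> z) \<partial>lborel) =
      - (\<Sum>p\<in>S'. \<eta> p * f p) + (2 * A + 2 * B) * (\<integral>z. \<eta> z * f z \<partial>lborel)"
    using laplacian_g[OF C2 K] by blast+
  have "(\<integral>z. g z * (EE 1 z + EE \<i> z) \<partial>lborel) =
      (LINT z:rhombus a b|lborel. (\<Sum>c\<in>cells. g (z + lat_pt a b c) * (EE 1 (z + lat_pt a b c) + EE \<i> (z + lat_pt a b c))))"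
    by (rule integral_fold[OF ab int]) (simp add: out EE_def)
  also have "\<dots> = (LINT z:rhombus a b|lborel. g z * (DD 1 z + DD \<i> z))"
  proof (rule set_lebesgue_integral_cong)
    show "\<forall>z. z \<in> rhombus a b \<longrightarrow> (\<Sum>c\<in>cells. g (z + lat_pt a b c) * (EE 1 (z + lat_pt a b c) + EE \<i> (z + lat_pt a b c)))
        = g z * (DD 1 z + DD \<i> z)"
    proof (intro allI impI)
      fix z assume z: "z \<in> rhombus a b"
      have "(\<Sum>c\<in>cells. EE d (z + lat_pt a b c)) = DD d z" if d: "d \<in> {1, \<i>}" for d
      proof -
        have "(\<Sum>c\<in>cells. EE d (z + lat_pt a b c)) =
          (\<Sum>c\<in>cells. XX d (z + lat_pt a b c) * f z + X d (z + lat_pt a b c) * (2 * D d z) + \<eta> (z + lat_pt a b c) * DD d z)"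
          by (rule sum.cong) (simp_all add: EE_def per C2_on_periodic[OF f per d])
        then show ?thesis
          by (simp only: sum.distrib sum_distrib_right[symmetric] sums[OF z])
      qed
      then have "(\<Sum>c\<in>cells. EE 1 (z + lat_pt a b c) + EE \<i> (z + lat_pt a b c)) = DD 1 z + DD \<i> z"
        by (simp add: sum.distrib)
      then show "(\<Sum>c\<in>cells. g (z + lat_pt a b c) * (EE 1 (z + lat_pt a b c) + EE \<i> (z + lat_pt a b c)))
          = g z * (DD 1 z + DD \<i> z)"
        by (simp only: g_lat_pt sum_distrib_left[symmetric])
    qed
  qed (simp add: rhombus_sets[OF ab])
  finally have 1: "(\<integral>z. g z * (EE 1 z + EE \<i> z) \<partial>lborel) = (LINT z:rhombus a b|lborel. g z * (DD 1 z + DD \<i> z))" .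
  have int': "integrable lborel (\<lambda>z. \<eta> z * f z)"
    by (rule integrable_compact_support[OF C2_on_continuous(1)[OF C2] K])
  have "(\<integral>z. \<eta> z * f z \<partial>lborel) = (LINT z:rhombus a b|lborel. (\<Sum>c\<in>cells. \<eta> (z + lat_pt a b c) * f (z + lat_pt a b c)))"
    by (rule integral_fold[OF ab int']) (simp add: out)
  also have "\<dots> = (LINT z:rhombus a b|lborel. f z)"
    by (rule set_lebesgue_integral_cong) (auto simp: rhombus_sets[OF ab] per sum_distrib_right[symmetric] sums)
  finally have 2: "(\<integral>z. \<eta> z * f z \<partial>lborel) = (LINT z:rhombus a b|lborel. f z)" .
  \<comment> \<open>The base pole lies in the fundamental domain, so the cutoff weights of its
    translates add up to 1 and a single unit mass remains.\<close>
  have "of_real (2 * a) \<in> rhombus a b"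
    by (simp add: mem_rhombus_iff[OF ab] pole)
  then have 3: "(\<Sum>p\<in>S'. \<eta> p * f p) = f (of_real (2 * a))"
    unfolding S'_def by (subst sum.reindex[OF inj]) (simp add: per sum_distrib_right[symmetric] sums)
  show ?thesis using eq unfolding 1 2 3 .
qed

lemma torus_area_eq: "torus_area (2 * \<omega>\<^sub>1 a b) (2 * \<omega>\<^sub>2 a b) * (2 * A + 2 * B) = 1"
proof -
  have "C2_on UNIV (\<lambda>_. 1) (\<lambda>_ _. 0) (\<lambda>_ _. 0)"
    by (auto simp: C2_on_def dir_deriv_on_def)
  from laplacian_g_torus[OF this] have "(2 * A + 2 * B) * (LINT z:rhombus a b|lborel. 1) = 1"
    by (simp add: set_lebesgue_integral_def)
  moreover have "(LINT z:rhombus a b|lborel. (1::real)) = torus_area (2 * \<omega>\<^sub>1 a b) (2 * \<omega>\<^sub>2 a b)"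
    by (simp add: set_lebesgue_integral_def torus_area_def)
  ultimately show ?thesis by (simp add: mult.commute)
qed

text \<open>A product equal to 1 has nonzero factors, which justifies the division by the
  area.\<close>

lemma quadratic_laplacian: "2 * A + 2 * B = 1 / torus_area (2 * \<omega>\<^sub>1 a b) (2 * \<omega>\<^sub>2 a b)"
  using torus_area_eq by (metis mult_zero_left nonzero_mult_div_cancel_left zero_neq_one)

lemma green_function: "is_green_function (2 * \<omega>\<^sub>1 a b) (2 * \<omega>\<^sub>2 a b) (of_real (2 * a)) G"
  unfolding is_green_function_def g_def[symmetric]
proof (intro conjI allI impI)
  show "doubly_periodic (2 * \<omega>\<^sub>1 a b) (2 * \<omega>\<^sub>2 a b) G" by (rule G_periodic)
  show "continuous_on UNIV G" by (rule continuous_G)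
  show "set_integrable lborel (rhombus a b) g"
    by (rule set_integrable_rhombus[OF set_integrable_g])
  fix \<phi> assume "smooth \<phi> \<and> doubly_periodic (2 * \<omega>\<^sub>1 a b) (2 * \<omega>\<^sub>2 a b) \<phi>"
  then show "(LINT z:rhombus a b|lborel. g z * laplacian \<phi> z) = - dirac (of_real (2 * a)) \<phi> +
      1 / torus_area (2 * \<omega>\<^sub>1 a b) (2 * \<omega>\<^sub>2 a b) * (LINT z:rhombus a b|lborel. \<phi> z)"
    unfolding laplacian_eq quadratic_laplacian[symmetric] dirac_def
    by (intro laplacian_g_torus[OF smooth_C2_on doubly_periodic_lat_pt]) auto
qed

lemma distr_laplacian:
  "has_distr_laplacian G
     (\<lambda>\<phi>. - (\<Sum>\<^sub>\<infinity>(m, n)\<in>(UNIV :: (int \<times> int) set).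
                dirac (of_real (2 * a) + 2 * of_int m * \<omega>\<^sub>1 a b + 2 * of_int n * \<omega>\<^sub>2 a b) \<phi>)
          + 1 / torus_area (2 * \<omega>\<^sub>1 a b) (2 * \<omega>\<^sub>2 a b) * (LINT z|lborel. \<phi> z))"
  (is "has_distr_laplacian G (\<lambda>\<phi>. - ?D \<phi> + _)")
  unfolding has_distr_laplacian_def locally_integrable_def g_def[symmetric]
proof (intro conjI allI impI)
  show "set_integrable lborel K g" if "compact K" for K
    using that by (rule set_integrable_g)
  fix \<phi> assume \<phi>: "test_function \<phi>"
  define K where "K = closure {z. \<phi> z \<noteq> 0}"
  have "compact K"
    using \<phi> by (simp add: K_def test_function_def)
  moreover have "\<phi> z = 0" if "z \<notin> K" for z
    using that closure_subset[of "{z. \<phi> z \<noteq> 0}"] by (auto simp: K_def)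
  ultimately have K: "compact K" "\<And>z. z \<notin> K \<Longrightarrow> \<phi> z = 0" by auto
  have C2: "C2_on UNIV \<phi> (\<lambda>d z. frechet_derivative \<phi> (at z) d)
      (\<lambda>d z. frechet_derivative (\<lambda>w. frechet_derivative \<phi> (at w) d) (at z) d)"
    using \<phi> by (intro smooth_C2_on) (simp add: test_function_def)
  obtain R where R: "K \<subseteq> ball 0 R"
    using bounded_subset_ballD[OF compact_imp_bounded[OF \<open>compact K\<close>], of 0] by blast
  \<comment> \<open>A disc around the support contains only finitely many poles, so the infinite sum
    of point masses reduces to a finite one.\<close>
  define S' where "S' = {p \<in> P. norm p \<le> R}"
  have S': "finite S'" "S' \<subseteq> P" "\<And>p. p \<in> P - S' \<Longrightarrow> \<phi> p = 0"
    using R K(2) locally_finite[of R] by (force simp: S'_def)+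
  have inj: "inj (\<lambda>c. of_real (2 * a) + lat_pt a b c)"
    using inj_lat_pt[OF a_pos b_pos] by (auto simp: inj_def)
  have "?D \<phi> = (\<Sum>\<^sub>\<infinity>c\<in>UNIV. \<phi> (of_real (2 * a) + lat_pt a b c))"
    by (intro infsum_cong) (auto simp: dirac_def lat_pt_def algebra_simps)
  also have "\<dots> = infsum \<phi> (range (\<lambda>c. of_real (2 * a) + lat_pt a b c))"
    by (subst infsum_reindex[OF inj]) (simp add: o_def)
  also have "range (\<lambda>c. of_real (2 * a) + lat_pt a b c) = P"
    by (auto simp: sym_poles_eq Lambda_eq)
  also have "infsum \<phi> P = infsum \<phi> S'"
    by (rule infsum_cong_neutral) (use S' in auto)
  also have "\<dots> = (\<Sum>p\<in>S'. \<phi> p)"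
    using S'(1) by simp
  finally have sum: "?D \<phi> = (\<Sum>p\<in>S'. \<phi> p)" .
  show "(LINT z|lborel. g z * laplacian \<phi> z) = - ?D \<phi> + 1 / torus_area (2 * \<omega>\<^sub>1 a b) (2 * \<omega>\<^sub>2 a b) * (LINT z|lborel. \<phi> z)"
    unfolding sum laplacian_eq quadratic_laplacian[symmetric]
    by (rule laplacian_g(2)[OF C2 K S'])
qed

end

theorem theorem2p3:
  fixes a b :: real
  assumes "a > 0" and "b > 0"
  shows "(\<exists>!(A, B, C). doubly_periodic (2 * \<omega>\<^sub>1 a b) (2 * \<omega>\<^sub>2 a b) (sym_Z_hat a b A B C)) \<and>
    (\<forall>A B C. doubly_periodic (2 * \<omega>\<^sub>1 a b) (2 * \<omega>\<^sub>2 a b) (sym_Z_hat a b A B C) \<longrightarrow>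
       is_green_function (2 * \<omega>\<^sub>1 a b) (2 * \<omega>\<^sub>2 a b) (of_real (2 * a)) (sym_G a b A B) \<and>
       sym_G a b A B 0 = 0 \<and>
       has_distr_laplacian (sym_G a b A B)
         (\<lambda>\<phi>. - (\<Sum>\<^sub>\<infinity>(m, n)\<in>(UNIV :: (int \<times> int) set).
                    dirac (of_real (2 * a) + 2 * of_int m * \<omega>\<^sub>1 a b + 2 * of_int n * \<omega>\<^sub>2 a b) \<phi>)
              + 1 / torus_area (2 * \<omega>\<^sub>1 a b) (2 * \<omega>\<^sub>2 a b) * (LINT z|lborel. \<phi> z)))"
proof -
  obtain A0 B0 where per: "doubly_periodic (2 * \<omega>\<^sub>1 a b) (2 * \<omega>\<^sub>2 a b) (sym_Z_hat a b A0 B0 0)"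
    using exists_periodic_correction[OF assms] by blast
  interpret periodic_correction a b A0 B0
    by unfold_locales (use assms per in auto)
  note unique = periodic_correction_unique[OF assms per]
  have "\<exists>!(A, B, C). doubly_periodic (2 * \<omega>\<^sub>1 a b) (2 * \<omega>\<^sub>2 a b) (sym_Z_hat a b A B C)"
  proof (rule ex1I[of _ "(A0, B0, 0)"])
    show "case (A0, B0, 0) of (A, B, C) \<Rightarrow> doubly_periodic (2 * \<omega>\<^sub>1 a b) (2 * \<omega>\<^sub>2 a b) (sym_Z_hat a b A B C)"
      using per by (simp only: prod.case)
    fix x
    assume "case x of (A, B, C) \<Rightarrow> doubly_periodic (2 * \<omega>\<^sub>1 a b) (2 * \<omega>\<^sub>2 a b) (sym_Z_hat a b A B C)"
    then show "x = (A0, B0, 0)"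
      by (cases x) (simp only: prod.case prod.inject unique)
  qed
  then show ?thesis
  proof (rule conjI, intro allI impI, goal_cases)
    case (1 A B C)
    then have "A = A0" "B = B0" using unique by auto
    then show ?case using green_function G_zero distr_laplacian by blast
  qed
qed


end
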